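(* Let $\Omega$ and $\Omega'$ be bounded domains in $\mathbb{C}^d$ and let $\Phi=(\phi_1,\dots,\phi_d):\Omega\to\Omega'$ be a holomorphic proper map. Then $\mathcal{V}^*(\Phi,\Omega)$ is nontrivial (i.e. $\neq\mathbb{C}I$) if and only if $\Phi$ is not biholomorphic.
   Context: A holomorphic map $\Phi:\Omega\to\Omega'$ is proper if $\Phi^{-1}(K)$ is compact for every compact $K\subseteq\Omega'$. $L^2_a(\Omega)$ is the Bergman space of holomorphic functions on $\Omega$ square integrable w.r.t. Lebesgue measure; $\mathcal{V}^*(\Phi,\Omega)$ is the von Neumann algebra of all bounded operators on $L^2_a(\Omega)$ commuting with every multiplication operator $M_{\phi_j,\Omega}f=\phi_jf$ and its adjoint $M_{\phi_j,\Omega}^*$. *)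

theory Defs
  imports "HOL-Analysis.Analysis"
begin

definition cdomain :: "(complex^'d) set \<Rightarrow> bool" where
  "cdomain S \<longleftrightarrow> open S \<and> connected S \<and> S \<noteq> {}"

definition holo_fun :: "(complex^'d \<Rightarrow> complex) \<Rightarrow> (complex^'d) set \<Rightarrow> bool" where
  "holo_fun f S \<longleftrightarrow>
     (\<forall>z\<in>S. \<exists>L. (f has_derivative L) (at z) \<and> (\<forall>c v. L (c *s v) = c * L v))"

definition holo_map :: "(complex^'d \<Rightarrow> complex^'e) \<Rightarrow> (complex^'d) set \<Rightarrow> bool" where
  "holo_map F S \<longleftrightarrow> (\<forall>j. holo_fun (\<lambda>z. F z $ j) S)"

definition proper_map :: "(complex^'d \<Rightarrow> complex^'e) \<Rightarrow> (complex^'d) set \<Rightarrow> (complex^'e) set \<Rightarrow> bool" where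
  "proper_map F S S' \<longleftrightarrow> F ` S \<subseteq> S' \<and>
     (\<forall>K. compact K \<and> K \<subseteq> S' \<longrightarrow> compact {z\<in>S. F z \<in> K})"

definition biholomorphic :: "(complex^'d \<Rightarrow> complex^'e) \<Rightarrow> (complex^'d) set \<Rightarrow> (complex^'e) set \<Rightarrow> bool" where
  "biholomorphic F S S' \<longleftrightarrow> bij_betw F S S' \<and> holo_map F S \<and>
     (\<exists>G. holo_map G S' \<and> (\<forall>w\<in>S'. G w \<in> S \<and> F (G w) = w) \<and> (\<forall>z\<in>S. G (F z) = z))"

text \<open>Bergman space: holomorphic functions on S, square integrable w.r.t. Lebesgue measure.
  Elements are normalised to vanish outside S, so that they are determined uniquely.\<close>
definition bergman_space :: "(complex^'d) set \<Rightarrow> (complex^'d \<Rightarrow> complex) set" where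
  "bergman_space S = {f. holo_fun f S \<and> (\<forall>z. z \<notin> S \<longrightarrow> f z = 0) \<and>
                        integrable lborel (\<lambda>z. (cmod (f z))\<^sup>2)}"

definition berg_inner :: "(complex^'d \<Rightarrow> complex) \<Rightarrow> (complex^'d \<Rightarrow> complex) \<Rightarrow> complex" where
  "berg_inner f g = integral\<^sup>L lborel (\<lambda>z. f z * cnj (g z))"

definition berg_norm :: "(complex^'d \<Rightarrow> complex) \<Rightarrow> real" where
  "berg_norm f = sqrt (integral\<^sup>L lborel (\<lambda>z. (cmod (f z))\<^sup>2))"

definition mult_op :: "(complex^'d) set \<Rightarrow> (complex^'d \<Rightarrow> complex) \<Rightarrow> (complex^'d \<Rightarrow> complex) \<Rightarrow> (complex^'d \<Rightarrow> complex)" where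
  "mult_op S \<phi> f = (\<lambda>z. if z \<in> S then \<phi> z * f z else 0)"

definition mult_adj :: "(complex^'d) set \<Rightarrow> (complex^'d \<Rightarrow> complex) \<Rightarrow> (complex^'d \<Rightarrow> complex) \<Rightarrow> (complex^'d \<Rightarrow> complex)" where
  "mult_adj S \<phi> g = (SOME h. h \<in> bergman_space S \<and>
      (\<forall>f\<in>bergman_space S. berg_inner (mult_op S \<phi> f) g = berg_inner f h))"

definition bounded_op :: "(complex^'d) set \<Rightarrow> ((complex^'d \<Rightarrow> complex) \<Rightarrow> (complex^'d \<Rightarrow> complex)) \<Rightarrow> bool" where
  "bounded_op S T \<longleftrightarrow>
     (\<forall>f\<in>bergman_space S. T f \<in> bergman_space S) \<and>
     (\<forall>f\<in>bergman_space S. \<forall>g\<in>bergman_space S. \<forall>a b::complex.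
         T (\<lambda>z. a * f z + b * g z) = (\<lambda>z. a * T f z + b * T g z)) \<and>
     (\<exists>C. \<forall>f\<in>bergman_space S. berg_norm (T f) \<le> C * berg_norm f)"

definition vN_alg :: "(complex^'d \<Rightarrow> complex^'d) \<Rightarrow> (complex^'d) set \<Rightarrow> ((complex^'d \<Rightarrow> complex) \<Rightarrow> (complex^'d \<Rightarrow> complex)) set" where
  "vN_alg \<Phi> S = {T. bounded_op S T \<and>
     (\<forall>j. \<forall>f\<in>bergman_space S.
        T (mult_op S (\<lambda>z. \<Phi> z $ j) f) = mult_op S (\<lambda>z. \<Phi> z $ j) (T f) \<and>
        T (mult_adj S (\<lambda>z. \<Phi> z $ j) f) = mult_adj S (\<lambda>z. \<Phi> z $ j) (T f))}"

definition vN_trivial :: "(complex^'d \<Rightarrow> complex^'d) \<Rightarrow> (complex^'d) set \<Rightarrow> bool" where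
  "vN_trivial \<Phi> S \<longleftrightarrow>
     (\<forall>T\<in>vN_alg \<Phi> S. \<exists>c::complex. \<forall>f\<in>bergman_space S. T f = (\<lambda>z. c * f z))"

end

theory Submission
  imports Defs "HOL-Complex_Analysis.Complex_Analysis"
begin

text \<open>
  Let \<open>J\<close> be the complex Jacobian determinant of \<open>\<Phi>\<close>. Since the cofactors of the Jacobian matrix are
  divergence free and \<open>\<Phi>\<close> is proper, \<open>J \<cdot> (\<partial>\<^sub>j\<psi> \<circ> \<Phi>)\<close> is orthogonal to every holomorphic
  function when \<open>\<psi>\<close> has compact support in \<open>\<Omega>'\<close> (Bell). So for holomorphic \<open>f\<close> the push-forward
  under \<open>\<Phi>\<close> of the measure with density \<open>f\<close> times the conjugate of \<open>J\<close> is weakly holomorphic: it has a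
  holomorphic density \<open>tr f\<close>, the trace of \<open>f\<close>. In particular \<open>tr J\<close> is real, hence a constant \<open>m\<close>,
  and \<open>m > 0\<close> because a holomorphic vector field killed by the derivative of a proper \<open>\<Phi>\<close>
  vanishes, so that \<open>J\<close> cannot vanish identically. Neither the branched covering structure of
  \<open>\<Phi>\<close> nor a change of variables is needed.

  The operator \<open>f \<mapsto> J \<cdot> (tr f \<circ> \<Phi>)\<close> is \<open>m\<close> times a projection onto a reducing subspace. If it is a
  scalar, applying it to \<open>1\<close> and to the coordinates yields a holomorphic inverse of \<open>\<Phi>\<close>.
  Conversely, for an operator \<open>S\<close> of the algebra and \<open>h = S\<^sup>* 1\<close>, all monomials in \<open>\<Phi>\<close> and its
  conjugate annihilate \<open>S f\<close> minus \<open>f\<close> times the conjugate of \<open>h\<close>. For injective \<open>\<Phi>\<close> this function vanishes by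
  Stone-Weierstrass, and \<open>f = 1\<close> shows that \<open>h\<close> and its conjugate are holomorphic, so \<open>h\<close> is constant.
\<close>

text \<open>Formally \<open>tr f w\<close> is the sum of \<open>f / jac\<close> over the preimages
  of \<open>w\<close>, because \<open>f * cnj jac\<close> is \<open>f / jac\<close> times the real
  Jacobian determinant \<open>(cmod jac)\<^sup>2\<close>. In this reading \<open>m\<close> is the
  number of sheets, and a scalar operator must be \<open>m\<close> itself, since \<open>jac\<close>
  is an eigenvector for \<open>m\<close>.

  That a weakly holomorphic measure has a holomorphic density rests on one identity: for a suitably
  normalised radial kernel, the derivative in the scale is a divergence in the conjugate derivatives
  of a compactly supported field. The mollifications of such a measure therefore do not change with
  the scale, and shrinking the support recovers the measure. The same argument for the identity map
  is Weyl's lemma; it also supplies the function theory in several variables, namely closure under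
  uniform limits, holomorphic derivatives and bounded point evaluations.\<close>

section \<open>Continuously differentiable functions and Wirtinger derivatives\<close>

definition C1_on :: "('a::euclidean_space \<Rightarrow> complex) \<Rightarrow> 'a set \<Rightarrow> bool" where
  "C1_on f S \<longleftrightarrow> (\<forall>z\<in>S. f differentiable (at z)) \<and>
     (\<forall>v. continuous_on S (\<lambda>z. frechet_derivative f (at z) v))"

text \<open>The Wirtinger derivatives in \<open>z $ k\<close> and in its conjugate:
  \<open>axis k 1\<close> and \<open>axis k \<i>\<close> are the directions of the real and the
  imaginary part of the coordinate \<open>k\<close>.\<close>

definition dz :: "'d \<Rightarrow> (complex^'d \<Rightarrow> complex) \<Rightarrow> complex^'d \<Rightarrow> complex" where
  "dz k f z = (frechet_derivative f (at z) (axis k 1) - \<i> * frechet_derivative f (at z) (axis k \<i>)) / 2"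

definition dzb :: "'d \<Rightarrow> (complex^'d \<Rightarrow> complex) \<Rightarrow> complex^'d \<Rightarrow> complex" where
  "dzb k f z = (frechet_derivative f (at z) (axis k 1) + \<i> * frechet_derivative f (at z) (axis k \<i>)) / 2"

lemma frechet_eqI: "(f has_derivative L) (at z) \<Longrightarrow> frechet_derivative f (at z) = L"
  by (metis frechet_derivative_at)

lemma has_frechet: "f differentiable (at z) \<Longrightarrow> (f has_derivative frechet_derivative f (at z)) (at z)"
  using frechet_derivative_works by blast

lemma dz_eq: "(f has_derivative L) (at z) \<Longrightarrow> dz k f z = (L (axis k 1) - \<i> * L (axis k \<i>)) / 2"
  by (simp add: dz_def frechet_eqI)

lemma dzb_eq: "(f has_derivative L) (at z) \<Longrightarrow> dzb k f z = (L (axis k 1) + \<i> * L (axis k \<i>)) / 2"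
  by (simp add: dzb_def frechet_eqI)

text \<open>Both functions have the same candidates for a derivative, so
  \<open>frechet_derivative\<close> makes the same choice for both, even at points where neither is
  differentiable.\<close>

lemma frechet_local_cong:
  assumes "open S" "z \<in> S" "\<And>x. x \<in> S \<Longrightarrow> f x = g x"
  shows "f differentiable (at z) \<longleftrightarrow> g differentiable (at z)"
    and "frechet_derivative f (at z) = frechet_derivative g (at z)"
proof -
  have *: "(f has_derivative L) (at z) \<longleftrightarrow> (g has_derivative L) (at z)" for L
    using has_derivative_transform_within_open[OF _ assms(1,2), of f L UNIV g]
      has_derivative_transform_within_open[OF _ assms(1,2), of g L UNIV f] assms(3) by auto
  then show "f differentiable (at z) \<longleftrightarrow> g differentiable (at z)"
    by (auto simp: differentiable_def)
  show "frechet_derivative f (at z) = frechet_derivative g (at z)"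
    unfolding frechet_derivative_def using * by simp
qed

lemma dz_local_cong:
  assumes "open S" "z \<in> S" "\<And>x. x \<in> S \<Longrightarrow> f x = g x"
  shows "dz k f z = dz k g z" "dzb k f z = dzb k g z"
  using frechet_local_cong[OF assms] by (simp_all add: dz_def dzb_def)

lemma C1_on_cong:
  assumes "open S" "\<And>x. x \<in> S \<Longrightarrow> f x = g x"
  shows "C1_on f S \<longleftrightarrow> C1_on g S"
  using frechet_local_cong[OF assms(1) _ assms(2)] unfolding C1_on_def
  by (simp cong: continuous_on_cong)

lemma C1_on_subset: "C1_on f S \<Longrightarrow> T \<subseteq> S \<Longrightarrow> C1_on f T"
  unfolding C1_on_def by (meson continuous_on_subset subsetD)

lemma C1_on_imp_continuous_on: "C1_on f S \<Longrightarrow> continuous_on S f"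
  unfolding C1_on_def
  by (meson continuous_at_imp_continuous_on differentiable_imp_continuous_within)

lemma C1_onI:
  assumes "\<And>z. z \<in> S \<Longrightarrow> (f has_derivative D z) (at z)"
    and "\<And>v. continuous_on S (\<lambda>z. D z v)"
  shows "C1_on f S"
proof -
  have "frechet_derivative f (at z) = D z" if "z \<in> S" for z
    using assms(1)[OF that] by (rule frechet_eqI)
  then show ?thesis
    unfolding C1_on_def using assms by (auto simp: differentiable_def cong: continuous_on_cong)
qed

lemma C1_on_D:
  assumes "C1_on f S"
  shows "z \<in> S \<Longrightarrow> (f has_derivative frechet_derivative f (at z)) (at z)"
    "continuous_on S (\<lambda>z. frechet_derivative f (at z) v)"
  using assms by (auto simp: C1_on_def has_frechet)

lemma C1_on_mult:
  assumes f: "C1_on f S" and g: "C1_on g S"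
  shows "C1_on (\<lambda>x. f x * g x) S"
proof (rule C1_onI)
  show "((\<lambda>x. f x * g x) has_derivative
      (\<lambda>v. f z * frechet_derivative g (at z) v + frechet_derivative f (at z) v * g z)) (at z)"
    if "z \<in> S" for z
    using has_derivative_mult[OF C1_on_D(1)[OF f that] C1_on_D(1)[OF g that]] .
qed (intro continuous_intros C1_on_D(2) f g C1_on_imp_continuous_on)

lemma C1_on_const [simp]: "C1_on (\<lambda>x. c) S"
  by (rule C1_onI[where D="\<lambda>z v. 0"]) (auto intro!: derivative_eq_intros)

lemma C1_on_cnj:
  assumes f: "C1_on f S"
  shows "C1_on (\<lambda>x. cnj (f x)) S"
proof (rule C1_onI)
  show "((\<lambda>x. cnj (f x)) has_derivative (\<lambda>v. cnj (frechet_derivative f (at z) v))) (at z)"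
    if "z \<in> S" for z
    using bounded_linear.has_derivative[OF bounded_linear_cnj C1_on_D(1)[OF f that]] .
qed (intro continuous_intros C1_on_D(2) f)

lemma C1_on_prod:
  assumes "\<And>i. i \<in> I \<Longrightarrow> C1_on (f i) S"
  shows "C1_on (\<lambda>x. \<Prod>i\<in>I. f i x) S"
  using assms by (induction I rule: infinite_finite_induct) (auto intro: C1_on_mult)

lemma dz_mult:
  assumes "f differentiable (at z)" "g differentiable (at z)"
  shows "dz k (\<lambda>x. f x * g x) z = dz k f z * g z + f z * dz k g z"
    "dzb k (\<lambda>x. f x * g x) z = dzb k f z * g z + f z * dzb k g z"
  unfolding dz_eq[OF has_derivative_mult[OF assms[THEN has_frechet]]]
    dzb_eq[OF has_derivative_mult[OF assms[THEN has_frechet]]]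
  by (simp_all add: dz_def dzb_def field_simps)

lemma dz_cnj:
  assumes "f differentiable (at z)"
  shows "dz k (\<lambda>x. cnj (f x)) z = cnj (dzb k f z)"
    "dzb k (\<lambda>x. cnj (f x)) z = cnj (dz k f z)"
  using dz_eq[OF bounded_linear.has_derivative[OF bounded_linear_cnj has_frechet[OF assms]]]
    dzb_eq[OF bounded_linear.has_derivative[OF bounded_linear_cnj has_frechet[OF assms]]]
  by (simp_all add: dz_def dzb_def)

lemma dz_const [simp]: "dz k (\<lambda>x. c) z = 0" "dzb k (\<lambda>x. c) z = 0"
  using dz_eq[of "\<lambda>x. c" "\<lambda>v. 0"] dzb_eq[of "\<lambda>x. c" "\<lambda>v. 0"] by simp_all

lemma dz_prod:
  assumes "finite I" "\<And>i. i \<in> I \<Longrightarrow> f i differentiable (at z)"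
  shows "(\<lambda>x. \<Prod>i\<in>I. f i x) differentiable (at z)"
    "dz k (\<lambda>x. \<Prod>i\<in>I. f i x) z = (\<Sum>l\<in>I. dz k (f l) z * (\<Prod>i\<in>I-{l}. f i z))"
proof -
  have "(\<lambda>x. \<Prod>i\<in>I. f i x) differentiable (at z) \<and>
    dz k (\<lambda>x. \<Prod>i\<in>I. f i x) z = (\<Sum>l\<in>I. dz k (f l) z * (\<Prod>i\<in>I-{l}. f i z))"
    using assms
  proof (induction I)
    case (insert j I)
    have 1: "insert j I - {l} = (if l = j then I else insert j (I - {l}))" for l
      using insert by auto
    have 2: "(\<Prod>i\<in>insert j I - {l}. f i z) = f j z * (\<Prod>i\<in>I-{l}. f i z)" if "l \<in> I" for l
      unfolding 1 using insert that by auto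
    show ?case
      using insert
      by (simp add: dz_mult 2 sum_distrib_left mult_ac cong: sum.cong)
  qed auto
  then show "(\<lambda>x. \<Prod>i\<in>I. f i x) differentiable (at z)"
    "dz k (\<lambda>x. \<Prod>i\<in>I. f i x) z = (\<Sum>l\<in>I. dz k (f l) z * (\<Prod>i\<in>I-{l}. f i z))" by auto
qed

subsection \<open>Holomorphic functions of several variables\<close>

lemma axis_complex: "axis k c = c *s (axis k 1 :: complex^'d)"
  by (vector axis_def)

lemma holo_fun_D:
  assumes "holo_fun f S" "z \<in> S"
  shows "(f has_derivative frechet_derivative f (at z)) (at z)"
    and "frechet_derivative f (at z) (c *s v) = c * frechet_derivative f (at z) v"
proof -
  obtain L where L: "(f has_derivative L) (at z)" "\<forall>c v. L (c *s v) = c * L v"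
    using assms unfolding holo_fun_def by blast
  have "frechet_derivative f (at z) = L" using L(1) by (rule frechet_eqI)
  then show "(f has_derivative frechet_derivative f (at z)) (at z)"
    "frechet_derivative f (at z) (c *s v) = c * frechet_derivative f (at z) v" using L by auto
qed

lemma holo_funI:
  assumes "\<And>z. z \<in> S \<Longrightarrow> (f has_derivative L z) (at z)"
    and "\<And>z c v. z \<in> S \<Longrightarrow> L z (c *s v) = c * L z v"
  shows "holo_fun f S"
  unfolding holo_fun_def using assms by blast

lemma holo_fun_differentiable: "holo_fun f S \<Longrightarrow> z \<in> S \<Longrightarrow> f differentiable (at z)"
  using holo_fun_D(1) differentiable_def by blast

lemma holo_fun_continuous_on: "holo_fun f S \<Longrightarrow> continuous_on S f"
  by (meson continuous_at_imp_continuous_on differentiable_imp_continuous_within holo_fun_differentiable)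

lemma holo_fun_subset: "holo_fun f S \<Longrightarrow> T \<subseteq> S \<Longrightarrow> holo_fun f T"
  unfolding holo_fun_def by blast

lemma holo_fun_cong:
  assumes "open S" "\<And>x. x \<in> S \<Longrightarrow> f x = g x" "holo_fun f S"
  shows "holo_fun g S"
proof (rule holo_funI)
  fix z c v assume z: "z \<in> S"
  show "(g has_derivative frechet_derivative f (at z)) (at z)"
    using has_derivative_transform_within_open[OF holo_fun_D(1)[OF assms(3) z] assms(1) z assms(2)] by simp
  show "frechet_derivative f (at z) (c *s v) = c * frechet_derivative f (at z) v"
    using holo_fun_D(2)[OF assms(3) z] .
qed

lemma holo_fun_dzb: "holo_fun f S \<Longrightarrow> z \<in> S \<Longrightarrow> dzb k f z = 0"
  unfolding dzb_def axis_complex[of k \<i>] by (simp add: holo_fun_D(2))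

lemma holo_fun_dz: "holo_fun f S \<Longrightarrow> z \<in> S \<Longrightarrow> dz k f z = frechet_derivative f (at z) (axis k 1)"
  unfolding dz_def axis_complex[of k \<i>] by (simp add: holo_fun_D(2))

lemma vec_axis_sum: "v = (\<Sum>k\<in>UNIV. axis k (v $ k))" for v :: "complex^'d"
  by (simp add: vec_eq_iff axis_def if_distrib cong: if_cong)

text \<open>The Cauchy-Riemann equations give homogeneity under \<open>\<i>\<close> on each axis;
  real linearity extends it to all vectors and scalars.\<close>

lemma dzb_zero_imp_complex_linear:
  fixes f :: "complex^'d \<Rightarrow> complex"
  assumes f: "(f has_derivative L) (at z)" and 0: "\<And>k. dzb k f z = 0"
  shows "L (c *s v) = c * L v"
proof -
  have lin: "linear L" using f has_derivative_linear by blast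
  have i: "L (axis k \<i>) = \<i> * L (axis k 1)" for k
    using 0[of k] by (simp add: dzb_eq[OF f] add_eq_0_iff2 complex_eq_iff)
  have ax: "L (axis k a) = a * L (axis k 1)" for k a
  proof -
    have "axis k a = Re a *\<^sub>R axis k 1 + Im a *\<^sub>R (axis k \<i> :: complex^'d)"
      by (simp add: vec_eq_iff axis_def complex_eq_iff)
    then show ?thesis
      by (simp add: linear_add[OF lin] linear_cmul[OF lin] i complex_eq_iff)
  qed
  have Lw: "L w = (\<Sum>k\<in>UNIV. w $ k * L (axis k 1))" for w
  proof -
    have "L w = L (\<Sum>k\<in>UNIV. axis k (w $ k))"
      by (rule arg_cong[OF vec_axis_sum])
    also have "\<dots> = (\<Sum>k\<in>UNIV. w $ k * L (axis k 1))"
      unfolding linear_sum[OF lin] by (rule sum.cong[OF refl]) (rule ax)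
    finally show ?thesis .
  qed
  show ?thesis unfolding Lw[of "c *s v"] Lw[of v] by (simp add: sum_distrib_left mult_ac)
qed

lemma holo_funI_dzb:
  assumes "\<And>z. z \<in> S \<Longrightarrow> f differentiable (at z)" "\<And>z k. z \<in> S \<Longrightarrow> dzb k f z = 0"
  shows "holo_fun f S"
proof (rule holo_funI)
  show 1: "(f has_derivative frechet_derivative f (at z)) (at z)" if "z \<in> S" for z
    using assms(1) that has_frechet by blast
  show "frechet_derivative f (at z) (c *s v) = c * frechet_derivative f (at z) v" if "z \<in> S" for z c v
    using dzb_zero_imp_complex_linear[OF 1[OF that]] assms(2) that by blast
qed

lemma holo_fun_const [simp]: "holo_fun (\<lambda>z. c) S"
  by (rule holo_funI[where L="\<lambda>z v. 0"]) auto

lemma holo_fun_coord [simp]: "holo_fun (\<lambda>z. z $ k) S"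
  by (rule holo_funI[where L="\<lambda>z v. v $ k"])
    (auto intro: bounded_linear_imp_has_derivative bounded_linear_vec_nth)

lemma holo_fun_add:
  assumes "holo_fun f S" "holo_fun g S"
  shows "holo_fun (\<lambda>z. f z + g z) S"
  by (rule holo_funI[OF has_derivative_add[OF holo_fun_D(1)[OF assms(1)] holo_fun_D(1)[OF assms(2)]]])
    (auto simp: holo_fun_D(2)[OF assms(1)] holo_fun_D(2)[OF assms(2)] algebra_simps)

lemma holo_fun_mult:
  assumes "holo_fun f S" "holo_fun g S"
  shows "holo_fun (\<lambda>z. f z * g z) S"
  by (rule holo_funI[OF has_derivative_mult[OF holo_fun_D(1)[OF assms(1)] holo_fun_D(1)[OF assms(2)]]])
    (auto simp: holo_fun_D(2)[OF assms(1)] holo_fun_D(2)[OF assms(2)] algebra_simps)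

lemma holo_fun_cmult: "holo_fun f S \<Longrightarrow> holo_fun (\<lambda>z. c * f z) S"
  by (rule holo_fun_mult[OF holo_fun_const])

lemma holo_fun_diff: "holo_fun f S \<Longrightarrow> holo_fun g S \<Longrightarrow> holo_fun (\<lambda>z. f z - g z) S"
  using holo_fun_add[of f S "\<lambda>z. (-1) * g z"] holo_fun_cmult[of g S "-1"] by simp

lemma holo_fun_sum: "(\<And>i. i \<in> I \<Longrightarrow> holo_fun (f i) S) \<Longrightarrow> holo_fun (\<lambda>z. \<Sum>i\<in>I. f i z) S"
  by (induction I rule: infinite_finite_induct) (auto intro: holo_fun_add)

lemma holo_fun_prod: "(\<And>i. i \<in> I \<Longrightarrow> holo_fun (f i) S) \<Longrightarrow> holo_fun (\<lambda>z. \<Prod>i\<in>I. f i z) S"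
  by (induction I rule: infinite_finite_induct) (auto intro: holo_fun_mult)

lemma holo_fun_inverse:
  assumes "holo_fun f S" "\<And>z. z \<in> S \<Longrightarrow> f z \<noteq> 0"
  shows "holo_fun (\<lambda>z. inverse (f z)) S"
  by (rule holo_funI[OF Deriv.has_derivative_inverse[OF assms(2) holo_fun_D(1)[OF assms(1)]]])
    (auto simp: holo_fun_D(2)[OF assms(1)])

lemma holo_map_has_derivative:
  assumes "holo_map F S" "z \<in> S"
  shows "(F has_derivative (\<lambda>v. \<chi> j. frechet_derivative (\<lambda>z. F z $ j) (at z) v)) (at z)"
proof -
  have "((\<lambda>x. F x $ j) has_derivative frechet_derivative (\<lambda>z. F z $ j) (at z)) (at z)" for j
    using assms unfolding holo_map_def by (intro holo_fun_D(1)) auto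
  then show ?thesis
    by (subst has_derivative_componentwise_within) (auto simp: Basis_vec_def inner_axis
        intro!: bounded_linear.has_derivative[OF bounded_linear_inner_left])
qed

lemma holo_map_continuous_on:
  assumes "holo_map F S"
  shows "continuous_on S F"
proof -
  have "continuous_on S (\<lambda>z. \<chi> j. F z $ j)"
    using assms unfolding holo_map_def by (intro continuous_on_vec_lambda holo_fun_continuous_on) auto
  then show ?thesis by simp
qed

lemma holo_fun_compose:
  assumes g: "holo_fun g T" and F: "holo_map F S" and sub: "F ` S \<subseteq> T"
  shows "holo_fun (\<lambda>z. g (F z)) S"
proof (rule holo_funI)
  fix z assume z: "z \<in> S"
  then have Fz: "F z \<in> T" using sub by auto
  show "((\<lambda>z. g (F z)) has_derivative (\<lambda>v. frechet_derivative g (at (F z))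
      (\<chi> j. frechet_derivative (\<lambda>z. F z $ j) (at z) v))) (at z)"
    using has_derivative_compose[OF holo_map_has_derivative[OF F z] holo_fun_D(1)[OF g Fz]] .
  fix c v
  have "(\<chi> j. frechet_derivative (\<lambda>z. F z $ j) (at z) (c *s v)) =
     c *s (\<chi> j. frechet_derivative (\<lambda>z. F z $ j) (at z) v)"
    using holo_fun_D(2)[OF _ z] F unfolding holo_map_def by (simp add: vec_eq_iff)
  then show "frechet_derivative g (at (F z)) (\<chi> j. frechet_derivative (\<lambda>z. F z $ j) (at z) (c *s v))
    = c * frechet_derivative g (at (F z)) (\<chi> j. frechet_derivative (\<lambda>z. F z $ j) (at z) v)"
    by (simp add: holo_fun_D(2)[OF g Fz])
qed

text \<open>Splitting into a complex linear and a conjugate linear part, with the coefficients of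
  \<open>dz\<close> and \<open>dzb\<close>. It yields the chain rule, and later expresses real
  linear forms through the coordinates and their conjugates.\<close>

lemma real_linear_decomp:
  fixes L :: "complex^'d \<Rightarrow> complex"
  assumes "linear L"
  shows "L v = (\<Sum>j\<in>UNIV. (L (axis j 1) - \<i> * L (axis j \<i>)) / 2 * v $ j
                 + (L (axis j 1) + \<i> * L (axis j \<i>)) / 2 * cnj (v $ j))"
proof -
  have ax: "L (axis j a) = (L (axis j 1) - \<i> * L (axis j \<i>)) / 2 * a
                 + (L (axis j 1) + \<i> * L (axis j \<i>)) / 2 * cnj a" for j a
  proof -
    have "axis j a = Re a *\<^sub>R axis j 1 + Im a *\<^sub>R (axis j \<i> :: complex^'d)"
      by (simp add: vec_eq_iff axis_def complex_eq_iff)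
    then show ?thesis
      by (simp add: linear_add[OF assms] linear_cmul[OF assms] complex_eq_iff field_simps)
  qed
  have "L v = L (\<Sum>k\<in>UNIV. axis k (v $ k))"
    by (rule arg_cong[OF vec_axis_sum])
  also have "\<dots> = (\<Sum>k\<in>UNIV. L (axis k (v $ k)))"
    by (rule linear_sum[OF assms])
  finally show ?thesis unfolding sum.cong[OF refl ax] .
qed

text \<open>The chain rule has a second sum, of \<open>dzb j \<psi>\<close> times the
  \<open>dz k\<close>-derivative of the conjugate of \<open>F\<close>; that factor vanishes for
  holomorphic \<open>F\<close>.\<close>

lemma dz_compose_holo:
  assumes psi: "\<psi> differentiable (at (F z))" and F: "holo_map F S" "z \<in> S"
  shows "dz k (\<lambda>x. \<psi> (F x)) z = (\<Sum>j\<in>UNIV. dz j \<psi> (F z) * dz k (\<lambda>x. F x $ j) z)"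
proof -
  let ?D = "\<lambda>v. \<chi> j. frechet_derivative (\<lambda>z. F z $ j) (at z) v"
  let ?P = "frechet_derivative \<psi> (at (F z))"
  have hj: "holo_fun (\<lambda>x. F x $ j) S" for j using F unfolding holo_map_def by auto
  have i: "frechet_derivative (\<lambda>z. F z $ j) (at z) (axis k \<i>) =
     \<i> * frechet_derivative (\<lambda>z. F z $ j) (at z) (axis k 1)" for j
    unfolding axis_complex[of k \<i>] by (rule holo_fun_D(2)[OF hj F(2)])
  have lin: "linear ?P" using has_frechet[OF psi] has_derivative_linear by blast
  have P: "?P v = (\<Sum>j\<in>UNIV. dz j \<psi> (F z) * v $ j + dzb j \<psi> (F z) * cnj (v $ j))" for v
    using real_linear_decomp[OF lin, of v] by (simp add: dz_def dzb_def)
  have "dz k (\<lambda>x. \<psi> (F x)) z = (?P (?D (axis k 1)) - \<i> * ?P (?D (axis k \<i>))) / 2"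
    using dz_eq[OF has_derivative_compose[OF holo_map_has_derivative[OF F] has_frechet[OF psi]]] .
  also have "\<dots> = (\<Sum>j\<in>UNIV. dz j \<psi> (F z) * ?D (axis k 1) $ j)"
    unfolding P sum_distrib_left sum_subtractf[symmetric] sum_divide_distrib
    by (rule sum.cong[OF refl]) (simp add: i field_simps)
  finally show ?thesis by (simp add: holo_fun_dz[OF hj F(2)])
qed

text \<open>Restriction to complex lines is the bridge to one variable: the Cauchy inequality and
  analytic continuation are applied through it.\<close>

lemma holo_fun_line:
  assumes "holo_fun f S"
  shows "(\<lambda>t. f (z + t *s v)) holomorphic_on {t. z + t *s v \<in> S}"
    and "z + t *s v \<in> S \<Longrightarrow> ((\<lambda>t. f (z + t *s v)) has_field_derivative frechet_derivative f (at (z + t *s v)) v) (at t)"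
proof -
  have lin: "bounded_linear (\<lambda>t. t *s v)" for v :: "complex^'b"
  proof -
    have "linear (\<lambda>t. t *s v)" by (rule linearI) (auto simp: vec_eq_iff algebra_simps)
    then show ?thesis by (simp add: linear_conv_bounded_linear)
  qed
  show 1: "((\<lambda>t. f (z + t *s v)) has_field_derivative frechet_derivative f (at (z + t *s v)) v) (at t)"
    if "z + t *s v \<in> S" for t
  proof -
    have "((\<lambda>t. z + t *s v) has_derivative (\<lambda>t. t *s v)) (at t)"
      by (auto intro!: derivative_eq_intros bounded_linear_imp_has_derivative lin)
    from has_derivative_compose[OF this holo_fun_D(1)[OF assms that]]
    show ?thesis unfolding has_field_derivative_def
      by (rule has_derivative_eq_rhs) (auto simp: holo_fun_D(2)[OF assms that] mult.commute)
  qed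
  have "(\<lambda>t. f (z + t *s v)) field_differentiable (at t within {t. z + t *s v \<in> S})"
    if "t \<in> {t. z + t *s v \<in> S}" for t
  proof -
    from that have "z + t *s v \<in> S" by simp
    from 1[OF this] show ?thesis
      using field_differentiable_def field_differentiable_at_within by blast
  qed
  then show "(\<lambda>t. f (z + t *s v)) holomorphic_on {t. z + t *s v \<in> S}"
    unfolding holomorphic_on_def by blast
qed

subsection \<open>Differentiation under the integral and integration by parts\<close>

text \<open>Differentiability is assumed at the single point \<open>w0\<close>, and the Lipschitz
  bound compares with \<open>w0\<close> only. This covers both later parameters, a point of the
  space and the scale of a kernel. Integrability of \<open>D z v\<close> comes for free, as a
  dominated limit of difference quotients.\<close>

lemma has_derivative_integral_param:
  fixes g :: "'a::euclidean_space \<Rightarrow> 'b \<Rightarrow> complex"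
  assumes r: "r > 0"
    and int: "\<And>w. w \<in> ball w0 r \<Longrightarrow> integrable M (g w)"
    and der: "\<And>z. z \<in> space M \<Longrightarrow> ((\<lambda>w. g w z) has_derivative D z) (at w0)"
    and lip: "\<And>w z. w \<in> ball w0 r \<Longrightarrow> z \<in> space M \<Longrightarrow> cmod (g w z - g w0 z) \<le> B z * norm (w - w0)"
    and B: "integrable M B"
  shows "((\<lambda>w. integral\<^sup>L M (g w)) has_derivative (\<lambda>v. \<integral>z. D z v \<partial>M)) (at w0)" (is ?A)
    and "integrable M (\<lambda>z. D z v)" (is ?B)
proof -
  have w0: "w0 \<in> ball w0 r" using r by simp
  have lin: "linear (D z)" if "z \<in> space M" for z
    using der[OF that] has_derivative_linear by blast
  \<comment> \<open>Steps tending to 0 for which \<open>w0 + t v n *\<^sub>R v\<close> stays in the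
    ball; the \<open>+ 1\<close> covers \<open>v = 0\<close>.\<close>
  define t where "t v n = r / (norm v + 1) / real (Suc n)" for v :: 'a and n
  have t_pos: "t v n > 0" for v n using r by (simp add: t_def add_nonneg_pos)
  have t_lim: "(\<lambda>n. t v n) \<longlonglongrightarrow> 0" for v
    unfolding t_def by (rule lim_const_over_n[THEN LIMSEQ_Suc])
  have t_ball: "w0 + t v n *\<^sub>R v \<in> ball w0 r" for v n
  proof -
    have "t v n \<le> r / (norm v + 1)"
      unfolding t_def using r divide_left_mono[of 1 "real (Suc n)" "r / (norm v + 1)"]
      by (simp add: add_nonneg_pos)
    then have "t v n * norm v \<le> r / (norm v + 1) * norm v" by (rule mult_right_mono) simp
    also have "\<dots> < r"
    proof -
      have "0 < 1 + norm v" by (simp add: add_pos_nonneg)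
      then show ?thesis using r by (simp add: field_simps)
    qed
    finally show ?thesis using t_pos[of v n] by (simp add: dist_norm)
  qed
  have Dlim: "(\<lambda>n. (g (w0 + t v n *\<^sub>R v) z - g w0 z) / of_real (t v n)) \<longlonglongrightarrow> D z v"
    if z: "z \<in> space M" for z v
  proof (cases "v = 0")
    case True
    then show ?thesis using linear_0[OF lin[OF z]] by simp
  next
    case False
    have "(\<lambda>h. norm (g (w0 + h) z - g w0 z - D z h) / norm h) \<midarrow>0\<rightarrow> 0"
      using der[OF z] unfolding has_derivative_at by blast
    moreover have "(\<lambda>n. t v n *\<^sub>R v) \<longlonglongrightarrow> 0"
      using tendsto_scaleR[OF t_lim tendsto_const, of v v] by simp
    moreover have "t v n *\<^sub>R v \<noteq> 0" for n using False t_pos[of v n] by simp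
    then have "\<forall>\<^sub>F n in sequentially. t v n *\<^sub>R v \<noteq> 0" by (intro always_eventually) blast
    ultimately have "(\<lambda>n. norm (g (w0 + t v n *\<^sub>R v) z - g w0 z - D z (t v n *\<^sub>R v)) / norm (t v n *\<^sub>R v)) \<longlonglongrightarrow> 0"
      by (rule tendsto_compose_eventually[where g="\<lambda>h. norm (g (w0 + h) z - g w0 z - D z h) / norm h"])
    then have "(\<lambda>n. norm (g (w0 + t v n *\<^sub>R v) z - g w0 z - D z (t v n *\<^sub>R v)) / norm (t v n *\<^sub>R v) * norm v) \<longlonglongrightarrow> 0"
      by (rule tendsto_mult_left_zero)
    moreover have "norm (g (w0 + t v n *\<^sub>R v) z - g w0 z - D z (t v n *\<^sub>R v)) / norm (t v n *\<^sub>R v) * norm v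
      = norm ((g (w0 + t v n *\<^sub>R v) z - g w0 z) / of_real (t v n) - D z v)" for n
    proof -
      have "(g (w0 + t v n *\<^sub>R v) z - g w0 z) / of_real (t v n) - D z v
        = (g (w0 + t v n *\<^sub>R v) z - g w0 z - D z (t v n *\<^sub>R v)) / of_real (t v n)"
        using t_pos[of v n]
        by (simp add: linear_cmul[OF lin[OF z]] diff_divide_distrib scaleR_conv_of_real)
      then show ?thesis using t_pos[of v n] False by (simp add: norm_divide)
    qed
    ultimately show ?thesis by (simp add: tendsto_norm_zero_iff LIM_zero_iff)
  qed
  have bnd: "cmod (D z v) \<le> B z * norm v" if z: "z \<in> space M" for z v
  proof (rule LIMSEQ_le_const2[OF tendsto_norm[OF Dlim[OF z]]], intro exI[of _ 0] allI impI)
    fix n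
    have "cmod (g (w0 + t v n *\<^sub>R v) z - g w0 z) \<le> B z * norm (t v n *\<^sub>R v)"
      using lip[OF t_ball[of v n] z] by simp
    then show "cmod ((g (w0 + t v n *\<^sub>R v) z - g w0 z) / of_real (t v n)) \<le> B z * norm v"
      using t_pos[of v n] by (simp add: norm_divide field_simps)
  qed
  have intD: "integrable M (\<lambda>z. D z v)" for v
  proof (rule Bochner_Integration.integrable_bound[where f="\<lambda>z. B z * norm v"])
    show "(\<lambda>z. D z v) \<in> borel_measurable M"
      by (rule borel_measurable_LIMSEQ_metric[OF _ Dlim])
        (use int[OF t_ball] int[OF w0] in measurable)
    show "AE z in M. norm (D z v) \<le> norm (B z * norm v)"
      using bnd by (intro AE_I2) (smt (verit) real_norm_def)
  qed (use B in simp)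
  then show ?B .
  have blin: "bounded_linear (\<lambda>v. \<integral>z. D z v \<partial>M)"
  proof -
    have "linear (\<lambda>v. \<integral>z. D z v \<partial>M)"
    proof (rule linearI)
      fix v w
      have "(\<integral>z. D z (v + w) \<partial>M) = (\<integral>z. D z v + D z w \<partial>M)"
        by (rule Bochner_Integration.integral_cong) (simp_all add: linear_add[OF lin])
      then show "(\<integral>z. D z (v + w) \<partial>M) = (\<integral>z. D z v \<partial>M) + (\<integral>z. D z w \<partial>M)"
        by (simp add: intD)
    next
      fix c v
      have "(\<integral>z. D z (c *\<^sub>R v) \<partial>M) = (\<integral>z. c *\<^sub>R D z v \<partial>M)"
        by (rule Bochner_Integration.integral_cong) (simp_all add: linear_cmul[OF lin])
      then show "(\<integral>z. D z (c *\<^sub>R v) \<partial>M) = c *\<^sub>R (\<integral>z. D z v \<partial>M)" by simp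
    qed
    then show ?thesis by (simp add: linear_conv_bounded_linear)
  qed
  \<comment> \<open>Dominated convergence along sequences: the increment and its linear part are
    each at most \<open>B z * norm (w - w0)\<close>, hence the majorant
    \<open>2 * B z\<close>.\<close>
  have lim: "((\<lambda>w. (((\<integral>z. g w z \<partial>M) - (\<integral>z. g w0 z \<partial>M)) - (\<integral>z. D z (w - w0) \<partial>M)) /\<^sub>R norm (w - w0)) \<longlongrightarrow> 0) (at w0 within ball w0 r)"
    unfolding tendsto_at_iff_sequentially comp_def
  proof (intro allI impI)
    fix X assume X: "\<forall>i. X i \<in> ball w0 r - {w0}" and Xl: "X \<longlonglongrightarrow> w0"
    let ?q = "\<lambda>n z. (g (X n) z - g w0 z - D z (X n - w0)) /\<^sub>R norm (X n - w0)"
    have intg: "integrable M (g (X n))" for n using int X by auto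
    have "(\<lambda>n. \<integral>z. ?q n z \<partial>M) \<longlonglongrightarrow> (\<integral>z. 0 \<partial>M)"
    proof (rule integral_dominated_convergence[where w="\<lambda>z. 2 * B z"])
      show "?q n \<in> borel_measurable M" for n
        using intg[of n] int[OF w0] intD[of "X n - w0"] by measurable
      show "integrable M (\<lambda>z. 2 * B z)" using B by simp
      show "AE z in M. (\<lambda>n. ?q n z) \<longlonglongrightarrow> 0"
      proof (rule AE_I2)
        fix z assume z: "z \<in> space M"
        have "((\<lambda>w. (g w z - g w0 z - D z (w - w0)) /\<^sub>R norm (w - w0)) \<longlongrightarrow> 0) (at w0)"
          using der[OF z] unfolding has_derivative_at_within by blast
        then show "(\<lambda>n. ?q n z) \<longlonglongrightarrow> 0"
          using Xl X unfolding tendsto_at_iff_sequentially comp_def by auto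
      qed
      show "AE z in M. norm (?q n z) \<le> 2 * B z" for n
      proof (rule AE_I2)
        fix z assume z: "z \<in> space M"
        have Xn: "X n \<in> ball w0 r" "norm (X n - w0) > 0" using X by auto
        have "cmod (g (X n) z - g w0 z - D z (X n - w0)) \<le> B z * norm (X n - w0) + B z * norm (X n - w0)"
          using norm_triangle_ineq4 lip[OF Xn(1) z] bnd[OF z, of "X n - w0"]
          by (smt (verit))
        then show "norm (?q n z) \<le> 2 * B z"
          unfolding norm_scaleR using Xn(2) by (simp add: divide_simps mult_ac)
      qed
    qed simp
    then show "(\<lambda>n. ((\<integral>z. g (X n) z \<partial>M) - (\<integral>z. g w0 z \<partial>M) - (\<integral>z. D z (X n - w0) \<partial>M)) /\<^sub>R norm (X n - w0)) \<longlonglongrightarrow> 0"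
      by (simp add: intg int[OF w0] intD)
  qed
  show ?A
    using lim blin r by (simp add: has_derivative_at_within at_within_open[OF w0])
qed

lemma integrable_compact_support:
  fixes f :: "'a::euclidean_space \<Rightarrow> 'b::{banach, second_countable_topology}"
  assumes "compact K" "continuous_on K f" "\<And>x. x \<notin> K \<Longrightarrow> f x = 0"
  shows "integrable lborel f"
proof -
  have "(\<lambda>x. indicator K x *\<^sub>R f x) = f"
    using assms(3) by (auto simp: indicator_def fun_eq_iff)
  then show ?thesis using borel_integrable_compact[OF assms(1,2)] by simp
qed

lemma frechet_zero_outside:
  assumes "closed K" "\<And>x. x \<notin> K \<Longrightarrow> h x = (0::complex)" "z \<notin> K"
  shows "frechet_derivative h (at z) = (\<lambda>v. 0)" "h differentiable (at z)"
proof -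
  have o: "open (- K)" using assms by auto
  have z: "z \<in> - K" using assms by auto
  have e: "\<And>x. x \<in> - K \<Longrightarrow> h x = 0" using assms by auto
  show "frechet_derivative h (at z) = (\<lambda>v. 0)" "h differentiable (at z)"
    using frechet_local_cong[OF o z e] by auto
qed

text \<open>\<open>S\<close> and \<open>- K\<close> are open and cover the space. This turns
  products formed on a domain into global functions that can be integrated by parts.\<close>

lemma C1_on_extend:
  assumes S: "open S" and h: "C1_on h S" and K: "closed K" "K \<subseteq> S"
    and 0: "\<And>x. x \<notin> K \<Longrightarrow> h x = 0"
  shows "C1_on h UNIV"
proof -
  have U: "S \<union> - K = UNIV" using K by auto
  have 1: "h differentiable (at z)" for z
    using h frechet_zero_outside(2)[of K h z, OF K(1) 0] K(2) unfolding C1_on_def by blast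
  have "continuous_on (- K) (\<lambda>z. frechet_derivative h (at z) v)" for v
    using frechet_zero_outside(1)[of K h, OF K(1) 0]
    by (subst continuous_on_cong[OF refl, where g="\<lambda>z. 0"]) auto
  then have "continuous_on UNIV (\<lambda>z. frechet_derivative h (at z) v)" for v
    using continuous_on_open_Un[OF S open_Compl[OF K(1)] C1_on_D(2)[OF h]] U by metis
  with 1 show ?thesis unfolding C1_on_def by auto
qed

lemma C1_frechet_bound:
  fixes h :: "'a::euclidean_space \<Rightarrow> complex"
  assumes h: "C1_on h K" and K: "compact K"
  obtains B where "B > 0" "\<And>x v. x \<in> K \<Longrightarrow> cmod (frechet_derivative h (at x) v) \<le> B * norm v"
proof -
  have "\<exists>M. \<forall>x\<in>K. cmod (frechet_derivative h (at x) b) \<le> M" for b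
  proof -
    have "compact ((\<lambda>x. frechet_derivative h (at x) b) ` K)"
      using compact_continuous_image[OF C1_on_D(2)[OF h] K] .
    then show ?thesis
      using compact_imp_bounded[of "(\<lambda>x. frechet_derivative h (at x) b) ` K"] unfolding bounded_iff by auto
  qed
  then obtain M where M: "\<And>x b. x \<in> K \<Longrightarrow> cmod (frechet_derivative h (at x) b) \<le> M b" by metis
  show ?thesis
  proof
    show "(\<Sum>b\<in>Basis. \<bar>M b\<bar>) + 1 > 0" by (smt (verit) sum_nonneg abs_ge_zero)
    fix x v assume x: "x \<in> K"
    have lin: "linear (frechet_derivative h (at x))"
      using C1_on_D(1)[OF h x] has_derivative_linear by blast
    have "frechet_derivative h (at x) v = frechet_derivative h (at x) (\<Sum>b\<in>Basis. (v \<bullet> b) *\<^sub>R b)"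
      by (simp add: euclidean_representation)
    also have "\<dots> = (\<Sum>b\<in>Basis. (v \<bullet> b) *\<^sub>R frechet_derivative h (at x) b)"
      by (simp add: linear_sum[OF lin] linear_cmul[OF lin])
    finally have "cmod (frechet_derivative h (at x) v) \<le> (\<Sum>b\<in>Basis. \<bar>M b\<bar> * norm v)"
      using M[OF x]
      by (auto intro!: order_trans[OF norm_sum] sum_mono order_trans[OF mult_mono[OF Basis_le_norm _ _ abs_ge_zero]] 
          simp: mult.commute) (smt (verit) mult_mono' Basis_le_norm norm_ge_zero abs_ge_zero mult.commute)
    then show "cmod (frechet_derivative h (at x) v) \<le> ((\<Sum>b\<in>Basis. \<bar>M b\<bar>) + 1) * norm v"
      by (simp add: sum_distrib_right distrib_right add_increasing2)
  qed
qed

lemma C1_Lipschitz: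
  fixes h :: "'a::euclidean_space \<Rightarrow> complex"
  assumes h: "C1_on h UNIV" and K: "compact K" and 0: "\<And>x. x \<notin> K \<Longrightarrow> h x = 0"
  obtains B where "B > 0" "\<And>x y. cmod (h x - h y) \<le> B * norm (x - y)"
proof -
  obtain B where B: "B > 0" "\<And>x v. x \<in> K \<Longrightarrow> cmod (frechet_derivative h (at x) v) \<le> B * norm v"
    using C1_frechet_bound[OF C1_on_subset[OF h] K] by blast
  have bnd: "cmod (frechet_derivative h (at x) v) \<le> B * norm v" for x v
    using B frechet_zero_outside(1)[of K h x, OF compact_imp_closed[OF K] 0]
    by (cases "x \<in> K") auto
  show ?thesis
  proof
    show "cmod (h x - h y) \<le> B * norm (x - y)" for x y
      by (rule differentiable_bound[of UNIV h "\<lambda>x. frechet_derivative h (at x)"])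
        (use bnd C1_on_D(1)[OF h] in \<open>auto intro!: onorm_le\<close>)
  qed (rule B)
qed

lemma lborel_translate:
  fixes h :: "'a::euclidean_space \<Rightarrow> 'b::{banach, second_countable_topology}"
  assumes "integrable lborel h"
  shows "integrable lborel (\<lambda>x. h (x - c))" "(\<integral>x. h (x - c) \<partial>lborel) = (\<integral>x. h x \<partial>lborel)"
proof -
  have "integrable (distr lborel borel ((+) (- c))) h"
    using assms by (simp add: lborel_distr_plus)
  then show "integrable lborel (\<lambda>x. h (x - c))"
    by (subst (asm) integrable_distr_eq) (use assms in auto)
  have "(\<integral>x. h x \<partial>lborel) = (\<integral>x. h x \<partial>distr lborel borel ((+) (- c)))"
    by (simp add: lborel_distr_plus)
  also have "\<dots> = (\<integral>x. h (x - c) \<partial>lborel)"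
    by (subst integral_distr) (use assms in auto)
  finally show "(\<integral>x. h (x - c) \<partial>lborel) = (\<integral>x. h x \<partial>lborel)" ..
qed

text \<open>By translation invariance the integral of \<open>h (x + t *\<^sub>R v)\<close> does not
  depend on \<open>t\<close>; its derivative at \<open>t = 0\<close> is the integral in question.
  Iterated integrals are avoided.\<close>

lemma integral_frechet_zero:
  fixes h :: "'a::euclidean_space \<Rightarrow> complex"
  assumes h: "C1_on h UNIV" and K: "compact K" and 0: "\<And>x. x \<notin> K \<Longrightarrow> h x = 0"
  shows "(\<integral>x. frechet_derivative h (at x) v \<partial>lborel) = 0"
proof -
  obtain B where B: "B > 0" "\<And>x y. cmod (h x - h y) \<le> B * norm (x - y)"
    using C1_Lipschitz[OF assms] by blast
  \<comment> \<open>\<open>K'\<close> contains the supports of all the translates with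
    \<open>\<bar>t\<bar> \<le> 1\<close>, so one multiple of its indicator dominates every
    difference quotient.\<close>
  define K' where "K' = (\<lambda>(x, t). x - t *\<^sub>R v) ` (K \<times> {-1..1})"
  have K': "compact K'" unfolding K'_def
    by (intro compact_continuous_image compact_Times K) (auto intro!: continuous_intros simp: case_prod_beta)
  have inK': "x \<in> K'" if "x + t *\<^sub>R v \<in> K" "\<bar>t\<bar> \<le> 1" for x t
    unfolding K'_def using that by (intro image_eqI[where x="(x + t *\<^sub>R v, t)"]) auto
  have inth: "integrable lborel h"
    by (rule integrable_compact_support[OF K _ 0])
      (use C1_on_imp_continuous_on[OF h] continuous_on_subset in auto)
  have transl: "integrable lborel (\<lambda>x. h (x + t *\<^sub>R v))"
       "(\<integral>x. h (x + t *\<^sub>R v) \<partial>lborel) = (\<integral>x. h x \<partial>lborel)" for t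
    using lborel_translate[OF inth, of "- t *\<^sub>R v"] by simp_all
  have "((\<lambda>t. \<integral>x. h (x + t *\<^sub>R v) \<partial>lborel) has_derivative 
     (\<lambda>s. \<integral>x. frechet_derivative h (at x) (s *\<^sub>R v) \<partial>lborel)) (at 0)"
  proof (rule has_derivative_integral_param(1)[where r=1 and B="\<lambda>x. indicator K' x *\<^sub>R (B * norm v)"])
    show "integrable lborel (\<lambda>x. indicator K' x *\<^sub>R (B * norm v))"
      by (rule borel_integrable_compact[OF K']) simp
    show "((\<lambda>w. h (z + w *\<^sub>R v)) has_derivative (\<lambda>s. frechet_derivative h (at z) (s *\<^sub>R v))) (at 0)" for z
    proof -
      have "((\<lambda>t. z + t *\<^sub>R v) has_derivative (\<lambda>t. t *\<^sub>R v)) (at (0::real))"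
        by (auto intro!: derivative_eq_intros)
      from has_derivative_compose[OF this, of h] C1_on_D(1)[OF h, of z] show ?thesis by simp
    qed
    show "cmod (h (z + w *\<^sub>R v) - h (z + 0 *\<^sub>R v)) \<le> indicator K' z *\<^sub>R (B * norm v) * norm (w - 0)"
      if w: "w \<in> ball 0 1" for w z
    proof (cases "z \<in> K'")
      case True
      then show ?thesis using B(2)[of "z + w *\<^sub>R v" z] by (simp add: mult_ac)
    next
      case False
      then have "h (z + w *\<^sub>R v) = 0" "h z = 0"
        using 0 inK'[of z w] inK'[of z 0] w by (auto simp: dist_norm)
      then show ?thesis using B(1) by simp
    qed
  qed (use transl in auto)
  moreover have "((\<lambda>t. \<integral>x. h (x + t *\<^sub>R v) \<partial>lborel) has_derivative (\<lambda>s. 0)) (at 0)"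
    by (simp add: transl(2))
  ultimately have "(\<lambda>s. \<integral>x. frechet_derivative h (at x) (s *\<^sub>R v) \<partial>lborel) = (\<lambda>s. 0)"
    by (rule has_derivative_unique)
  from fun_cong[OF this, of 1] show ?thesis by simp
qed

lemma integrable_frechet:
  fixes h :: "'a::euclidean_space \<Rightarrow> complex"
  assumes h: "C1_on h UNIV" and K: "compact K" and 0: "\<And>x. x \<notin> K \<Longrightarrow> h x = 0"
  shows "integrable lborel (\<lambda>x. frechet_derivative h (at x) v)"
proof (rule integrable_compact_support[OF K])
  show "continuous_on K (\<lambda>x. frechet_derivative h (at x) v)"
    using C1_on_D(2)[OF C1_on_subset[OF h]] by blast
  show "frechet_derivative h (at x) v = 0" if "x \<notin> K" for x
    using frechet_zero_outside(1)[of K h x, OF compact_imp_closed[OF K] 0] that by simp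
qed

lemma integral_dz_zero:
  assumes h: "C1_on h UNIV" and K: "compact K" and 0: "\<And>x. x \<notin> K \<Longrightarrow> h x = 0"
  shows "(\<integral>x. dz k h x \<partial>lborel) = 0" "(\<integral>x. dzb k h x \<partial>lborel) = 0"
  unfolding dz_def dzb_def
  using integral_frechet_zero[OF assms] integrable_frechet[OF assms] by simp_all

subsection \<open>A radial mollifier\<close>

text \<open>The square makes the function continuously differentiable at \<open>r = 1\<close>. It
  will be composed with squared norms, so the origin causes no singularity either.\<close>

definition bump :: "real \<Rightarrow> real" where "bump r = (max 0 (1 - r))\<^sup>2"

lemma bump_has_real_derivative: "(bump has_real_derivative - 2 * max 0 (1 - r)) (at r)"
proof -
  consider "r < 1" | "r = 1" | "r > 1" by linarith
  then show ?thesis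
  proof cases
    case 1
    have "((\<lambda>r. (1 - r)\<^sup>2) has_real_derivative - 2 * max 0 (1 - r)) (at r)"
      using 1 by (auto intro!: derivative_eq_intros)
    then show ?thesis
      by (rule has_field_derivative_transform_within[where d="1 - r"]) (use 1 in \<open>auto simp: bump_def dist_real_def abs_if split: if_splits\<close>)
  next
    case 3
    have "((\<lambda>r::real. 0) has_real_derivative - 2 * max 0 (1 - r)) (at r)"
      using 3 by (auto intro!: derivative_eq_intros)
    then show ?thesis
      by (rule has_field_derivative_transform_within[where d="r - 1"]) (use 3 in \<open>auto simp: bump_def dist_real_def abs_if split: if_splits\<close>)
  next
    case 2
    have "((\<lambda>h. max 0 (- h) * (if h \<le> 0 then -1 else 0)) \<longlongrightarrow> 0) (at (0::real))"
      by (rule Lim_null_comparison[OF always_eventually tendsto_rabs_zero[OF tendsto_ident_at]]) (auto simp: max_def)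
    moreover have "(bump (1 + h) - bump 1) / h = max 0 (- h) * (if h \<le> 0 then -1 else 0)" for h
      by (auto simp: bump_def max_def power2_eq_square)
    ultimately show ?thesis using 2 by (simp add: DERIV_def)
  qed
qed

lemma bump_nonneg [simp]: "bump r \<ge> 0" and bump_zero: "r \<ge> 1 \<Longrightarrow> bump r = 0"
  and bump_pos: "r < 1 \<Longrightarrow> bump r > 0"
  by (auto simp: bump_def)

text \<open>Supported in the ball of radius \<open>1 / sqrt t\<close>. The real dimension is
  \<open>2 * CARD('d)\<close>, so the power of \<open>t\<close> keeps the total mass independent of
  the scale.\<close>

definition scaled_bump :: "real \<Rightarrow> complex^'d \<Rightarrow> complex" where
  "scaled_bump t x = of_real (t ^ CARD('d) * bump (t * (norm x)\<^sup>2))"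

lemma scaled_bump_zero: "t > 0 \<Longrightarrow> t * (norm x)\<^sup>2 \<ge> 1 \<Longrightarrow> scaled_bump t x = 0"
  by (simp add: scaled_bump_def bump_zero)

lemma has_derivative_bump_norm:
  fixes x :: "'a::real_inner"
  shows "((\<lambda>x. bump (t * (norm x)\<^sup>2)) has_derivative
    (\<lambda>v. - 2 * max 0 (1 - t * (norm x)\<^sup>2) * (2 * t * (x \<bullet> v)))) (at x)"
proof -
  have "((\<lambda>x. t * (norm x)\<^sup>2) has_derivative (\<lambda>v. 2 * t * (x \<bullet> v))) (at x)"
    unfolding power2_norm_eq_inner
    by (auto intro!: derivative_eq_intros simp: inner_commute)
  from has_derivative_compose[OF this bump_has_real_derivative[unfolded has_field_derivative_def]]
  show ?thesis by simp
qed

lemma C1_scaled_bump: "C1_on (scaled_bump t) UNIV"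
proof -
  have "((\<lambda>x. of_real (t ^ CARD('d) * bump (t * (norm x)\<^sup>2)) :: complex) has_derivative
    (\<lambda>v. of_real (t ^ CARD('d) * (- 2 * max 0 (1 - t * (norm z)\<^sup>2) * (2 * t * (z \<bullet> v)))))) (at z)" for z :: "complex^'d"
    by (intro has_derivative_of_real has_derivative_mult_right has_derivative_bump_norm)
  then show ?thesis unfolding scaled_bump_def [abs_def]
    by (rule C1_onI) (auto intro!: continuous_intros)
qed

lemma inner_axis_complex: "(x::complex^'d) \<bullet> axis k 1 = Re (x $ k)" "x \<bullet> axis k \<i> = Im (x $ k)"
  by (simp_all add: inner_axis inner_complex_def)

lemma norm_vec_sq: "(\<Sum>j\<in>UNIV. (cmod (x $ j))\<^sup>2) = (norm x)\<^sup>2" for x :: "complex^'d"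
  by (simp add: norm_vec_def L2_set_def sum_nonneg)

text \<open>The conjugate radial field around \<open>w\<close>, cut off at the radius of the kernel.
  Its divergence in the conjugate derivatives, times \<open>- t ^ (CARD('d) - 1)\<close>, is the
  derivative of the kernel in \<open>t\<close>.\<close>

definition bump_field :: "real \<Rightarrow> complex^'d \<Rightarrow> 'd \<Rightarrow> complex^'d \<Rightarrow> complex" where
  "bump_field t w j \<zeta> = cnj ((w - \<zeta>) $ j) * of_real (bump (t * (norm (w - \<zeta>))\<^sup>2))"

lemma C1_bump_shift: "C1_on (\<lambda>\<zeta>. of_real (bump (t * (norm (w - \<zeta>))\<^sup>2))) UNIV"
  and bump_shift_derivative: "((\<lambda>\<zeta>. of_real (bump (t * (norm (w - \<zeta>))\<^sup>2)) :: complex) has_derivative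
    (\<lambda>v. of_real (2 * max 0 (1 - t * (norm (w - \<zeta>))\<^sup>2) * (2 * t * ((w - \<zeta>) \<bullet> v))))) (at \<zeta>)"
  for w :: "complex^'d"
proof -
  show *: "((\<lambda>\<zeta>. of_real (bump (t * (norm (w - \<zeta>))\<^sup>2)) :: complex) has_derivative
    (\<lambda>v. of_real (2 * max 0 (1 - t * (norm (w - \<zeta>))\<^sup>2) * (2 * t * ((w - \<zeta>) \<bullet> v))))) (at \<zeta>)" for \<zeta>
  proof -
    have "((\<lambda>\<zeta>. w - \<zeta>) has_derivative (\<lambda>v. - v)) (at \<zeta>)"
      by (auto intro!: derivative_eq_intros)
    from has_derivative_of_real[OF has_derivative_compose[OF this has_derivative_bump_norm]]
    show ?thesis by (simp add: inner_minus_right)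
  qed
  show "C1_on (\<lambda>\<zeta>. of_real (bump (t * (norm (w - \<zeta>))\<^sup>2))) UNIV"
    by (rule C1_onI[OF *]) (auto intro!: continuous_intros)
qed

lemma cnj_coord_derivative: "((\<lambda>\<zeta>. cnj ((w - \<zeta>) $ j)) has_derivative (\<lambda>v. - cnj (v $ j))) (at \<zeta>)"
  for w :: "complex^'d"
proof -
  have "((\<lambda>\<zeta>. w - \<zeta>) has_derivative (\<lambda>v. - v)) (at \<zeta>)"
    by (auto intro!: derivative_eq_intros)
  from bounded_linear.has_derivative[OF bounded_linear_cnj 
      bounded_linear.has_derivative[OF bounded_linear_vec_nth[of j] this]]
  show ?thesis by simp
qed

lemma C1_bump_field: "C1_on (bump_field t w j) UNIV"
proof -
  have "C1_on (\<lambda>\<zeta>. cnj ((w - \<zeta>) $ j)) UNIV"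
    by (rule C1_onI[OF cnj_coord_derivative]) (auto intro!: continuous_intros)
  then show ?thesis unfolding bump_field_def [abs_def] by (intro C1_on_mult C1_bump_shift)
qed

lemma dzb_bump_field:
  "dzb j (bump_field t w j) \<zeta> = of_real (- bump (t * (norm (w - \<zeta>))\<^sup>2)
     + 2 * max 0 (1 - t * (norm (w - \<zeta>))\<^sup>2) * t * (cmod ((w - \<zeta>) $ j))\<^sup>2)"
proof -
  have 1: "dzb j (\<lambda>\<zeta>. cnj ((w - \<zeta>) $ j)) \<zeta> = - 1"
    unfolding dzb_eq[OF cnj_coord_derivative] by (simp add: axis_def)
  have 2: "dzb j (\<lambda>\<zeta>. of_real (bump (t * (norm (w - \<zeta>))\<^sup>2))) \<zeta> =
      of_real (2 * max 0 (1 - t * (norm (w - \<zeta>))\<^sup>2) * t) * (w - \<zeta>) $ j"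
    using dzb_eq[OF bump_shift_derivative, where k=j]
    unfolding inner_axis_complex by (simp add: complex_eq_iff)
  have "dzb j (bump_field t w j) \<zeta> = - of_real (bump (t * (norm (w - \<zeta>))\<^sup>2)) +
     cnj ((w - \<zeta>) $ j) * (of_real (2 * max 0 (1 - t * (norm (w - \<zeta>))\<^sup>2) * t) * (w - \<zeta>) $ j)"
    unfolding bump_field_def [abs_def]
    unfolding dz_mult(2)[OF differentiableI[OF cnj_coord_derivative] differentiableI[OF bump_shift_derivative]]
    unfolding 1 2 by simp
  also have "\<dots> = of_real (- bump (t * (norm (w - \<zeta>))\<^sup>2)
     + 2 * max 0 (1 - t * (norm (w - \<zeta>))\<^sup>2) * t * (cmod ((w - \<zeta>) $ j))\<^sup>2)"
    using complex_norm_square[of "(w - \<zeta>) $ j"] by (simp add: mult_ac)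
  finally show ?thesis .
qed

text \<open>This is why mollifying a weakly holomorphic density gives a result that does not depend on
  the scale.\<close>

lemma scaled_bump_has_derivative_scale:
  fixes w :: "complex^'d"
  assumes t: "t > 0"
  shows "((\<lambda>t. scaled_bump t (w - \<zeta>)) has_derivative
     (\<lambda>s. of_real s * (- of_real (t ^ (CARD('d) - 1)) * (\<Sum>j\<in>UNIV. dzb j (bump_field t w j) \<zeta>)))) (at t)"
proof -
  let ?n = "CARD('d)"
  define \<rho> where "\<rho> = (norm (w - \<zeta>))\<^sup>2"
  have "(\<Sum>j\<in>UNIV. dzb j (bump_field t w j) \<zeta>)
     = of_real (\<Sum>j\<in>UNIV. - bump (t * \<rho>) + 2 * max 0 (1 - t * \<rho>) * t * (cmod ((w - \<zeta>) $ j))\<^sup>2)"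
    unfolding dzb_bump_field \<rho>_def by simp
  also have "(\<Sum>j\<in>UNIV. - bump (t * \<rho>) + 2 * max 0 (1 - t * \<rho>) * t * (cmod ((w - \<zeta>) $ j))\<^sup>2)
     = - (?n * bump (t * \<rho>)) + 2 * max 0 (1 - t * \<rho>) * t * \<rho>"
    unfolding sum.distrib sum_distrib_left[symmetric] norm_vec_sq \<rho>_def by simp
  finally have S: "(\<Sum>j\<in>UNIV. dzb j (bump_field t w j) \<zeta>) = of_real (- (?n * bump (t * \<rho>)) + 2 * max 0 (1 - t * \<rho>) * t * \<rho>)" .
  have "((\<lambda>t. t * \<rho>) has_real_derivative \<rho>) (at t)" by (auto intro!: derivative_eq_intros)
  from DERIV_chain2[OF bump_has_real_derivative this]
  have b: "((\<lambda>t. bump (t * \<rho>)) has_real_derivative - 2 * max 0 (1 - t * \<rho>) * \<rho>) (at t)" by simp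
  have "((\<lambda>t. t ^ ?n * bump (t * \<rho>)) has_real_derivative
      ?n * t ^ (?n - 1) * bump (t * \<rho>) + (- 2 * max 0 (1 - t * \<rho>) * \<rho>) * t ^ ?n) (at t)"
    using DERIV_mult[OF DERIV_pow[of ?n t UNIV] b] by simp
  moreover have "t ^ ?n = t * t ^ (?n - 1)"
    using power_Suc[of t "?n - 1"] by simp
  ultimately have "((\<lambda>t. t ^ ?n * bump (t * \<rho>)) has_real_derivative
      - (t ^ (?n - 1)) * (- (?n * bump (t * \<rho>)) + 2 * max 0 (1 - t * \<rho>) * t * \<rho>)) (at t)"
    by (simp add: algebra_simps)
  then have "((\<lambda>t. t ^ ?n * bump (t * \<rho>)) has_derivative
      (*) (- (t ^ (?n - 1)) * (- (?n * bump (t * \<rho>)) + 2 * max 0 (1 - t * \<rho>) * t * \<rho>))) (at t)"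
    by (simp add: has_field_derivative_def)
  from has_derivative_of_real[OF this, where 'a=complex]
  show ?thesis
    unfolding scaled_bump_def \<rho>_def[symmetric] S by (simp add: mult_ac)
qed

text \<open>A bound uniform in \<open>x\<close>, needed to differentiate in the scale under the
  integral. With \<open>s = u * (norm x)\<^sup>2\<close> the derivative is
  \<open>u ^ (CARD('d) - 1)\<close> times a combination of \<open>CARD('d) * bump s\<close> and
  \<open>2 * (1 - s) * s\<close> for \<open>s \<le> 1\<close>, of modulus at most
  \<open>CARD('d) + 2\<close>; the remaining power is estimated by
  \<open>u \<le> 2 * t\<close>.\<close>

lemma scaled_bump_scale_lipschitz:
  assumes t: "t > 0" and s: "s \<in> {t/2..2*t}" 
  shows "cmod (scaled_bump s x - scaled_bump t (x::complex^'d)) \<le> (2 * t) ^ (CARD('d) - 1) * (CARD('d) + 2) * \<bar>s - t\<bar>"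
proof -
  let ?n = "CARD('d)"
  let ?B = "(2 * t) ^ (CARD('d) - 1) * (real CARD('d) + 2)"
  have d: "((\<lambda>t. scaled_bump t (x - 0)) has_derivative
     (\<lambda>s. of_real s * (- of_real (u ^ (?n - 1)) * (\<Sum>j\<in>UNIV. dzb j (bump_field u x j) 0)))) (at u)" if "u > 0" for u
    by (rule scaled_bump_has_derivative_scale[OF that])
  have bnd: "cmod (- of_real (u ^ (?n - 1)) * (\<Sum>j\<in>UNIV. dzb j (bump_field u x j) 0)) \<le> ?B" if u: "u \<in> {t/2..2*t}" for u
  proof -
    define \<rho> where "\<rho> = (norm x)\<^sup>2"
    have u0: "u > 0" using u t by auto
    have "(\<Sum>j\<in>UNIV. dzb j (bump_field u x j) 0)
       = of_real (\<Sum>j\<in>UNIV. - bump (u * \<rho>) + 2 * max 0 (1 - u * \<rho>) * u * (cmod (x $ j))\<^sup>2)"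
      unfolding dzb_bump_field \<rho>_def by simp
    also have "(\<Sum>j\<in>UNIV. - bump (u * \<rho>) + 2 * max 0 (1 - u * \<rho>) * u * (cmod (x $ j))\<^sup>2)
       = - (?n * bump (u * \<rho>)) + 2 * max 0 (1 - u * \<rho>) * (u * \<rho>)"
      unfolding sum.distrib sum_distrib_left[symmetric] norm_vec_sq \<rho>_def by simp
    finally have S: "(\<Sum>j\<in>UNIV. dzb j (bump_field u x j) 0) = of_real (- (?n * bump (u * \<rho>)) + 2 * max 0 (1 - u * \<rho>) * (u * \<rho>))" .
    have ur: "u * \<rho> \<ge> 0" using u0 by (simp add: \<rho>_def)
    have "bump (u * \<rho>) \<le> 1" unfolding bump_def using ur by (intro power_le_one) auto
    moreover have "2 * max 0 (1 - u * \<rho>) * (u * \<rho>) \<le> 2"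
    proof (cases "u * \<rho> \<le> 1")
      case True
      then have "(1 - u * \<rho>) * (u * \<rho>) \<le> 1 * 1" using ur by (intro mult_mono) auto
      moreover have "2 * max 0 (1 - u * \<rho>) * (u * \<rho>) = 2 * ((1 - u * \<rho>) * (u * \<rho>))"
        using True by simp
      ultimately show ?thesis by linarith
    qed (use ur in simp)
    moreover have "2 * max 0 (1 - u * \<rho>) * (u * \<rho>) \<ge> 0" using ur by simp
    moreover have "?n * bump (u * \<rho>) \<le> ?n" using \<open>bump (u * \<rho>) \<le> 1\<close> by (simp add: mult_left_le)
    moreover have "?n * bump (u * \<rho>) \<ge> 0" by simp
    ultimately have "\<bar>- (?n * bump (u * \<rho>)) + 2 * max 0 (1 - u * \<rho>) * (u * \<rho>)\<bar> \<le> ?n + 2"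
      by linarith
    moreover have "u ^ (?n - 1) \<le> (2 * t) ^ (?n - 1)" using u u0 by (intro power_mono) auto
    ultimately have "u ^ (?n - 1) * \<bar>- (?n * bump (u * \<rho>)) + 2 * max 0 (1 - u * \<rho>) * (u * \<rho>)\<bar> \<le> ?B"
      using u0 t by (intro mult_mono) auto
    moreover have "cmod (- of_real (u ^ (?n - 1)) * of_real (- (?n * bump (u * \<rho>)) + 2 * max 0 (1 - u * \<rho>) * (u * \<rho>)))
      = u ^ (?n - 1) * \<bar>- (?n * bump (u * \<rho>)) + 2 * max 0 (1 - u * \<rho>) * (u * \<rho>)\<bar>"
      using u0 by (simp only: norm_mult norm_minus_cancel norm_of_real) simp
    ultimately show ?thesis unfolding S by simp
  qed
  have gen: "norm (of_real s * A) \<le> B * norm s" if "cmod A \<le> B" for A B and s :: real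
    using mult_left_mono[OF that, of "\<bar>s\<bar>"] by (simp add: norm_mult mult.commute)
  have "norm (scaled_bump s (x - 0) - scaled_bump t (x - 0)) \<le> ?B * norm (s - t)"
  proof (rule differentiable_bound[of "{t/2..2*t}" _ "\<lambda>u s. of_real s * (- of_real (u ^ (?n - 1)) * (\<Sum>j\<in>UNIV. dzb j (bump_field u x j) 0))"])
    fix u assume u: "u \<in> {t/2..2*t}"
    then have u0: "u > 0" using t by auto
    show "((\<lambda>t. scaled_bump t (x - 0)) has_derivative
     (\<lambda>s. of_real s * (- of_real (u ^ (?n - 1)) * (\<Sum>j\<in>UNIV. dzb j (bump_field u x j) 0)))) (at u within {t/2..2*t})"
      by (rule has_derivative_at_withinI[OF d[OF u0]])
    show "onorm (\<lambda>s. of_real s * (- of_real (u ^ (?n - 1)) * (\<Sum>j\<in>UNIV. dzb j (bump_field u x j) 0))) \<le> ?B"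
      by (rule onorm_le) (rule gen[OF bnd[OF u]])
  qed (use s t in auto)
  then show ?thesis by (simp add: add.commute)
qed

subsection \<open>Traces of weakly holomorphic densities\<close>

text \<open>The mass depends on the dimension only, which is therefore passed as a type.\<close>

definition bump_mass :: "'d::finite itself \<Rightarrow> complex" where
  "bump_mass _ = (\<integral>x. scaled_bump 1 (x::complex^'d) \<partial>lborel)"

definition mol :: "real \<Rightarrow> complex^'d \<Rightarrow> complex" where
  "mol t x = scaled_bump t x / bump_mass TYPE('d)"

text \<open>The push-forward under \<open>q\<close> of the measure with density \<open>a\<close>
  satisfies the Cauchy-Riemann equations weakly on \<open>Y\<close>. All integrals are kept on
  \<open>X\<close>, so preimages of points never enter. The interpretations are
  \<open>q = \<Phi>\<close> for the trace, the identity for Weyl's lemma, and the constant density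
  for the mass of the kernel.\<close>

locale weakly_holo_density =
  fixes X Y :: "(complex^'d) set" and q :: "complex^'d \<Rightarrow> complex^'d" and a :: "complex^'d \<Rightarrow> complex"
  assumes X: "open X" and Y: "open Y"
    and a_cont: "continuous_on X a" and a_zero: "\<And>z. z \<notin> X \<Longrightarrow> a z = 0"
    and q_cont: "continuous_on X q"
    and proper: "\<And>K. compact K \<Longrightarrow> K \<subseteq> Y \<Longrightarrow> compact {z\<in>X. q z \<in> K}"
    and weak: "\<And>\<psi> j K. C1_on \<psi> UNIV \<Longrightarrow> compact K \<Longrightarrow> K \<subseteq> Y \<Longrightarrow> (\<And>w. w \<notin> K \<Longrightarrow> \<psi> w = 0)
       \<Longrightarrow> (\<integral>z. a z * dzb j \<psi> (q z) \<partial>lborel) = 0"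
begin

lemma integrable_test:
  assumes "continuous_on UNIV u" "compact K" "K \<subseteq> Y" "\<And>w. w \<notin> K \<Longrightarrow> u w = 0"
  shows "integrable lborel (\<lambda>z. a z * u (q z))"
proof (rule integrable_compact_support[OF proper[OF assms(2,3)]])
  show "continuous_on {z \<in> X. q z \<in> K} (\<lambda>z. a z * u (q z))"
    by (intro continuous_on_mult continuous_on_compose2[OF assms(1)]
        continuous_on_subset[OF a_cont] continuous_on_subset[OF q_cont]) auto
qed (use a_zero assms(4) in auto)

lemma integrable_norm_part:
  assumes "compact K" "K \<subseteq> Y"
  shows "integrable lborel (\<lambda>z. indicator {z\<in>X. q z \<in> K} z *\<^sub>R cmod (a z))"
  by (rule borel_integrable_compact[OF proper[OF assms]])
    (intro continuous_on_norm continuous_on_subset[OF a_cont], auto)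

lemma scaled_bump_support:
  assumes "t > 0" "R > 0" "1 < t * R\<^sup>2" "scaled_bump t x \<noteq> 0"
  shows "norm x < R"
proof (rule ccontr)
  assume "\<not> norm x < R"
  then have "R\<^sup>2 \<le> (norm x)\<^sup>2" using assms by (intro power_mono) auto
  then have "t * R\<^sup>2 \<le> t * (norm x)\<^sup>2" using assms by simp
  then have "1 \<le> t * (norm x)\<^sup>2" using assms(3) by linarith
  then have "scaled_bump t x = 0" by (rule scaled_bump_zero[OF assms(1)])
  then show False using assms by simp
qed

definition mollified :: "real \<Rightarrow> complex^'d \<Rightarrow> complex" where
  "mollified t w = (\<integral>z. a z * scaled_bump t (w - q z) \<partial>lborel)"

lemma scaled_bump_shift_C1: "C1_on (\<lambda>\<zeta>. scaled_bump t (w - \<zeta>)) UNIV"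
  and scaled_bump_shift_derivative: "((\<lambda>\<zeta>. scaled_bump t (w - \<zeta>)) has_derivative (\<lambda>v. - frechet_derivative (scaled_bump t) (at (w - \<zeta>)) v)) (at \<zeta>)"
proof -
  show *: "((\<lambda>\<zeta>. scaled_bump t (w - \<zeta>)) has_derivative (\<lambda>v. - frechet_derivative (scaled_bump t) (at (w - \<zeta>)) v)) (at \<zeta>)" for \<zeta>
  proof -
    have "linear (frechet_derivative (scaled_bump t) (at (w - \<zeta>)))"
      using C1_on_D(1)[OF C1_scaled_bump] has_derivative_linear by blast
    moreover have "((\<lambda>\<zeta>. w - \<zeta>) has_derivative (\<lambda>v. - v)) (at \<zeta>)"
      by (auto intro!: derivative_eq_intros)
    from has_derivative_compose[OF this C1_on_D(1)[OF C1_scaled_bump]]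
    have "((\<lambda>\<zeta>. scaled_bump t (w - \<zeta>)) has_derivative (\<lambda>v. frechet_derivative (scaled_bump t) (at (w - \<zeta>)) (- v))) (at \<zeta>)"
      by simp
    ultimately show ?thesis by (simp add: linear_neg)
  qed
  show "C1_on (\<lambda>\<zeta>. scaled_bump t (w - \<zeta>)) UNIV"
    by (rule C1_onI[OF *])
      (intro continuous_on_minus continuous_on_compose2[OF C1_on_D(2)[OF C1_scaled_bump]] continuous_intros, auto)
qed

lemma dzb_scaled_bump_shift: "dzb k (\<lambda>\<zeta>. scaled_bump t (w - \<zeta>)) \<zeta> = - dzb k (scaled_bump t) (w - \<zeta>)"
  unfolding dzb_eq[OF scaled_bump_shift_derivative] by (simp add: dzb_def field_simps)

text \<open>The derivative in \<open>w\<close> falls on the kernel, where it is minus the derivative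
  in the variable of integration; the integral is then one that \<open>weak\<close> makes
  zero.\<close>

lemma mollified_holo_at:
  assumes t: "t > 0" "R > 0" "1 < t * R\<^sup>2" and sub: "cball w R \<subseteq> Y"
  shows "mollified t differentiable (at w)" "dzb k (mollified t) w = 0"
proof -
  \<comment> \<open>The room left by the kernel radius \<open>1 / sqrt t\<close>: moving the centre
    by less than \<open>r\<close> keeps the support inside \<open>cball w R\<close>.\<close>
  define r where "r = R - 1 / sqrt t"
  have "1 / sqrt t < R"
  proof -
    have "1 < sqrt (t * R\<^sup>2)" using t by simp
    also have "\<dots> = sqrt t * R" using t by (simp add: real_sqrt_mult)
    finally show ?thesis using t by (simp add: field_simps)
  qed
  then have r: "r > 0" by (simp add: r_def)
  have supp: "\<zeta> \<in> cball w R" if "w' \<in> ball w r" "scaled_bump t (w' - \<zeta>) \<noteq> 0" for w' \<zeta>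
  proof -
    have "t * (norm (w' - \<zeta>))\<^sup>2 < 1" using scaled_bump_zero[of t "w' - \<zeta>"] that t by force
    then have "sqrt (t * (norm (w' - \<zeta>))\<^sup>2) < 1" by simp
    then have "sqrt t * norm (w' - \<zeta>) < 1" by (simp add: real_sqrt_mult)
    then have "norm (w' - \<zeta>) < 1 / sqrt t" using t by (simp add: field_simps)
    moreover have "norm (w - w') < r" using that by (simp add: dist_norm)
    ultimately show ?thesis
      using norm_triangle_ineq[of "w - w'" "w' - \<zeta>"] by (simp add: dist_norm r_def)
  qed
  let ?K = "cball w R"
  have K: "compact ?K" by simp
  obtain B where B: "B > 0" "\<And>x y. cmod (scaled_bump t x - scaled_bump t y) \<le> B * norm (x - (y::complex^'d))"
  proof (rule C1_Lipschitz[OF C1_scaled_bump[of t]])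
    show "compact (cball 0 R :: (complex^'d) set)" by simp
    show "scaled_bump t x = 0" if "x \<notin> cball 0 R" for x :: "complex^'d"
      using that scaled_bump_support[of t R x] t by (auto simp: dist_norm)
  qed blast
  let ?D = "\<lambda>z v. a z * frechet_derivative (scaled_bump t) (at (w - q z)) v"
  have d: "((\<lambda>w. \<integral>z. a z * scaled_bump t (w - q z) \<partial>lborel) has_derivative (\<lambda>v. \<integral>z. ?D z v \<partial>lborel)) (at w)"
    and i: "integrable lborel (\<lambda>z. ?D z v)" for v
  proof (atomize (full), goal_cases)
    case 1
    have int: "integrable lborel (\<lambda>z. a z * scaled_bump t (w' - q z))" if "w' \<in> ball w r" for w'
      by (rule integrable_test[where u="\<lambda>\<zeta>. scaled_bump t (w' - \<zeta>)", OF C1_on_imp_continuous_on[OF scaled_bump_shift_C1] K sub])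
        (use supp[OF that] in blast)
    have der: "((\<lambda>w. a z * scaled_bump t (w - q z)) has_derivative ?D z) (at w)" for z
    proof -
      have "((\<lambda>w. w - q z) has_derivative (\<lambda>v. v)) (at w)" by (auto intro!: derivative_eq_intros)
      from has_derivative_mult_right[OF has_derivative_compose[OF this C1_on_D(1)[OF C1_scaled_bump]]]
      show ?thesis by simp
    qed
    have lip: "cmod (a z * scaled_bump t (w' - q z) - a z * scaled_bump t (w - q z))
       \<le> (indicator {z\<in>X. q z \<in> ?K} z *\<^sub>R cmod (a z)) * B * norm (w' - w)" if "w' \<in> ball w r" for w' z
    proof (cases "z \<in> X \<and> q z \<in> ?K")
      case True
      have "cmod (a z * scaled_bump t (w' - q z) - a z * scaled_bump t (w - q z)) = cmod (a z) * cmod (scaled_bump t (w' - q z) - scaled_bump t (w - q z))"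
        by (simp add: norm_mult flip: right_diff_distrib)
      also have "\<dots> \<le> cmod (a z) * (B * norm (w' - w))"
        using B(2)[of "w' - q z" "w - q z"] by (intro mult_left_mono) auto
      finally show ?thesis using True by (simp add: mult_ac)
    next
      case False
      then have "a z * scaled_bump t (w' - q z) = 0" "a z * scaled_bump t (w - q z) = 0"
        using supp[OF that, of "q z"] supp[of w "q z"] r a_zero[of z] by auto
      then show ?thesis using False by auto
    qed
    have "integrable lborel (\<lambda>z. (indicator {z\<in>X. q z \<in> ?K} z *\<^sub>R cmod (a z)) * B)"
      by (rule integrable_mult_left[OF integrable_norm_part[OF K sub]])
    from has_derivative_integral_param[OF r int der lip this] show ?case by auto
  qed
  show "mollified t differentiable (at w)"
    using d unfolding mollified_def[abs_def] by (rule differentiableI)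
  have "(\<integral>z. a z * dzb k (\<lambda>\<zeta>. scaled_bump t (w - \<zeta>)) (q z) \<partial>lborel) = 0"
    by (rule weak[OF scaled_bump_shift_C1 K sub]) (use supp[of w] r in auto)
  then have "(\<integral>z. a z * dzb k (scaled_bump t) (w - q z) \<partial>lborel) = 0"
    by (simp add: dzb_scaled_bump_shift)
  moreover have "dzb k (mollified t) w = (\<integral>z. a z * dzb k (scaled_bump t) (w - q z) \<partial>lborel)"
  proof -
    have "dzb k (mollified t) w = ((\<integral>z. ?D z (axis k 1) \<partial>lborel) + \<i> * (\<integral>z. ?D z (axis k \<i>) \<partial>lborel)) / 2"
      using dzb_eq[OF d] unfolding mollified_def[abs_def] .
    also have "\<dots> = (\<integral>z. (?D z (axis k 1) + \<i> * ?D z (axis k \<i>)) / 2 \<partial>lborel)"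
      using i by simp
    finally show ?thesis by (simp add: dzb_def algebra_simps)
  qed
  ultimately show "dzb k (mollified t) w = 0" by simp
qed

text \<open>The derivative in the scale is a combination of the integrals of
  \<open>a z * dzb j (bump_field u w j) (q z)\<close>, and each of these is zero by
  \<open>weak\<close>.\<close>

lemma mollified_const:
  assumes t: "t > 0" "s > 0" "R > 0" "1 < t * R\<^sup>2" "1 < s * R\<^sup>2" and sub: "cball w R \<subseteq> Y"
  shows "mollified t w = mollified s w"
proof -
  let ?K = "cball w R"
  \<comment> \<open>The scales whose kernel radius is less than \<open>R\<close>; an interval, so a
    zero derivative there means constant.\<close>
  let ?T = "{1 / R\<^sup>2 <..}"
  have K: "compact ?K" by simp
  have supp: "\<zeta> \<in> ?K" if "u \<in> ?T" "scaled_bump u (w - \<zeta>) \<noteq> 0" for u \<zeta>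
  proof -
    have "1 < u * R\<^sup>2" "u > 0" using that(1) t
      by (auto simp: field_simps intro: less_trans[OF _ that(1)[unfolded greaterThan_iff]])
    then show ?thesis using scaled_bump_support[of u R "w - \<zeta>"] that(2) t by (simp add: dist_norm)
  qed
  have der: "((\<lambda>u. mollified u w) has_derivative (\<lambda>h. 0)) (at u)" if u: "u \<in> ?T" for u
  proof -
    have u0: "u > 0" by (rule less_trans[OF _ u[unfolded greaterThan_iff]]) (use t in auto)
    let ?E = "\<lambda>\<zeta>. - of_real (u ^ (CARD('d) - 1)) * (\<Sum>j\<in>UNIV. dzb j (bump_field u w j) \<zeta>)"
    \<comment> \<open>Keeps the nearby scales inside \<open>?T\<close> and inside
      \<open>{u/2..2*u}\<close>, where the Lipschitz bound is available.\<close>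
    define r where "r = min (u / 2) (u - 1 / R\<^sup>2)"
    have r: "r > 0" using u u0 by (simp add: r_def)
    have T: "u' \<in> ?T" "u' \<in> {u/2..2*u}" if "u' \<in> ball u r" for u'
      using that u0 by (auto simp: r_def dist_real_def abs_if split: if_splits)
    let ?C = "(2 * u) ^ (CARD('d) - 1) * (CARD('d) + 2)"
    have int: "integrable lborel (\<lambda>z. a z * scaled_bump u' (w - q z))" if "u' \<in> ball u r" for u'
      by (rule integrable_test[where u="\<lambda>\<zeta>. scaled_bump u' (w - \<zeta>)", OF C1_on_imp_continuous_on[OF scaled_bump_shift_C1] K sub])
        (use supp[OF T(1)[OF that]] in blast)
    have d: "((\<lambda>u. a z * scaled_bump u (w - q z)) has_derivative (\<lambda>s. a z * (of_real s * ?E (q z)))) (at u)" for z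
      by (intro has_derivative_mult_right scaled_bump_has_derivative_scale u0)
    have lip: "cmod (a z * scaled_bump u' (w - q z) - a z * scaled_bump u (w - q z))
       \<le> (indicator {z\<in>X. q z \<in> ?K} z *\<^sub>R cmod (a z)) * ?C * norm (u' - u)" if u': "u' \<in> ball u r" for u' z
    proof (cases "z \<in> X \<and> q z \<in> ?K")
      case True
      have "cmod (a z * scaled_bump u' (w - q z) - a z * scaled_bump u (w - q z)) = cmod (a z) * cmod (scaled_bump u' (w - q z) - scaled_bump u (w - q z))"
        by (simp add: norm_mult flip: right_diff_distrib)
      also have "\<dots> \<le> cmod (a z) * (?C * norm (u' - u))"
        using scaled_bump_scale_lipschitz[OF u0 T(2)[OF u'], of "w - q z"] by (intro mult_left_mono) auto
      finally show ?thesis using True by (simp add: mult_ac)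
    next
      case False
      then have "a z * scaled_bump u' (w - q z) = 0" "a z * scaled_bump u (w - q z) = 0"
        using supp[OF T(1)[OF u'], of "q z"] supp[OF u, of "q z"] a_zero[of z] by auto
      then show ?thesis using False by auto
    qed
    have B: "integrable lborel (\<lambda>z. (indicator {z\<in>X. q z \<in> ?K} z *\<^sub>R cmod (a z)) * ?C)"
      by (rule integrable_mult_left[OF integrable_norm_part[OF K sub]])
    have D: "((\<lambda>u. \<integral>z. a z * scaled_bump u (w - q z) \<partial>lborel) has_derivative
        (\<lambda>s. \<integral>z. a z * (of_real s * ?E (q z)) \<partial>lborel)) (at u)"
      using has_derivative_integral_param(1)[OF r int d lip B] by blast
    have kdz: "bump_field u w j \<zeta> = 0" if "\<zeta> \<notin> ?K" for \<zeta> j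
      using supp[OF u, of \<zeta>] that u0 by (auto simp: bump_field_def scaled_bump_def)
    have wk: "(\<integral>z. a z * dzb j (bump_field u w j) (q z) \<partial>lborel) = 0" for j
      by (rule weak[OF C1_bump_field K sub]) (rule kdz)
    have ik: "integrable lborel (\<lambda>z. a z * dzb j (bump_field u w j) (q z))" for j
    proof (rule integrable_test[where u="dzb j (bump_field u w j)", OF _ K sub])
      show "continuous_on UNIV (dzb j (bump_field u w j))"
        unfolding dzb_def[abs_def] by (intro continuous_intros C1_on_D(2)[OF C1_bump_field]) auto
      show "dzb j (bump_field u w j) \<zeta> = 0" if "\<zeta> \<notin> ?K" for \<zeta>
        using frechet_zero_outside(1)[of ?K "bump_field u w j" \<zeta>] kdz that by (simp add: dzb_def)
    qed
    have "(\<integral>z. a z * (of_real s * ?E (q z)) \<partial>lborel) = 0" for s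
    proof -
      have "(\<integral>z. a z * (of_real s * ?E (q z)) \<partial>lborel)
        = (\<integral>z. (- of_real s * of_real (u ^ (CARD('d) - 1))) * (\<Sum>j\<in>UNIV. a z * dzb j (bump_field u w j) (q z)) \<partial>lborel)"
        by (simp add: sum_distrib_left mult_ac)
      also have "\<dots> = (- of_real s * of_real (u ^ (CARD('d) - 1))) * (\<integral>z. (\<Sum>j\<in>UNIV. a z * dzb j (bump_field u w j) (q z)) \<partial>lborel)"
        by (rule integral_mult_right_zero)
      also have "(\<integral>z. (\<Sum>j\<in>UNIV. a z * dzb j (bump_field u w j) (q z)) \<partial>lborel) = 0"
        using ik by (subst Bochner_Integration.integral_sum) (auto simp: wk)
      finally show ?thesis by simp
    qed
    then show ?thesis using D unfolding mollified_def by simp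
  qed
  obtain c where "\<forall>u\<in>?T. mollified u w = c"
    using has_derivative_zero_constant[of ?T "\<lambda>u. mollified u w"] der has_derivative_at_withinI
    by (metis convex_real_interval(3))
  moreover have "t \<in> ?T" "s \<in> ?T" using t by (auto simp: field_simps)
  ultimately show ?thesis by simp
qed

end

section \<open>Normalisation of the mollifier\<close>

lemma integral_pos_open:
  fixes g :: "'a::euclidean_space \<Rightarrow> real"
  assumes "open S" "x0 \<in> S" "continuous_on S g" "\<And>x. g x \<ge> 0" "integrable lborel g" "g x0 > 0"
  shows "(\<integral>x. g x \<partial>lborel) > 0"
proof -
  have "isCont g x0" using assms(1,2,3) continuous_on_eq_continuous_at by blast
  then obtain d where d: "d > 0" "\<And>x. dist x x0 < d \<Longrightarrow> dist (g x) (g x0) < g x0 / 2"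
    unfolding continuous_at_eps_delta using assms(6) by (metis half_gt_zero)
  have "0 < g x0 / 2 * measure lborel (ball x0 d)"
    using assms(6) d(1) content_ball_pos by simp
  also have "\<dots> = (\<integral>x. indicator (ball x0 d) x *\<^sub>R (g x0 / 2) \<partial>lborel)"
    using emeasure_bounded_finite[OF bounded_ball[of x0 d]] by simp
  also have "\<dots> \<le> (\<integral>x. g x \<partial>lborel)"
  proof (rule integral_mono[OF _ assms(5)])
    show "integrable lborel (\<lambda>x. indicator (ball x0 d) x *\<^sub>R (g x0 / 2))"
      using emeasure_bounded_finite[OF bounded_ball[of x0 d]] by (intro integrable_scaleR_left integrable_real_indicator) auto
    show "indicator (ball x0 d) x *\<^sub>R (g x0 / 2) \<le> g x" for x
      using d(2)[of x] assms(4)[of x] by (cases "x \<in> ball x0 d") (auto simp: dist_real_def dist_commute abs_if split: if_splits)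
  qed
  finally show ?thesis .
qed

lemma continuous_scaled_bump: "continuous_on S (scaled_bump t)"
  using C1_on_imp_continuous_on[OF C1_scaled_bump] continuous_on_subset by blast

lemma integrable_scaled_bump:
  assumes "t > 0"
  shows "integrable lborel (scaled_bump t :: complex^'d \<Rightarrow> complex)"
proof (rule integrable_compact_support[of "cball 0 (1 / sqrt t)"])
  fix x :: "complex^'d" assume "x \<notin> cball 0 (1 / sqrt t)"
  then have "1 < sqrt t * norm x" using assms by (simp add: field_simps)
  then have "1 \<le> (sqrt t * norm x)\<^sup>2" by simp
  then show "scaled_bump t x = 0" using assms by (intro scaled_bump_zero) (auto simp: power_mult_distrib)
qed (auto intro: continuous_scaled_bump)

lemma bump_mass_pos: "\<exists>m>0. bump_mass TYPE('d::finite) = of_real m"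
proof -
  have "integrable lborel (\<lambda>x::complex^'d. bump (1 * (norm x)\<^sup>2))"
    using integrable_Re[OF integrable_scaled_bump[of 1, where 'd='d]] unfolding scaled_bump_def[abs_def] by simp
  moreover have "continuous_on UNIV (\<lambda>x::complex^'d. bump (1 * (norm x)\<^sup>2))"
    unfolding bump_def by (intro continuous_intros)
  ultimately have "(\<integral>x. bump (1 * (norm (x::complex^'d))\<^sup>2) \<partial>lborel) > 0"
    by (intro integral_pos_open[of UNIV 0]) (auto simp: bump_pos)
  moreover have "bump_mass TYPE('d) = of_real (\<integral>x. bump (1 * (norm (x::complex^'d))\<^sup>2) \<partial>lborel)"
    unfolding bump_mass_def scaled_bump_def by simp
  ultimately show ?thesis by blast
qed

lemma bump_mass_nonzero [simp]: "bump_mass TYPE('d::finite) \<noteq> 0"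
  using bump_mass_pos[where 'd='d] by auto

text \<open>Independence of the scale for the constant density 1, which is weakly holomorphic; this
  replaces a change of variables.\<close>

lemma integral_scaled_bump:
  assumes t: "t > 0"
  shows "(\<integral>x. scaled_bump t (x::complex^'d) \<partial>lborel) = bump_mass TYPE('d)"
proof -
  interpret weakly_holo_density UNIV UNIV "\<lambda>z. z" "\<lambda>_::complex^'d. 1"
    by unfold_locales (use integral_dz_zero(2) in auto)
  \<comment> \<open>A radius admissible for both scales \<open>t\<close> and 1, since
    \<open>t * R\<^sup>2 \<ge> t * R = t + 1\<close>.\<close>
  define R where "R = 1 + 1 / t"
  have "R \<ge> 1" using t by (simp add: R_def)
  then have "R \<le> R\<^sup>2" by (simp add: power2_eq_square)
  then have "1 < R\<^sup>2" "t * R \<le> t * R\<^sup>2" using t by (auto simp: R_def)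
  moreover have "t * R = t + 1" using t by (simp add: R_def field_simps)
  ultimately have "mollified t 0 = mollified 1 0"
    using t \<open>R \<ge> 1\<close> by (intro mollified_const[of t 1 R 0]) auto
  moreover have "scaled_bump t (0 - x) = scaled_bump t x" for t and x :: "complex^'d"
    by (simp add: scaled_bump_def)
  ultimately show ?thesis unfolding mollified_def bump_mass_def by simp
qed

lemma integral_mol: "t > 0 \<Longrightarrow> (\<integral>x. mol t (x::complex^'d) \<partial>lborel) = 1"
  unfolding mol_def by (simp add: integral_scaled_bump)

lemma mol_nonneg_real:
  assumes "t > 0"
  shows "mol t x = of_real (cmod (mol t x))"
proof -
  obtain m where "m > 0" "bump_mass TYPE('a) = of_real m" using bump_mass_pos by blast
  then have "mol t x = of_real (t ^ CARD('a) * bump (t * (norm x)\<^sup>2) / m)"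
    "t ^ CARD('a) * bump (t * (norm x)\<^sup>2) / m \<ge> 0"
    using assms by (simp_all add: mol_def scaled_bump_def)
  then show ?thesis by (metis abs_of_nonneg norm_of_real)
qed

lemma continuous_mol: "continuous_on S (mol t :: complex^'d \<Rightarrow> complex)"
  unfolding mol_def[abs_def] by (intro continuous_intros continuous_scaled_bump) auto

lemma uniformly_continuous_compact_support:
  fixes u :: "'a::euclidean_space \<Rightarrow> 'b::real_normed_vector"
  assumes u: "continuous_on UNIV u" and K: "compact K" and 0: "\<And>w. w \<notin> K \<Longrightarrow> u w = 0"
  shows "uniformly_continuous_on UNIV u"
  unfolding uniformly_continuous_on_def
proof (intro allI impI)
  fix e :: real assume e: "e > 0"
  obtain M where M: "K \<subseteq> cball 0 M"
    using compact_imp_bounded[OF K] unfolding bounded_iff by (meson mem_cball_0 subsetI)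
  have "uniformly_continuous_on (cball 0 (M + 1)) u"
    using u by (intro compact_uniformly_continuous continuous_on_subset[OF u]) auto
  then obtain d where d: "d > 0" "\<And>x y. x \<in> cball 0 (M+1) \<Longrightarrow> y \<in> cball 0 (M+1) \<Longrightarrow> dist y x < d \<Longrightarrow> dist (u y) (u x) < e"
    using e unfolding uniformly_continuous_on_def by metis
  have "dist (u y) (u x) < e" if xy: "dist y x < min d 1" for x y
  proof (cases "x \<in> cball 0 (M+1) \<and> y \<in> cball 0 (M+1)")
    case False
    have "norm x \<le> norm y + dist y x" "norm y \<le> norm x + dist y x"
      using norm_triangle_ineq2[of x y] norm_triangle_ineq2[of y x]
      by (simp_all add: dist_norm norm_minus_commute)
    then have "x \<notin> cball 0 M" "y \<notin> cball 0 M" using False xy by auto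
    then have "x \<notin> K" "y \<notin> K" using M by blast+
    then have "u x = 0" "u y = 0" using 0 by blast+
    then show ?thesis using e by simp
  qed (use d xy in auto)
  then show "\<exists>d>0. \<forall>x\<in>UNIV. \<forall>x'\<in>UNIV. dist x' x < d \<longrightarrow> dist (u x') (u x) < e"
    using d(1) by (intro exI[of _ "min d 1"]) auto
qed

lemma nonpos_if_le_eps_mult:
  fixes x A :: real
  assumes "\<And>e. e > 0 \<Longrightarrow> x \<le> e * A" "A \<ge> 0"
  shows "x \<le> 0"
proof (rule field_le_epsilon)
  fix e :: real assume "e > 0"
  then have "x \<le> e / (A + 1) * A" using assms(2) by (intro assms(1)) auto
  also have "\<dots> \<le> e" using assms(2) \<open>e > 0\<close> by (simp add: field_simps)
  finally show "x \<le> 0 + e" by simp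
qed

section \<open>The trace as holomorphic density of the push-forward\<close>

context weakly_holo_density
begin

definition radius :: "complex^'d \<Rightarrow> real" where
  "radius w = (SOME R. R > 0 \<and> cball w R \<subseteq> Y)"

lemma radius: "w \<in> Y \<Longrightarrow> radius w > 0 \<and> cball w (radius w) \<subseteq> Y"
  unfolding radius_def using Y open_contains_cball by (metis (mono_tags, lifting) someI_ex)

text \<open>The scale is one that is admissible at \<open>w\<close>, since
  \<open>t * (radius w)\<^sup>2 = 2 > 1\<close>; the value does not depend on this choice.\<close>

definition trace :: "complex^'d \<Rightarrow> complex" where
  "trace w = (if w \<in> Y then mollified (2 / (radius w)\<^sup>2) w / bump_mass TYPE('d) else 0)"

text \<open>The two scales are admissible for different radii. Their maximum is admissible for both,
  and each is compared with it.\<close>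

lemma trace_eq_mollified:
  assumes "t > 0" "R > 0" "1 < t * R\<^sup>2" "cball w R \<subseteq> Y"
  shows "trace w = mollified t w / bump_mass TYPE('d)"
proof -
  have w: "w \<in> Y" using assms by (auto simp: subset_iff)
  note r = radius[OF w]
  define s where "s = max t (2 / (radius w)\<^sup>2)"
  have s0: "s > 0" using assms by (simp add: s_def)
  have "t * R\<^sup>2 \<le> s * R\<^sup>2" by (rule mult_right_mono) (auto simp: s_def)
  then have 1: "mollified t w = mollified s w"
    using assms s0 order.strict_trans2[OF assms(3)] by (intro mollified_const[of t s R]) auto
  have "2 / (radius w)\<^sup>2 * (radius w)\<^sup>2 \<le> s * (radius w)\<^sup>2"
    by (rule mult_right_mono) (auto simp: s_def)
  then have 2: "mollified (2 / (radius w)\<^sup>2) w = mollified s w"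
    using r s0 by (intro mollified_const[of _ s "radius w"]) auto
  show ?thesis using w 1 2 by (simp add: trace_def)
qed

lemma trace_eq_mol:
  assumes "t > 0" "R > 0" "1 < t * R\<^sup>2" "cball w R \<subseteq> Y"
  shows "trace w = (\<integral>z. a z * mol t (w - q z) \<partial>lborel)"
  unfolding trace_eq_mollified[OF assms] mollified_def mol_def by simp

lemma trace_holo: "holo_fun trace Y"
proof (rule holo_funI_dzb)
  have *: "trace differentiable (at w0) \<and> dzb k trace w0 = 0" if w0: "w0 \<in> Y" for w0 k
  proof -
    obtain R where R: "R > 0" "cball w0 R \<subseteq> Y" using Y w0 open_contains_cball by blast
    \<comment> \<open>\<open>t * (R/2)\<^sup>2 = 2\<close>, so this single scale computes
      \<open>trace\<close> at every point of \<open>ball w0 (R/2)\<close>.\<close>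
    define t where "t = 8 / R\<^sup>2"
    have t: "t > 0" "1 < t * (R/2)\<^sup>2" using R by (auto simp: t_def field_simps power2_eq_square)
    have sub: "cball w (R/2) \<subseteq> Y" if "w \<in> ball w0 (R/2)" for w
    proof -
      have "cball w (R/2) \<subseteq> cball w0 R"
        using that by (auto simp: dist_norm) (smt (verit) field_sum_of_halves norm_diff_triangle_le)
      then show ?thesis using R by blast
    qed
    have eq: "trace w = mollified t w * (1 / bump_mass TYPE('d))" if "w \<in> ball w0 (R/2)" for w
      using trace_eq_mollified[OF t(1) _ t(2) sub[OF that]] R by simp
    have w0b: "w0 \<in> ball w0 (R/2)" using R by simp
    have F: "mollified t differentiable (at w0)" "dzb k (mollified t) w0 = 0"
      using mollified_holo_at[OF t(1) _ t(2) sub[OF w0b]] R by auto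
    have 1: "(\<lambda>w. mollified t w * (1 / bump_mass TYPE('d))) differentiable (at w0)"
      by (rule differentiable_mult[OF F(1) differentiable_const])
    have 2: "dzb k (\<lambda>w. mollified t w * (1 / bump_mass TYPE('d))) w0 = 0"
      unfolding dz_mult(2)[OF F(1) differentiable_const] F(2) dz_const by simp
    have "trace differentiable (at w0)"
      using frechet_local_cong(1)[of "ball w0 (R/2)" w0 trace "\<lambda>w. mollified t w * (1 / bump_mass TYPE('d))", OF open_ball w0b eq] 1 by blast
    moreover have "dzb k trace w0 = 0"
      using dz_local_cong(2)[of "ball w0 (R/2)" w0 trace "\<lambda>w. mollified t w * (1 / bump_mass TYPE('d))", OF open_ball w0b eq] 2 by simp
    ultimately show ?thesis by blast
  qed
  then show "trace differentiable (at z)" if "z \<in> Y" for z using that by blast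
  show "dzb k trace z = 0" if "z \<in> Y" for z k using * that by blast
qed

text \<open>On the support of \<open>u\<close> the trace is an integral against a mollifier. Fubini
  moves the mollifier onto \<open>u\<close>, and smoothing \<open>u\<close> changes it uniformly by
  less than \<open>e\<close>. The left side of the estimate does not involve the scale, so it is at
  most \<open>e * A\<close> for all \<open>e\<close> and hence zero.\<close>

lemma trace_pairing:
  assumes u: "continuous_on UNIV u" and K: "compact K" "K \<subseteq> Y" and u0: "\<And>w. w \<notin> K \<Longrightarrow> u w = 0"
  shows "(\<integral>z. a z * u (q z) \<partial>lborel) = (\<integral>w. trace w * u w \<partial>lborel)"
proof -
  obtain R where R: "R > 0" "(\<Union>x\<in>K. cball x R) \<subseteq> Y"
    using compact_subset_open_imp_cball_epsilon_subset[OF K(1) Y K(2)] by blast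
  \<comment> \<open>The closed \<open>R\<close>-neighbourhood of \<open>K\<close>, written as the
    image of a sum so that compactness is immediate. Every \<open>q z\<close> that a kernel centred
    in \<open>K\<close> can see lies in it.\<close>
  define KR where "KR = (\<lambda>(x, y). x + y) ` (K \<times> cball 0 R)"
  have KR: "compact KR" unfolding KR_def
    by (intro compact_continuous_image compact_Times K) (auto intro!: continuous_intros simp: case_prod_beta)
  have KR_eq: "KR = (\<Union>x\<in>K. cball x R)"
    unfolding KR_def
    by (force simp: dist_norm image_iff norm_minus_commute intro: bexI[where x="(_, _ - _)"])
  have KRY: "KR \<subseteq> Y" using R KR_eq by simp
  have KKR: "K \<subseteq> KR" using R(1) by (auto simp: KR_eq)
  let ?L = "{z\<in>X. q z \<in> KR}"
  have L: "compact ?L" by (rule proper[OF KR KRY])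
  define A where "A = (\<integral>z. indicator ?L z *\<^sub>R cmod (a z) \<partial>lborel)"
  have uK: "uniformly_continuous_on UNIV u"
    by (rule uniformly_continuous_compact_support[OF u K(1) u0])
  have key: "cmod ((\<integral>w. trace w * u w \<partial>lborel) - (\<integral>z. a z * u (q z) \<partial>lborel)) \<le> e * A" if e: "e > 0" for e
  proof -
    obtain d where d: "d > 0" "\<And>x y. dist x y < d \<Longrightarrow> dist (u x) (u y) < e"
      using uK e unfolding uniformly_continuous_on_def by (metis UNIV_I)
    \<comment> \<open>A kernel of radius less than \<open>r\<close> serves two purposes: below
      \<open>R\<close> it computes \<open>trace\<close> on \<open>K\<close>, and below
      \<open>d\<close> it sees \<open>u\<close> vary by less than \<open>e\<close>.\<close>
    define r where "r = min R d"
    have r: "r > 0" "r \<le> R" "r \<le> d" using R d by (auto simp: r_def)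
    define t where "t = 2 / r\<^sup>2"
    have t: "t > 0" "1 < t * r\<^sup>2" "1 < t * R\<^sup>2"
    proof -
      show "t > 0" "1 < t * r\<^sup>2" using r by (auto simp: t_def)
      moreover have "t * r\<^sup>2 \<le> t * R\<^sup>2" using r \<open>t > 0\<close> by (intro mult_left_mono power_mono) auto
      ultimately show "1 < t * R\<^sup>2" by linarith
    qed
    have molr: "norm x < r" if "mol t x \<noteq> 0" for x :: "complex^'d"
      using scaled_bump_support[OF t(1) r(1) t(2), of x] that by (auto simp: mol_def)
    define G where "G = (\<lambda>w z. u w * a z * mol t (w - q z))"
    have G0: "G w z = 0" if "(w, z) \<notin> K \<times> ?L" for w z
    proof (rule ccontr)
      assume "G w z \<noteq> 0"
      then have "u w \<noteq> 0" "a z \<noteq> 0" "mol t (w - q z) \<noteq> 0" by (auto simp: G_def)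
      then have "w \<in> K" "z \<in> X" "norm (w - q z) < r" using u0 a_zero molr by auto
      moreover from this have "q z \<in> KR" using r by (auto simp: KR_eq dist_norm intro!: bexI[of _ w])
      ultimately show False using that by auto
    qed
    have "integrable lborel (\<lambda>p. G (fst p) (snd p))"
    proof (rule integrable_compact_support[of "K \<times> ?L"])
      show "compact (K \<times> ?L)" by (rule compact_Times[OF K(1) L])
      show "continuous_on (K \<times> ?L) (\<lambda>p. G (fst p) (snd p))"
        unfolding G_def
        by (intro continuous_intros continuous_on_compose2[OF u] continuous_on_compose2[OF a_cont]
            continuous_on_compose2[OF continuous_mol[of UNIV]] continuous_on_compose2[OF q_cont]) auto
      show "G (fst p) (snd p) = 0" if "p \<notin> K \<times> ?L" for p
        using G0[of "fst p" "snd p"] that by simp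
    qed
    then have Gint: "integrable (lborel \<Otimes>\<^sub>M lborel) (\<lambda>(w, z). G w z)"
      by (simp add: lborel_prod case_prod_unfold)
    have 1: "trace w * u w = (\<integral>z. G w z \<partial>lborel)" for w
    proof (cases "w \<in> K")
      case True
      then have "cball w R \<subseteq> Y" using R by auto
      from trace_eq_mol[OF t(1) R(1) t(3) this]
      have "trace w * u w = u w * (\<integral>z. a z * mol t (w - q z) \<partial>lborel)" by simp
      also have "\<dots> = (\<integral>z. G w z \<partial>lborel)"
        unfolding G_def mult.assoc by (rule integral_mult_right_zero[symmetric])
      finally show ?thesis .
    qed (use u0 in \<open>simp add: G_def\<close>)
    have 2: "(\<integral>w. trace w * u w \<partial>lborel) = (\<integral>z. (\<integral>w. G w z \<partial>lborel) \<partial>lborel)"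
      unfolding 1 using lborel_pair.Fubini_integral[OF Gint] by simp
    have Gi2: "integrable lborel (\<lambda>z. \<integral>w. G w z \<partial>lborel)"
      using lborel_pair.integrable_snd[OF Gint] by simp
    have ai: "integrable lborel (\<lambda>z. a z * u (q z))" by (rule integrable_test[OF u K u0])
    have bnd: "cmod ((\<integral>w. G w z \<partial>lborel) - a z * u (q z)) \<le> e * (indicator ?L z *\<^sub>R cmod (a z))" for z
    proof (cases "z \<in> ?L")
      case False
      then have "G w z = 0" for w using G0[of w z] by auto
      moreover have "a z * u (q z) = 0" using False a_zero[of z] u0[of "q z"] KKR by auto
      ultimately show ?thesis using e by (simp only:) simp
    next
      case True
      have mi: "integrable lborel (\<lambda>w. mol t (w - q z))" "(\<integral>w. mol t (w - q z) \<partial>lborel) = 1"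
        "integrable lborel (\<lambda>w. cmod (mol t (w - q z)))" "(\<integral>w. cmod (mol t (w - q z)) \<partial>lborel) = 1"
      proof -
        have mi0: "integrable lborel (mol t :: complex^'d \<Rightarrow> complex)"
          unfolding mol_def[abs_def] by (intro integrable_divide_zero integrable_scaled_bump t)
        show i1: "integrable lborel (\<lambda>w. mol t (w - q z))" by (rule lborel_translate(1)[OF mi0])
        show i2: "(\<integral>w. mol t (w - q z) \<partial>lborel) = 1"
          using lborel_translate(2)[OF mi0] integral_mol[OF t(1)] by simp
        show i3: "integrable lborel (\<lambda>w. cmod (mol t (w - q z)))" using i1 by simp
        have "complex_of_real (\<integral>w. cmod (mol t (w - q z)) \<partial>lborel) = (\<integral>w. of_real (cmod (mol t (w - q z))) \<partial>lborel)"
          by simp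
        also have "\<dots> = 1" unfolding mol_nonneg_real[OF t(1), symmetric] by (rule i2)
        finally show "(\<integral>w. cmod (mol t (w - q z)) \<partial>lborel) = 1" by (metis of_real_eq_1_iff)
      qed
      have ui: "integrable lborel (\<lambda>w. u w * mol t (w - q z))"
        by (rule integrable_compact_support[OF K(1)])
          (use u0 in \<open>auto intro!: continuous_intros continuous_on_subset[OF u] continuous_on_compose2[OF continuous_mol[of UNIV]]\<close>)
      have "(\<integral>w. G w z \<partial>lborel) - a z * u (q z) = a z * ((\<integral>w. u w * mol t (w - q z) \<partial>lborel) - u (q z) * (\<integral>w. mol t (w - q z) \<partial>lborel))"
        unfolding G_def mi(2) by (simp add: mult_ac right_diff_distrib flip: integral_mult_right_zero)
      also have "(\<integral>w. u w * mol t (w - q z) \<partial>lborel) - u (q z) * (\<integral>w. mol t (w - q z) \<partial>lborel)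
         = (\<integral>w. (u w - u (q z)) * mol t (w - q z) \<partial>lborel)"
        using ui mi(1) by (simp add: left_diff_distrib)
      also have "cmod (a z * \<dots>) = cmod (a z) * cmod (\<integral>w. (u w - u (q z)) * mol t (w - q z) \<partial>lborel)"
        by (rule norm_mult)
      also have "\<dots> \<le> cmod (a z) * (\<integral>w. e * cmod (mol t (w - q z)) \<partial>lborel)"
      proof (rule mult_left_mono[OF Bochner_Integration.integral_norm_bound_integral])
        fix w
        show "cmod ((u w - u (q z)) * mol t (w - q z)) \<le> e * cmod (mol t (w - q z))"
        proof (cases "mol t (w - q z) = 0")
          case False
          then have "dist w (q z) < d" using molr[of "w - q z"] r by (simp add: dist_norm)
          then show ?thesis using d(2)[of w "q z"] unfolding norm_mult by (intro mult_right_mono) (auto simp: dist_norm)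
        qed simp
      qed (use ui mi in \<open>auto simp: left_diff_distrib\<close>)
      also have "\<dots> = cmod (a z) * e" using mi(4) by simp
      finally show ?thesis using True by (simp add: mult.commute)
    qed
    have "cmod ((\<integral>z. (\<integral>w. G w z \<partial>lborel) \<partial>lborel) - (\<integral>z. a z * u (q z) \<partial>lborel))
       = cmod (\<integral>z. (\<integral>w. G w z \<partial>lborel) - a z * u (q z) \<partial>lborel)"
      using Gi2 ai by simp
    also have "\<dots> \<le> (\<integral>z. e * (indicator ?L z *\<^sub>R cmod (a z)) \<partial>lborel)"
      using Gi2 ai bnd integrable_norm_part[OF KR KRY]
      by (intro Bochner_Integration.integral_norm_bound_integral) auto
    also have "\<dots> = e * A" unfolding A_def by simp
    finally show ?thesis unfolding 2 .
  qed
  moreover have "A \<ge> 0" unfolding A_def by (intro integral_nonneg_AE) auto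
  ultimately have "cmod ((\<integral>w. trace w * u w \<partial>lborel) - (\<integral>z. a z * u (q z) \<partial>lborel)) \<le> 0"
    by (rule nonpos_if_le_eps_mult)
  then show ?thesis by simp
qed

end

subsection \<open>Regularity of holomorphic functions\<close>

lemma norm_vec_cmult: "norm (c *s v) = cmod c * norm (v :: complex^'d)"
  by (simp add: norm_vec_def L2_set_right_distrib norm_mult)

text \<open>\<open>holo_fun\<close> asks only for a derivative at each point. Uniform continuity
  makes \<open>f (w + u *s v) - f (w0 + u *s v)\<close> small on a disc of values \<open>u\<close>,
  and the Cauchy inequality passes this on to the derivatives at the centre.\<close>

lemma holo_fun_C1:
  assumes S: "open S" and f: "holo_fun f S"
  shows "C1_on f S"
proof (rule C1_onI[OF holo_fun_D(1)[OF f]])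
  fix v
  have cf: "continuous_on S f" by (rule holo_fun_continuous_on[OF f])
  show "continuous_on S (\<lambda>z. frechet_derivative f (at z) v)"
    unfolding continuous_on_eq_continuous_at[OF S] continuous_at_eps_delta
  proof (intro ballI allI impI)
    fix w0 e assume w0: "w0 \<in> S" and e: "(e::real) > 0"
    obtain R0 where R0: "R0 > 0" "cball w0 R0 \<subseteq> S" using S w0 open_contains_cball by blast
    define R where "R = R0 / 2"
    have R: "R > 0" "cball w0 (2 * R) \<subseteq> S" using R0 by (auto simp: R_def)
    \<comment> \<open>Then \<open>cmod u \<le> r\<close> moves a point along \<open>v\<close> by at
      most \<open>R\<close>. The oscillation \<open>e * r / 2\<close> chosen below becomes
      \<open>e / 2\<close> after division by \<open>r\<close>.\<close>
    define r where "r = R / (norm v + 1)"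
    have nv: "norm v + 1 > 0" by (simp add: add_nonneg_pos)
    have r: "r > 0" using R nv by (simp add: r_def)
    have rv: "cmod u * norm v \<le> R" if "cmod u \<le> r" for u
    proof -
      have "cmod u * norm v \<le> r * norm v" using that by (intro mult_right_mono) auto
      also have "\<dots> \<le> r * (norm v + 1)" using r by simp
      finally show ?thesis using nv by (simp add: r_def)
    qed
    have inS: "w + u *s v \<in> cball w0 (2 * R)" if "w \<in> cball w0 R" "cmod u \<le> r" for w u
    proof -
      have "w0 - (w + u *s v) = (w0 - w) + - (u *s v)" by simp
      then have "norm (w0 - (w + u *s v)) \<le> norm (w0 - w) + norm (u *s v)"
        using norm_triangle_ineq[of "w0 - w" "- (u *s v)"] by (simp only: norm_minus_cancel)
      then show ?thesis using that rv[OF that(2)] by (simp add: dist_norm norm_vec_cmult)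
    qed
    have "uniformly_continuous_on (cball w0 (2 * R)) f"
      by (intro compact_uniformly_continuous continuous_on_subset[OF cf] R) auto
    then obtain d where d: "d > 0" "\<And>x y. x \<in> cball w0 (2 * R) \<Longrightarrow> y \<in> cball w0 (2 * R) \<Longrightarrow> dist y x < d \<Longrightarrow> dist (f y) (f x) < e * r / 2"
      using e r unfolding uniformly_continuous_on_def by (metis half_gt_zero mult_pos_pos)
    show "\<exists>d>0. \<forall>w. dist w w0 < d \<longrightarrow>
        dist (frechet_derivative f (at w) v) (frechet_derivative f (at w0) v) < e"
    proof (intro exI[of _ "min d R"] conjI allI impI)
      fix w assume w: "dist w w0 < min d R"
      let ?h = "\<lambda>u. f (w + u *s v) - f (w0 + u *s v)"
      have wb: "w \<in> cball w0 R" "w0 \<in> cball w0 R" using w R by (auto simp: dist_commute)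
      have inS': "w + u *s v \<in> S" "w0 + u *s v \<in> S" if "cmod u \<le> r" for u
        using inS[OF wb(1) that] inS[OF wb(2) that] R by blast+
      have hol: "?h holomorphic_on cball 0 r"
        using inS' by (intro holomorphic_on_diff holomorphic_on_subset[OF holo_fun_line(1)[OF f]]) auto
      have "norm ((deriv ^^ 1) ?h 0) \<le> fact 1 * (e * r / 2) / r ^ 1"
      proof (rule Cauchy_inequality)
        show "?h holomorphic_on ball 0 r" using hol holomorphic_on_subset ball_subset_cball by blast
        show "continuous_on (cball 0 r) ?h" using hol holomorphic_on_imp_continuous_on by blast
        show "norm (?h u) \<le> e * r / 2" if "norm (0 - u) = r" for u
        proof -
          have "cmod u \<le> r" using that by simp
          from d(2)[OF inS[OF wb(2) this] inS[OF wb(1) this]] w show ?thesis by (simp add: dist_norm)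
        qed
      qed (rule r)
      moreover have "deriv ?h 0 = frechet_derivative f (at w) v - frechet_derivative f (at w0) v"
      proof -
        have "(?h has_field_derivative frechet_derivative f (at (w + 0 *s v)) v - frechet_derivative f (at (w0 + 0 *s v)) v) (at 0)"
          by (intro DERIV_diff holo_fun_line(2)[OF f] inS') (use r in auto)
        then show ?thesis by (simp add: DERIV_imp_deriv)
      qed
      ultimately show "dist (frechet_derivative f (at w) v) (frechet_derivative f (at w0) v) < e"
        using r e by (simp add: dist_norm)
    qed (use d R in auto)
  qed
qed

text \<open>Only continuity is asked for: a density is determined by its pairings, whereas weak
  holomorphy is tested with \<open>C1_on\<close> functions.\<close>

definition test_fun :: "(complex^'d \<Rightarrow> complex) \<Rightarrow> (complex^'d) set \<Rightarrow> bool" where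
  "test_fun u Y \<longleftrightarrow> continuous_on UNIV u \<and> (\<exists>K. compact K \<and> K \<subseteq> Y \<and> (\<forall>w. w \<notin> K \<longrightarrow> u w = 0))"

definition bump_at :: "complex^'d \<Rightarrow> real \<Rightarrow> complex^'d \<Rightarrow> real" where
  "bump_at w0 R w = bump ((1 / R\<^sup>2) * (norm (w0 - w))\<^sup>2)"

lemma bump_at:
  assumes "R > 0"
  shows "continuous_on S (bump_at w0 R)" "bump_at w0 R w \<ge> 0" "bump_at w0 R w0 > 0"
    "w \<notin> cball w0 R \<Longrightarrow> bump_at w0 R w = 0"
    "C1_on (\<lambda>w. of_real (bump_at w0 R w)) UNIV"
proof -
  show "continuous_on S (bump_at w0 R)"
    unfolding bump_at_def[abs_def] bump_def by (intro continuous_intros)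
  show "bump_at w0 R w \<ge> 0" "bump_at w0 R w0 > 0" by (auto simp: bump_at_def bump_pos)
  show "bump_at w0 R w = 0" if "w \<notin> cball w0 R"
    unfolding bump_at_def using that assms
    by (intro bump_zero) (auto simp: dist_norm intro!: power_mono)
  show "C1_on (\<lambda>w. of_real (bump_at w0 R w)) UNIV"
    unfolding bump_at_def by (rule C1_bump_shift)
qed

lemma test_fun_bump:
  assumes "R > 0" "cball w0 R \<subseteq> Y"
  shows "test_fun (\<lambda>w. c * of_real (bump_at w0 R w)) Y"
  unfolding test_fun_def
proof (intro conjI exI[of _ "cball w0 R"])
  show "continuous_on UNIV (\<lambda>w. c * complex_of_real (bump_at w0 R w))"
    by (intro continuous_intros bump_at(1) assms)
qed (use bump_at(4)[OF assms(1)] assms in auto)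

lemma integrable_test_mult:
  assumes "continuous_on Y f" "test_fun u Y"
  shows "integrable lborel (\<lambda>w. f w * u w)"
proof -
  obtain K where K: "continuous_on UNIV u" "compact K" "K \<subseteq> Y" "\<forall>w. w \<notin> K \<longrightarrow> u w = 0"
    using assms(2) unfolding test_fun_def by blast
  show ?thesis
    by (rule integrable_compact_support[OF K(2)])
      (use K in \<open>auto intro!: continuous_on_mult intro: continuous_on_subset[OF assms(1)] continuous_on_subset[OF K(1)]\<close>)
qed

text \<open>Testing with a bump at \<open>w0\<close> times the conjugate of
  \<open>f w0 - g w0\<close> makes the real part of the integrand nonnegative, and positive at
  \<open>w0\<close>.\<close>

lemma test_fun_eqI:
  assumes Y: "open Y" and f: "continuous_on Y f" and g: "continuous_on Y g"
    and eq: "\<And>u. test_fun u Y \<Longrightarrow> (\<integral>w. f w * u w \<partial>lborel) = (\<integral>w. g w * u w \<partial>lborel)"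
    and w0: "w0 \<in> Y"
  shows "f w0 = g w0"
proof (rule ccontr)
  assume ne: "f w0 \<noteq> g w0"
  define h where "h = (\<lambda>w. Re ((f w - g w) * cnj (f w0 - g w0)))"
  have h: "continuous_on Y h" unfolding h_def by (intro continuous_intros f g)
  have "h w0 = (cmod (f w0 - g w0))\<^sup>2" unfolding h_def by (simp only: complex_norm_square[symmetric] Re_complex_of_real)
  then have h0: "h w0 > 0" using ne by simp
  have "open (Y \<inter> h -` {0<..})" using continuous_open_preimage[OF h Y open_greaterThan] .
  then obtain R where R: "R > 0" "cball w0 R \<subseteq> Y \<inter> h -` {0<..}"
    using open_contains_cball[of "Y \<inter> h -` {0<..}"] w0 h0
    by (metis IntI greaterThan_iff vimageI)
  let ?u = "\<lambda>w. cnj (f w0 - g w0) * of_real (bump_at w0 R w)"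
  have u: "test_fun ?u Y" using test_fun_bump[OF R(1)] R(2) by blast
  have int: "integrable lborel (\<lambda>w. f w * ?u w - g w * ?u w)"
    using integrable_test_mult[OF f u] integrable_test_mult[OF g u] by simp
  have "(\<integral>w. f w * ?u w - g w * ?u w \<partial>lborel) = 0"
    using eq[OF u] integrable_test_mult[OF f u] integrable_test_mult[OF g u] by simp
  moreover have Re: "Re (f w * ?u w - g w * ?u w) = h w * bump_at w0 R w" for w
    unfolding h_def by (simp add: algebra_simps)
  ultimately have "(\<integral>w. h w * bump_at w0 R w \<partial>lborel) = 0"
    using integral_Re[OF int] by simp
  moreover have "(\<integral>w. h w * bump_at w0 R w \<partial>lborel) > 0"
  proof (rule integral_pos_open[OF Y w0])
    show "continuous_on Y (\<lambda>w. h w * bump_at w0 R w)" by (intro continuous_intros h bump_at R)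
    show "0 \<le> h w * bump_at w0 R w" for w
      using R(2) bump_at(2)[OF R(1), of w0 w] bump_at(4)[OF R(1), of w w0] by (cases "w \<in> cball w0 R") (auto simp: subset_iff less_imp_le)
    show "integrable lborel (\<lambda>w. h w * bump_at w0 R w)"
      using integrable_Re[OF int] Re by simp
    show "0 < h w0 * bump_at w0 R w0" using h0 bump_at(3)[OF R(1), of w0] by simp
  qed
  ultimately show False by simp
qed

text \<open>Integration by parts: \<open>dzb j\<close> of \<open>f * \<psi>\<close> is
  \<open>f * dzb j \<psi>\<close>. The product has to be \<open>C1_on\<close>, which is where
  continuity of the derivatives of \<open>f\<close> enters.\<close>

lemma holo_weakly_holo:
  assumes S: "open S" and f: "holo_fun f S" and f0: "\<And>z. z \<notin> S \<Longrightarrow> f z = 0"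
    and psi: "C1_on \<psi> UNIV" "compact K" "K \<subseteq> S" "\<And>w. w \<notin> K \<Longrightarrow> \<psi> w = 0"
  shows "(\<integral>z. f z * dzb j \<psi> z \<partial>lborel) = 0"
proof -
  have "C1_on (\<lambda>z. f z * \<psi> z) S"
    by (intro C1_on_mult holo_fun_C1 S f C1_on_subset[OF psi(1)]) auto
  then have C: "C1_on (\<lambda>z. f z * \<psi> z) UNIV"
    by (rule C1_on_extend[OF S _ compact_imp_closed[OF psi(2)] psi(3)]) (simp add: psi(4))
  have "dzb j (\<lambda>z. f z * \<psi> z) z = f z * dzb j \<psi> z" for z
  proof (cases "z \<in> S")
    case True
    have "\<psi> differentiable at z" using psi(1) by (simp add: C1_on_def)
    then show ?thesis
      using dz_mult(2)[OF holo_fun_differentiable[OF f True]] holo_fun_dzb[OF f True] by simp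
  next
    case False
    then have "z \<notin> K" using psi by auto
    from frechet_zero_outside(1)[of K "\<lambda>z. f z * \<psi> z", OF compact_imp_closed[OF psi(2)] _ this]
    show ?thesis using f0[OF False] psi(4) by (simp add: dzb_def)
  qed
  then show ?thesis
    using integral_dz_zero(2)[OF C psi(2), of j] psi(4) by simp
qed

text \<open>Weyl's lemma. For the identity map the trace has the same pairings as \<open>f\<close>,
  so it equals \<open>f\<close>; holomorphy and the mean value formula are inherited from
  it.\<close>

lemma weakly_holo_density_id:
  assumes S: "open S" and f: "continuous_on S f" and f0: "\<And>z. z \<notin> S \<Longrightarrow> f z = 0"
    and weak: "\<And>\<psi> j K. C1_on \<psi> UNIV \<Longrightarrow> compact K \<Longrightarrow> K \<subseteq> S \<Longrightarrow> (\<And>w. w \<notin> K \<Longrightarrow> \<psi> w = 0)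
       \<Longrightarrow> (\<integral>z. f z * dzb j \<psi> z \<partial>lborel) = 0"
  shows "holo_fun f S"
    and "t > 0 \<Longrightarrow> R > 0 \<Longrightarrow> 1 < t * R\<^sup>2 \<Longrightarrow> cball w R \<subseteq> S \<Longrightarrow> f w = (\<integral>z. f z * mol t (w - z) \<partial>lborel)"
proof -
  have P: "{z \<in> S. z \<in> K} = K" if "K \<subseteq> S" for K using that by auto
  interpret weakly_holo_density S S "\<lambda>z. z" f
    by unfold_locales (use S f f0 weak P in auto)
  have eq: "f w = trace w" if "w \<in> S" for w
  proof (rule test_fun_eqI[OF S f holo_fun_continuous_on[OF trace_holo] _ that])
    fix u assume "test_fun u S"
    then show "(\<integral>w. f w * u w \<partial>lborel) = (\<integral>w. trace w * u w \<partial>lborel)"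
      unfolding test_fun_def using trace_pairing by blast
  qed
  show "holo_fun f S" using holo_fun_cong[OF S _ trace_holo] eq by simp
  assume t: "t > 0" "R > 0" "1 < t * R\<^sup>2" and sub: "cball w R \<subseteq> S"
  have "w \<in> S" using sub t by (auto simp: subset_iff)
  then show "f w = (\<integral>z. f z * mol t (w - z) \<partial>lborel)"
    using eq trace_eq_mol[OF t sub] by simp
qed

text \<open>Writes a point value as an integral against a square integrable kernel, the source of
  the bounded point evaluations on the Bergman space.\<close>

lemma holo_mean_value:
  assumes "open S" "holo_fun f S" "\<And>z. z \<notin> S \<Longrightarrow> f z = 0"
    and "t > 0" "R > 0" "1 < t * R\<^sup>2" "cball w R \<subseteq> S"
  shows "f w = (\<integral>z. f z * mol t (w - z) \<partial>lborel)"
proof (rule weakly_holo_density_id(2)[OF assms(1) holo_fun_continuous_on[OF assms(2)] assms(3) _ assms(4-7)])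
  show "(\<integral>z. f z * dzb j \<psi> z \<partial>lborel) = 0"
    if "C1_on \<psi> UNIV" "compact K" "K \<subseteq> S" "\<And>w. w \<notin> K \<Longrightarrow> \<psi> w = 0" for \<psi> j K
    using holo_weakly_holo[OF assms(1-3) that] .
qed

text \<open>Weak holomorphy is an integral condition and survives uniform limits; Weyl's lemma then
  returns to the pointwise notion.\<close>

lemma holo_uniform_limit:
  assumes S: "open S" and f: "\<And>n. holo_fun (f n) S" and lim: "uniform_limit S f g sequentially"
  shows "holo_fun g S"
proof -
  \<comment> \<open>The sequence and its limit are set to zero off \<open>S\<close>, because the
    weak formulation integrates over the whole space.\<close>
  define f' where "f' n z = (if z \<in> S then f n z else 0)" for n z
  define g' where "g' z = (if z \<in> S then g z else 0)" for z
  have f': "holo_fun (f' n) S" for n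
    by (rule holo_fun_cong[OF S _ f[of n]]) (simp add: f'_def)
  have cg: "continuous_on S g'"
  proof -
    have "continuous_on S g"
      by (rule uniform_limit_theorem[OF always_eventually lim]) (auto intro: holo_fun_continuous_on f)
    then show ?thesis by (simp add: g'_def cong: continuous_on_cong)
  qed
  have "holo_fun g' S"
  proof (rule weakly_holo_density_id(1)[OF S cg])
    fix \<psi> :: "complex^'a \<Rightarrow> complex" and j K 
    assume psi: "C1_on \<psi> UNIV" "compact K" "K \<subseteq> S" "\<And>w. w \<notin> K \<Longrightarrow> \<psi> w = 0"
    have "continuous_on UNIV (dzb j \<psi>)"
      unfolding dzb_def[abs_def] by (intro continuous_intros C1_on_D(2)[OF psi(1)]) auto
    moreover have "dzb j \<psi> z = 0" if "z \<notin> K" for z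
      using frechet_zero_outside(1)[of K \<psi> z] psi that by (simp add: dzb_def compact_imp_closed)
    ultimately have T: "test_fun (dzb j \<psi>) S"
      unfolding test_fun_def using psi by blast
    define A where "A = (\<integral>z. cmod (dzb j \<psi> z) \<partial>lborel)"
    have iT: "integrable lborel (dzb j \<psi>)"
      using integrable_test_mult[OF continuous_on_const[of S 1] T] by simp
    have "cmod (\<integral>z. g' z * dzb j \<psi> z \<partial>lborel) \<le> e * A" if e: "e > 0" for e
    proof -
      obtain n where n: "\<And>z. z \<in> S \<Longrightarrow> dist (f n z) (g z) < e"
        using uniform_limitD[OF lim e] unfolding eventually_sequentially by blast
      have i: "integrable lborel (\<lambda>z. g' z * dzb j \<psi> z)" "integrable lborel (\<lambda>z. f' n z * dzb j \<psi> z)"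
        by (rule integrable_test_mult[OF _ T], fact cg)
          (rule integrable_test_mult[OF holo_fun_continuous_on[OF f'] T])
      have "(\<integral>z. f' n z * dzb j \<psi> z \<partial>lborel) = 0"
        by (rule holo_weakly_holo[OF S f' _ psi]) (simp add: f'_def)
      then have "(\<integral>z. g' z * dzb j \<psi> z \<partial>lborel) = (\<integral>z. g' z * dzb j \<psi> z - f' n z * dzb j \<psi> z \<partial>lborel)"
        using i by simp
      also have "cmod \<dots> \<le> (\<integral>z. e * cmod (dzb j \<psi> z) \<partial>lborel)"
      proof (rule Bochner_Integration.integral_norm_bound_integral)
        show "cmod (g' z * dzb j \<psi> z - f' n z * dzb j \<psi> z) \<le> e * cmod (dzb j \<psi> z)" for z
          using n[of z] e unfolding left_diff_distrib[symmetric] norm_mult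
          by (intro mult_right_mono) (auto simp: g'_def f'_def dist_norm norm_minus_commute)
      qed (use i iT in auto)
      finally show ?thesis unfolding A_def by simp
    qed
    moreover have "A \<ge> 0" unfolding A_def by simp
    ultimately have "cmod (\<integral>z. g' z * dzb j \<psi> z \<partial>lborel) \<le> 0"
      using nonpos_if_le_eps_mult by blast
    then show "(\<integral>z. g' z * dzb j \<psi> z \<partial>lborel) = 0" by simp
  qed (simp add: g'_def)
  then show ?thesis using holo_fun_cong[OF S, of g' g] by (simp add: g'_def)
qed

section \<open>Derivatives of holomorphic functions: holomorphy and symmetry\<close>

lemma norm_axis1: "norm (axis k (1::complex)) = 1"
  by (rule norm_Basis) (simp add: axis_in_Basis_iff)

lemma holo_fun_shift:
  assumes "holo_fun f T" "(\<lambda>w. w + c) ` S \<subseteq> T"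
  shows "holo_fun (\<lambda>w. f (w + c)) S"
  by (rule holo_fun_compose[OF assms(1) _ assms(2)])
    (auto simp: holo_map_def intro!: holo_fun_add)

text \<open>The derivative is uniformly continuous on the larger closed ball, so the mean value
  inequality is uniform in \<open>w\<close>. Holomorphy of \<open>dz k f\<close> and the symmetry of
  mixed derivatives both work with these quotients, hence the joint statement.\<close>

lemma diff_quotient_uniform_limit:
  assumes S: "open S" and f: "holo_fun f S" and r: "r > 0" "cball w0 (2 * r) \<subseteq> S"
    and s: "\<And>n. s n > 0" "\<And>n. s n \<le> r" and s_lim: "s \<longlonglongrightarrow> 0"
  shows "uniform_limit (ball w0 r) (\<lambda>n w. (f (w + s n *\<^sub>R axis k 1) - f w) * of_real (1 / s n)) (dz k f) sequentially"
    and "\<And>n. holo_fun (\<lambda>w. (f (w + s n *\<^sub>R axis k 1) - f w) * of_real (1 / s n)) (ball w0 r)"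
    and "\<And>w n. w \<in> ball w0 r \<Longrightarrow> w + s n *\<^sub>R axis k 1 \<in> S"
    and "ball w0 r \<subseteq> S"
proof -
  let ?e = "axis k 1 :: complex^'a"
  let ?D = "\<lambda>w. frechet_derivative f (at w) ?e"
  have C1: "C1_on f S" by (rule holo_fun_C1[OF S f])
  have near: "w + \<sigma> *\<^sub>R ?e \<in> cball w0 (2 * r)" if "w \<in> ball w0 r" "0 \<le> \<sigma>" "\<sigma> \<le> r" for w \<sigma>
  proof -
    have "norm (w0 - (w + \<sigma> *\<^sub>R ?e)) \<le> norm (w0 - w) + norm (\<sigma> *\<^sub>R ?e)"
      using norm_triangle_ineq4[of "w0 - w" "\<sigma> *\<^sub>R ?e"] by (simp add: algebra_simps)
    then show ?thesis using that by (simp add: dist_norm norm_axis1)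
  qed
  show sub: "ball w0 r \<subseteq> S" using r by (intro subset_trans[OF _ r(2)]) auto
  show inS: "\<And>w n. w \<in> ball w0 r \<Longrightarrow> w + s n *\<^sub>R ?e \<in> S"
    using near r s by (meson less_imp_le subsetD)
  define g where "g n w = (f (w + s n *\<^sub>R ?e) - f w) * of_real (1 / s n)" for n w
  show "\<And>n. holo_fun (\<lambda>w. (f (w + s n *\<^sub>R ?e) - f w) * of_real (1 / s n)) (ball w0 r)"
    using inS by (intro holo_fun_mult holo_fun_diff holo_fun_const holo_fun_shift[OF f] holo_fun_subset[OF f sub]) auto
  have "uniform_limit (ball w0 r) g ?D sequentially"
  proof (rule uniform_limitI)
  fix e :: real assume e: "e > 0"
  have "uniformly_continuous_on (cball w0 (2 * r)) ?D"
    by (intro compact_uniformly_continuous continuous_on_subset[OF C1_on_D(2)[OF C1]] r) auto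
  then obtain d where d: "d > 0" "\<And>x y. x \<in> cball w0 (2 * r) \<Longrightarrow> y \<in> cball w0 (2 * r) \<Longrightarrow> dist y x < d \<Longrightarrow> dist (?D y) (?D x) < e/2"
    using e unfolding uniformly_continuous_on_def by (metis half_gt_zero)
  have "\<forall>\<^sub>F n in sequentially. s n < d"
    using order_tendstoD(2)[OF s_lim d(1)] .
  then show "\<forall>\<^sub>F n in sequentially. \<forall>w\<in>ball w0 r. dist (g n w) (?D w) < e"
  proof eventually_elim
    case (elim n)
    show ?case
    proof
      fix w assume w: "w \<in> ball w0 r"
      \<comment> \<open>Subtracting the linear part leaves a path whose derivative is a difference
        of two values of \<open>?D\<close>, hence at most \<open>e/2\<close>.\<close>
      let ?\<phi> = "\<lambda>\<sigma>. f (w + \<sigma> *\<^sub>R ?e) - \<sigma> *\<^sub>R ?D w"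
      have "norm (?\<phi> (s n) - ?\<phi> 0) \<le> (e/2) * norm (s n - 0)"
      proof (rule differentiable_bound[of "{0..s n}" _ "\<lambda>\<sigma> h. h *\<^sub>R (?D (w + \<sigma> *\<^sub>R ?e) - ?D w)"])
        fix \<sigma> assume \<sigma>: "\<sigma> \<in> {0..s n}"
        have in1: "w + \<sigma> *\<^sub>R ?e \<in> cball w0 (2 * r)" using near[OF w, of \<sigma>] \<sigma> s[of n] by auto
        have in2: "w \<in> cball w0 (2 * r)" using near[OF w, of 0] r by simp
        have "((\<lambda>\<sigma>. w + \<sigma> *\<^sub>R ?e) has_derivative (\<lambda>h. h *\<^sub>R ?e)) (at \<sigma>)"
          by (auto intro!: derivative_eq_intros)
        from has_derivative_compose[OF this C1_on_D(1)[OF C1]]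
        have "((\<lambda>\<sigma>. f (w + \<sigma> *\<^sub>R ?e)) has_derivative (\<lambda>h. frechet_derivative f (at (w + \<sigma> *\<^sub>R ?e)) (h *\<^sub>R ?e))) (at \<sigma>)"
          using in1 r by blast
        moreover have "linear (frechet_derivative f (at (w + \<sigma> *\<^sub>R ?e)))"
          using C1_on_D(1)[OF C1] in1 r has_derivative_linear by blast
        ultimately have "((\<lambda>\<sigma>. f (w + \<sigma> *\<^sub>R ?e)) has_derivative (\<lambda>h. h *\<^sub>R ?D (w + \<sigma> *\<^sub>R ?e))) (at \<sigma>)"
          by (simp add: linear_cmul)
        then have "(?\<phi> has_derivative (\<lambda>h. h *\<^sub>R ?D (w + \<sigma> *\<^sub>R ?e) - h *\<^sub>R ?D w)) (at \<sigma>)"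
          by (intro has_derivative_diff has_derivative_scaleR_left has_derivative_ident)
        then show "(?\<phi> has_derivative (\<lambda>h. h *\<^sub>R (?D (w + \<sigma> *\<^sub>R ?e) - ?D w))) (at \<sigma> within {0..s n})"
          unfolding scaleR_diff_right by (rule has_derivative_at_withinI)
        have "dist (w + \<sigma> *\<^sub>R ?e) w < d" using \<sigma> elim by (simp add: dist_norm norm_axis1)
        from d(2)[OF in2 in1 this] have b: "norm (?D (w + \<sigma> *\<^sub>R ?e) - ?D w) \<le> e/2" by (simp add: dist_norm)
        show "onorm (\<lambda>h. h *\<^sub>R (?D (w + \<sigma> *\<^sub>R ?e) - ?D w)) \<le> e/2"
        proof (rule onorm_le)
          show "norm (h *\<^sub>R (?D (w + \<sigma> *\<^sub>R ?e) - ?D w)) \<le> e/2 * norm h" for h :: real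
            using mult_left_mono[OF b, of "\<bar>h\<bar>"] by (simp add: mult.commute)
        qed
      qed (use s[of n] in auto)
      then have b: "cmod (f (w + s n *\<^sub>R ?e) - f w - s n *\<^sub>R ?D w) \<le> (e/2) * s n"
        using s(1)[of n] by (simp add: algebra_simps)
      have "g n w - ?D w = (f (w + s n *\<^sub>R ?e) - f w - s n *\<^sub>R ?D w) / of_real (s n)"
        using s(1)[of n] by (simp add: g_def diff_divide_distrib scaleR_conv_of_real)
      then have "cmod (g n w - ?D w) = cmod (f (w + s n *\<^sub>R ?e) - f w - s n *\<^sub>R ?D w) / s n"
        using s(1)[of n] by (simp add: norm_divide)
      also have "\<dots> \<le> e / 2" using b s(1)[of n] by (simp add: field_simps)
      finally show "dist (g n w) (?D w) < e" using e by (simp add: dist_norm)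
    qed
  qed
  qed
  then show "uniform_limit (ball w0 r) (\<lambda>n w. (f (w + s n *\<^sub>R axis k 1) - f w) * of_real (1 / s n)) (dz k f) sequentially"
    unfolding g_def using sub holo_fun_dz[OF f]
    by (subst uniform_limit_cong'[where g="\<lambda>n w. (f (w + s n *\<^sub>R axis k 1) - f w) * of_real (1 / s n)" and i="?D"]) auto
qed

lemma holo_fun_dz_holo:
  assumes S: "open S" and f: "holo_fun f S"
  shows "holo_fun (dz k f) S"
proof -
  have "\<exists>r>0. holo_fun (dz k f) (ball w0 r)" if w0: "w0 \<in> S" for w0
  proof -
    obtain R0 where R0: "R0 > 0" "cball w0 R0 \<subseteq> S" using S w0 open_contains_cball by blast
    define r where "r = R0 / 2"
    have r: "r > 0" "cball w0 (2 * r) \<subseteq> S" using R0 by (auto simp: r_def)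
    define s where "s n = r / real (Suc n)" for n
    have s: "s n > 0" "s n \<le> r" for n using r by (auto simp: s_def divide_simps)
    have s_lim: "s \<longlonglongrightarrow> 0"
      unfolding s_def[abs_def] by (rule lim_const_over_n[THEN LIMSEQ_Suc])
    show ?thesis
      using holo_uniform_limit[OF open_ball diff_quotient_uniform_limit(2,1)[OF S f r s s_lim]] r(1) by blast
  qed
  then show ?thesis unfolding holo_fun_def by (metis centre_in_ball)
qed

text \<open>The Cauchy inequality for the difference \<open>g n - G\<close> along the complex line
  through \<open>w0\<close> in direction \<open>a\<close>.\<close>

lemma dz_uniform_limit:
  assumes r: "r > 0" and g: "\<And>n. holo_fun (g n) (ball w0 r)" and G: "holo_fun G (ball w0 r)"
    and lim: "uniform_limit (ball w0 r) g G sequentially"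
  shows "(\<lambda>n. dz a (g n) w0) \<longlonglongrightarrow> dz a G w0"
proof (rule LIMSEQ_I)
  fix e :: real assume e: "e > 0"
  let ?e = "axis a 1 :: complex^'a"
  let ?w = "\<lambda>u. w0 + u *s ?e"
  have inb: "?w u \<in> ball w0 r" if "cmod u \<le> r/2" for u
    using that r by (simp add: dist_norm norm_vec_cmult norm_axis1)
  \<comment> \<open>On the circle of radius \<open>r/2\<close> this bound turns into
    \<open>e / 2\<close> for the derivative.\<close>
  obtain N where N: "\<And>n w. n \<ge> N \<Longrightarrow> w \<in> ball w0 r \<Longrightarrow> dist (g n w) (G w) < e * (r/2) / 2"
    using uniform_limitD[OF lim, of "e * (r/2) / 2"] e r unfolding eventually_sequentially by force
  have "norm (dz a (g n) w0 - dz a G w0) < e" if n: "n \<ge> N" for n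
  proof -
    let ?h = "\<lambda>u. g n (?w u) - G (?w u)"
    have hol: "?h holomorphic_on cball 0 (r/2)"
      using inb by (intro holomorphic_on_diff holomorphic_on_subset[OF holo_fun_line(1)[OF g]]
          holomorphic_on_subset[OF holo_fun_line(1)[OF G]]) auto
    have "norm ((deriv ^^ 1) ?h 0) \<le> fact 1 * (e * (r/2) / 2) / (r/2) ^ 1"
    proof (rule Cauchy_inequality)
      show "?h holomorphic_on ball 0 (r/2)" using hol holomorphic_on_subset ball_subset_cball by blast
      show "continuous_on (cball 0 (r/2)) ?h" using hol holomorphic_on_imp_continuous_on by blast
      show "norm (?h u) \<le> e * (r/2) / 2" if "norm (0 - u) = r/2" for u
        using N[OF n inb[of u]] that by (simp add: dist_norm)
    qed (use r in simp)
    moreover have "deriv ?h 0 = frechet_derivative (g n) (at w0) ?e - frechet_derivative G (at w0) ?e"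
    proof -
      have "(?h has_field_derivative frechet_derivative (g n) (at (w0 + 0 *s ?e)) ?e - frechet_derivative G (at (w0 + 0 *s ?e)) ?e) (at 0)"
        by (intro DERIV_diff holo_fun_line(2)[OF g] holo_fun_line(2)[OF G]) (use r in auto)
      then show ?thesis by (simp add: DERIV_imp_deriv)
    qed
    ultimately show ?thesis
      using r e by (simp add: holo_fun_dz[OF g] holo_fun_dz[OF G])
  qed
  then show "\<exists>N. \<forall>n\<ge>N. norm (dz a (g n) w0 - dz a G w0) < e" by blast
qed

text \<open>A difference quotient in direction \<open>b\<close> commutes with \<open>dz a\<close>.
  One side converges because the quotients of \<open>f\<close> converge uniformly, the other by
  convergence of the quotients of \<open>dz a f\<close>.\<close>

lemma dz_commute:
  assumes S: "open S" and f: "holo_fun f S" and w0: "w0 \<in> S"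
  shows "dz a (dz b f) w0 = dz b (dz a f) w0"
proof -
  obtain R0 where R0: "R0 > 0" "cball w0 R0 \<subseteq> S" using S w0 open_contains_cball by blast
  define r where "r = R0 / 2"
  have r: "r > 0" "cball w0 (2 * r) \<subseteq> S" using R0 by (auto simp: r_def)
  define s where "s n = r / real (Suc n)" for n
  have s: "s n > 0" "s n \<le> r" for n using r by (auto simp: s_def divide_simps)
  have s_lim: "s \<longlonglongrightarrow> 0"
    unfolding s_def[abs_def] by (rule lim_const_over_n[THEN LIMSEQ_Suc])
  let ?e = "axis b 1 :: complex^'a"
  let ?g = "\<lambda>f n w. (f (w + s n *\<^sub>R ?e) - f w) * of_real (1 / s n)"
  note D = diff_quotient_uniform_limit[OF S _ r s s_lim]
  note F = D[OF f] and F' = D[OF holo_fun_dz_holo[OF S f, of a]]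
  have w0b: "w0 \<in> ball w0 r" using r by simp
  have "dz a (?g f n) w0 = ?g (dz a f) n w0" for n
  proof -
    have i: "w0 + s n *\<^sub>R ?e \<in> S" by (rule F(3)[OF w0b])
    have sh: "((\<lambda>w. f (w + s n *\<^sub>R ?e)) has_derivative frechet_derivative f (at (w0 + s n *\<^sub>R ?e))) (at w0)"
    proof -
      have "((\<lambda>w. w + s n *\<^sub>R ?e) has_derivative (\<lambda>v. v)) (at w0)" by (auto intro!: derivative_eq_intros)
      from has_derivative_compose[OF this holo_fun_D(1)[OF f i]] show ?thesis .
    qed
    have "(?g f n has_derivative (\<lambda>v. (frechet_derivative f (at (w0 + s n *\<^sub>R ?e)) v - frechet_derivative f (at w0) v) * of_real (1 / s n))) (at w0)"
      by (intro has_derivative_mult_left has_derivative_diff sh holo_fun_D(1)[OF f w0])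
    show ?thesis unfolding dz_eq[OF \<open>(?g f n has_derivative _) (at w0)\<close>]
      using s(1)[of n] by (simp add: dz_def field_simps)
  qed
  moreover have "(\<lambda>n. dz a (?g f n) w0) \<longlonglongrightarrow> dz a (dz b f) w0"
    by (rule dz_uniform_limit[OF r(1) F(2) _ F(1)]) (rule holo_fun_subset[OF holo_fun_dz_holo[OF S f] F(4)])
  moreover have "(\<lambda>n. ?g (dz a f) n w0) \<longlonglongrightarrow> dz b (dz a f) w0"
    by (rule tendsto_uniform_limitI[OF F'(1) w0b])
  ultimately show ?thesis using LIMSEQ_unique by simp
qed

subsection \<open>Bell's integration by parts for proper maps\<close>

lemma C1_on_compose_holo:
  assumes S: "open S" and F: "holo_map F S" and psi: "C1_on \<psi> UNIV"
  shows "C1_on (\<lambda>z. \<psi> (F z)) S"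
proof (rule C1_onI)
  let ?D = "\<lambda>z v. \<chi> j. frechet_derivative (\<lambda>z. F z $ j) (at z) v"
  show "((\<lambda>z. \<psi> (F z)) has_derivative (\<lambda>v. frechet_derivative \<psi> (at (F z)) (?D z v))) (at z)" if "z \<in> S" for z
    using has_derivative_compose[OF holo_map_has_derivative[OF F that] C1_on_D(1)[OF psi]] by simp
  fix v
  have hj: "C1_on (\<lambda>z. F z $ j) S" for j
    using F unfolding holo_map_def by (intro holo_fun_C1 S) auto
  have cF: "continuous_on S F" by (rule holo_map_continuous_on[OF F])
  have "frechet_derivative \<psi> (at w) v = (\<Sum>j\<in>UNIV. dz j \<psi> w * v $ j + dzb j \<psi> w * cnj (v $ j))" for w v
    using real_linear_decomp[of "frechet_derivative \<psi> (at w)" v] C1_on_D(1)[OF psi, of w] has_derivative_linear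
    unfolding dz_def dzb_def by blast
  then have e: "frechet_derivative \<psi> (at (F z)) (?D z v) =
     (\<Sum>j\<in>UNIV. dz j \<psi> (F z) * frechet_derivative (\<lambda>z. F z $ j) (at z) v
        + dzb j \<psi> (F z) * cnj (frechet_derivative (\<lambda>z. F z $ j) (at z) v))" for z by simp
  have "continuous_on UNIV (dz j \<psi>)" "continuous_on UNIV (dzb j \<psi>)" for j
    unfolding dzb_def[abs_def] dz_def[abs_def] by (intro continuous_intros C1_on_D(2)[OF psi]; auto)+
  then show "continuous_on S (\<lambda>z. frechet_derivative \<psi> (at (F z)) (?D z v))"
    unfolding e
    by (intro continuous_intros continuous_on_compose2[of UNIV "dz _ \<psi>", OF _ cF]
        continuous_on_compose2[of UNIV "dzb _ \<psi>", OF _ cF] C1_on_D(2)[OF hj]) auto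
qed

locale proper_holo =
  fixes \<Omega> \<Omega>' :: "(complex^'d) set" and \<Phi> :: "complex^'d \<Rightarrow> complex^'d"
  assumes \<Omega>: "open \<Omega>" and \<Omega>': "open \<Omega>'"
    and holo: "holo_map \<Phi> \<Omega>" and proper: "proper_map \<Phi> \<Omega> \<Omega>'"
begin

definition jmat :: "complex^'d \<Rightarrow> complex^'d^'d" where
  "jmat z = (\<chi> i k. dz k (\<lambda>x. \<Phi> x $ i) z)"

definition jac :: "complex^'d \<Rightarrow> complex" where
  "jac z = (if z \<in> \<Omega> then det (jmat z) else 0)"

lemma holo_coord: "holo_fun (\<lambda>x. \<Phi> x $ i) \<Omega>"
  using holo unfolding holo_map_def by blast

lemma \<Phi>_cont: "continuous_on \<Omega> \<Phi>" by (rule holo_map_continuous_on[OF holo])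

lemma \<Phi>_in: "z \<in> \<Omega> \<Longrightarrow> \<Phi> z \<in> \<Omega>'"
  using proper unfolding proper_map_def by auto

lemma compact_preimage: "compact K \<Longrightarrow> K \<subseteq> \<Omega>' \<Longrightarrow> compact {z\<in>\<Omega>. \<Phi> z \<in> K}"
  using proper unfolding proper_map_def by auto

lemma holo_jmat: "holo_fun (\<lambda>z. jmat z $ i $ k) \<Omega>"
  unfolding jmat_def using holo_fun_dz_holo[OF \<Omega> holo_coord] by simp

lemma holo_jac: "holo_fun jac \<Omega>"
proof -
  have "holo_fun (\<lambda>z. det (jmat z)) \<Omega>"
    unfolding det_def by (intro holo_fun_sum holo_fun_mult holo_fun_prod holo_jmat holo_fun_const)
  then show ?thesis by (rule holo_fun_cong[OF \<Omega>, rotated]) (simp add: jac_def)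
qed

lemma jac_outside: "z \<notin> \<Omega> \<Longrightarrow> jac z = 0" by (simp add: jac_def)

text \<open>The Piola identity: collecting the permutations by the value of \<open>p j\<close> gives
  the cofactors of row \<open>j\<close>. By the product rule each term holds one second derivative;
  composing \<open>p\<close> with the transposition of \<open>j\<close> and \<open>l\<close> flips
  the sign and swaps the two derivatives of \<open>\<Phi>\<close> component \<open>l\<close>, so the
  terms cancel in pairs.\<close>

lemma cofactor_div_free:
  assumes z: "z \<in> \<Omega>"
  shows "(\<Sum>p | p permutes UNIV. of_int (sign p) * dz (p j) (\<lambda>x. \<Prod>i\<in>UNIV-{j}. dz (p i) (\<lambda>x. \<Phi> x $ i) x) z) = 0"
proof -
  let ?P = "{p. p permutes (UNIV::'d set)}"
  let ?h = "\<lambda>l p. of_int (sign p) * (dz (p j) (dz (p l) (\<lambda>x. \<Phi> x $ l)) z * (\<Prod>i\<in>UNIV-{j}-{l}. dz (p i) (\<lambda>x. \<Phi> x $ i) z)) :: complex"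
  have "dz (p j) (\<lambda>x. \<Prod>i\<in>UNIV-{j}. dz (p i) (\<lambda>x. \<Phi> x $ i) x) z
     = (\<Sum>l\<in>UNIV-{j}. dz (p j) (dz (p l) (\<lambda>x. \<Phi> x $ l)) z * (\<Prod>i\<in>UNIV-{j}-{l}. dz (p i) (\<lambda>x. \<Phi> x $ i) z))" for p
    by (rule dz_prod(2)) (auto intro: holo_fun_differentiable[OF holo_fun_dz_holo[OF \<Omega> holo_coord] z])
  then have "(\<Sum>p\<in>?P. of_int (sign p) * dz (p j) (\<lambda>x. \<Prod>i\<in>UNIV-{j}. dz (p i) (\<lambda>x. \<Phi> x $ i) x) z)
    = (\<Sum>p\<in>?P. \<Sum>l\<in>UNIV-{j}. ?h l p)"
    by (simp add: sum_distrib_left)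
  also have "\<dots> = (\<Sum>l\<in>UNIV-{j}. \<Sum>p\<in>?P. ?h l p)" by (rule sum.swap)
  also have "\<dots> = 0"
  proof (rule sum.neutral, rule ballI)
    fix l assume l: "l \<in> UNIV - {j}"
    let ?t = "Transposition.transpose j l"
    have "(\<Sum>p\<in>?P. ?h l p) = (\<Sum>p\<in>?P. ?h l (p \<circ> ?t))"
      by (rule sum_permutations_compose_right[OF permutes_swap_id]) auto
    also have "\<dots> = (\<Sum>p\<in>?P. - ?h l p)"
    proof (rule sum.cong[OF refl])
      fix p assume p: "p \<in> ?P"
      have "sign (p \<circ> ?t) = - sign p"
        using l p by (subst sign_compose) (auto simp: permutation_swap_id sign_swap_id intro: permutes_imp_permutation[OF finite])
      moreover have "(\<Prod>i\<in>UNIV-{j}-{l}. dz ((p \<circ> ?t) i) (\<lambda>x. \<Phi> x $ i) z) = (\<Prod>i\<in>UNIV-{j}-{l}. dz (p i) (\<lambda>x. \<Phi> x $ i) z)"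
        by (rule prod.cong) (auto simp: Transposition.transpose_def)
      moreover have "dz ((p \<circ> ?t) j) (dz ((p \<circ> ?t) l) (\<lambda>x. \<Phi> x $ l)) z = dz (p j) (dz (p l) (\<lambda>x. \<Phi> x $ l)) z"
        by (simp add: dz_commute[OF \<Omega> holo_coord z])
      ultimately show "?h l (p \<circ> ?t) = - ?h l p" by simp
    qed
    finally have "(\<Sum>p\<in>?P. ?h l p) = - (\<Sum>p\<in>?P. ?h l p)" by (simp add: sum_negf)
    then show "(\<Sum>p\<in>?P. ?h l p) = 0" by simp
  qed
  finally show ?thesis .
qed

text \<open>The left side is the determinant of the Jacobian matrix with row \<open>j\<close>
  replaced by the gradient of \<open>\<psi>\<close> composed with \<open>\<Phi>\<close>. By the
  chain rule that gradient is a combination of all the rows, and the determinant keeps only the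
  coefficient of row \<open>j\<close>.\<close>

lemma bell_identity:
  assumes z: "z \<in> \<Omega>" and psi: "\<psi> differentiable (at (\<Phi> z))"
  shows "(\<Sum>p | p permutes UNIV. of_int (sign p) * (dz (p j) (\<lambda>x. \<psi> (\<Phi> x)) z * (\<Prod>i\<in>UNIV-{j}. dz (p i) (\<lambda>x. \<Phi> x $ i) z)))
     = dz j \<psi> (\<Phi> z) * jac z"
proof -
  let ?x = "\<chi> i. dz i \<psi> (\<Phi> z)"
  let ?A = "\<chi> i. if i = j then (\<Sum>i\<in>UNIV. ?x $ i *s row i (jmat z)) else row i (jmat z)"
  have 1: "?A $ i $ k = (if i = j then dz k (\<lambda>x. \<psi> (\<Phi> x)) z else dz k (\<lambda>x. \<Phi> x $ i) z)" for i k
    by (simp add: dz_compose_holo[OF psi holo z] row_def jmat_def)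
  have "(\<Prod>i\<in>UNIV. ?A $ i $ p i) = dz (p j) (\<lambda>x. \<psi> (\<Phi> x)) z * (\<Prod>i\<in>UNIV-{j}. dz (p i) (\<lambda>x. \<Phi> x $ i) z)" for p
    unfolding 1 by (subst prod.remove[of UNIV j]) (auto intro!: prod.cong)
  then have "det ?A = (\<Sum>p | p permutes UNIV. of_int (sign p) * (dz (p j) (\<lambda>x. \<psi> (\<Phi> x)) z * (\<Prod>i\<in>UNIV-{j}. dz (p i) (\<lambda>x. \<Phi> x $ i) z)))"
    unfolding det_def by simp
  moreover have "det ?A = dz j \<psi> (\<Phi> z) * det (jmat z)"
    using cramer_lemma_transpose[of j ?x "jmat z"] by simp
  ultimately show ?thesis using z by (simp add: jac_def)
qed

text \<open>The integrand is a sum of derivatives of the compactly supported \<open>h p\<close>: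
  \<open>dz\<close> annihilates \<open>cnj f\<close>, derivatives of the cofactors cancel, and what
  remains is the expression of \<open>bell_identity\<close>.\<close>

lemma bell_ibp:
  assumes f: "holo_fun f \<Omega>" and f0: "\<And>z. z \<notin> \<Omega> \<Longrightarrow> f z = 0"
    and psi: "C1_on \<psi> UNIV" "compact K" "K \<subseteq> \<Omega>'" "\<And>w. w \<notin> K \<Longrightarrow> \<psi> w = 0"
  shows "(\<integral>z. cnj (f z) * (dz j \<psi> (\<Phi> z) * jac z) \<partial>lborel) = 0"
proof -
  let ?L = "{z\<in>\<Omega>. \<Phi> z \<in> K}"
  let ?Q = "{p. p permutes (UNIV::'d set)}"
  define P where "P p x = (\<Prod>i\<in>UNIV-{j}. dz (p i) (\<lambda>x. \<Phi> x $ i) x)" for p x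
  define h where "h p z = cnj (f z) * (\<psi> (\<Phi> z) * P p z)" for p z
  have L: "compact ?L" by (rule compact_preimage[OF psi(2,3)])
  have psid: "\<psi> differentiable (at w)" for w using psi(1) by (simp add: C1_on_def)
  have C1P: "C1_on (P p) \<Omega>" for p
    unfolding P_def by (intro C1_on_prod holo_fun_C1 \<Omega> holo_fun_dz_holo holo_coord)
  have C1c: "C1_on (\<lambda>z. \<psi> (\<Phi> z)) \<Omega>" by (rule C1_on_compose_holo[OF \<Omega> holo psi(1)])
  have C1f: "C1_on (\<lambda>z. cnj (f z)) \<Omega>" by (intro C1_on_cnj holo_fun_C1 \<Omega> f)
  have h0: "h p z = 0" if "z \<notin> ?L" for p z
    using that f0[of z] psi(4)[of "\<Phi> z"] by (auto simp: h_def)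
  have C1h: "C1_on (h p) UNIV" for p
    by (rule C1_on_extend[OF \<Omega> _ compact_imp_closed[OF L]])
      (use h0 in \<open>auto simp: h_def[abs_def] intro!: C1_on_mult C1f C1c C1P\<close>)
  have D: "dz (p j) (h p) z = cnj (f z) * (dz (p j) (\<lambda>x. \<psi> (\<Phi> x)) z * P p z) + cnj (f z) * \<psi> (\<Phi> z) * dz (p j) (P p) z"
    if z: "z \<in> \<Omega>" for p z
  proof -
    have d: "(\<lambda>z. cnj (f z)) differentiable (at z)" "(\<lambda>z. \<psi> (\<Phi> z)) differentiable (at z)" "P p differentiable (at z)"
      using C1f C1c C1P z unfolding C1_on_def by blast+
    have "(\<lambda>z. \<psi> (\<Phi> z) * P p z) differentiable (at z)" by (rule differentiable_mult[OF d(2,3)])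
    from dz_mult(1)[OF d(1) this] dz_mult(1)[OF d(2,3)]
    show ?thesis unfolding h_def[abs_def]
      by (simp add: dz_cnj(1)[OF holo_fun_differentiable[OF f z]] holo_fun_dzb[OF f z] algebra_simps)
  qed
  have "(\<Sum>p\<in>?Q. of_int (sign p) * dz (p j) (h p) z) = cnj (f z) * (dz j \<psi> (\<Phi> z) * jac z)" for z
  proof (cases "z \<in> \<Omega>")
    case True
    have "(\<Sum>p\<in>?Q. of_int (sign p) * dz (p j) (h p) z) =
       cnj (f z) * (\<Sum>p\<in>?Q. of_int (sign p) * (dz (p j) (\<lambda>x. \<psi> (\<Phi> x)) z * P p z))
       + cnj (f z) * \<psi> (\<Phi> z) * (\<Sum>p\<in>?Q. of_int (sign p) * dz (p j) (P p) z)"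
      unfolding D[OF True] by (simp add: sum_distrib_left sum.distrib algebra_simps)
    also have "(\<Sum>p\<in>?Q. of_int (sign p) * dz (p j) (P p) z) = 0"
      using cofactor_div_free[OF True] unfolding P_def[abs_def] .
    also have "(\<Sum>p\<in>?Q. of_int (sign p) * (dz (p j) (\<lambda>x. \<psi> (\<Phi> x)) z * P p z)) = dz j \<psi> (\<Phi> z) * jac z"
      using bell_identity[OF True psid] unfolding P_def .
    finally show ?thesis by simp
  next
    case False
    then have "z \<notin> ?L" by auto
    then have "frechet_derivative (h p) (at z) = (\<lambda>v. 0)" for p
      using frechet_zero_outside(1)[of ?L "h p" z, OF compact_imp_closed[OF L] h0] by blast
    then show ?thesis using f0[OF False] by (simp add: dz_def)
  qed
  then have "(\<integral>z. cnj (f z) * (dz j \<psi> (\<Phi> z) * jac z) \<partial>lborel) = (\<integral>z. (\<Sum>p\<in>?Q. of_int (sign p) * dz (p j) (h p) z) \<partial>lborel)"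
    by simp
  also have "\<dots> = (\<Sum>p\<in>?Q. of_int (sign p) * (\<integral>z. dz (p j) (h p) z \<partial>lborel))"
  proof -
    have "integrable lborel (\<lambda>z. dz (p j) (h p) z)" for p
      unfolding dz_def using integrable_frechet[OF C1h L h0] by simp
    then show ?thesis by (subst Bochner_Integration.integral_sum) auto
  qed
  also have "\<dots> = 0" using integral_dz_zero(1)[OF C1h L h0] by simp
  finally show ?thesis .
qed

text \<open>Weak holomorphy is stated with \<open>dzb\<close>, so the integration by parts is
  applied to the conjugate test function and the resulting integral is conjugated.\<close>

lemma trace_density:
  assumes f: "holo_fun f \<Omega>" and f0: "\<And>z. z \<notin> \<Omega> \<Longrightarrow> f z = 0"
  shows "weakly_holo_density \<Omega> \<Omega>' \<Phi> (\<lambda>z. f z * cnj (jac z))"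
proof
  show "continuous_on \<Omega> (\<lambda>z. f z * cnj (jac z))"
    by (intro continuous_intros holo_fun_continuous_on f holo_jac)
  show "f z * cnj (jac z) = 0" if "z \<notin> \<Omega>" for z using f0[OF that] by simp
  fix \<psi> :: "complex^'d \<Rightarrow> complex" and j K
  assume psi: "C1_on \<psi> UNIV" "compact K" "K \<subseteq> \<Omega>'" "\<And>w. w \<notin> K \<Longrightarrow> \<psi> w = 0"
  have psid: "\<psi> differentiable (at w)" for w using psi(1) by (simp add: C1_on_def)
  have "(\<integral>z. cnj (f z) * (dz j (\<lambda>w. cnj (\<psi> w)) (\<Phi> z) * jac z) \<partial>lborel) = 0"
    by (rule bell_ibp[OF f f0 C1_on_cnj[OF psi(1)] psi(2,3)]) (use psi(4) in auto)
  then have "(\<integral>z. cnj (f z * cnj (jac z) * dzb j \<psi> (\<Phi> z)) \<partial>lborel) = 0"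
    by (simp add: dz_cnj(1)[OF psid] mult_ac)
  then show "(\<integral>z. f z * cnj (jac z) * dzb j \<psi> (\<Phi> z) \<partial>lborel) = 0"
    unfolding Bochner_Integration.integral_cnj complex_cnj_zero_iff .
qed (auto intro: \<Omega> \<Omega>' \<Phi>_cont compact_preimage)

text \<open>Formally the sum of \<open>f / jac\<close> over the preimages of a point.\<close>

definition tr :: "(complex^'d \<Rightarrow> complex) \<Rightarrow> complex^'d \<Rightarrow> complex" where
  "tr f = weakly_holo_density.trace \<Omega>' \<Phi> (\<lambda>z. f z * cnj (jac z))"

lemma tr:
  assumes f: "holo_fun f \<Omega>" and f0: "\<And>z. z \<notin> \<Omega> \<Longrightarrow> f z = 0"
  shows "holo_fun (tr f) \<Omega>'"
    and "test_fun u \<Omega>' \<Longrightarrow> (\<integral>z. f z * cnj (jac z) * u (\<Phi> z) \<partial>lborel) = (\<integral>w. tr f w * u w \<partial>lborel)"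
    and "test_fun u \<Omega>' \<Longrightarrow> integrable lborel (\<lambda>z. f z * cnj (jac z) * u (\<Phi> z))"
proof -
  interpret weakly_holo_density \<Omega> \<Omega>' \<Phi> "\<lambda>z. f z * cnj (jac z)"
    by (rule trace_density[OF f f0])
  show "holo_fun (tr f) \<Omega>'" unfolding tr_def by (rule trace_holo)
  assume "test_fun u \<Omega>'"
  then show "(\<integral>z. f z * cnj (jac z) * u (\<Phi> z) \<partial>lborel) = (\<integral>w. tr f w * u w \<partial>lborel)"
    "integrable lborel (\<lambda>z. f z * cnj (jac z) * u (\<Phi> z))"
    unfolding test_fun_def tr_def using trace_pairing integrable_test by blast+
qed

end

subsection \<open>The Bergman space as a Hilbert space\<close>

definition L2 :: "(complex^'d \<Rightarrow> complex) \<Rightarrow> bool" where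
  "L2 f \<longleftrightarrow> f \<in> borel_measurable lborel \<and> integrable lborel (\<lambda>z. (cmod (f z))\<^sup>2)"

lemma borel_measurable_cnj: "f \<in> borel_measurable M \<Longrightarrow> (\<lambda>z. cnj (f z)) \<in> borel_measurable M"
  by (rule measurable_compose[of f M borel cnj borel])
    (auto intro!: borel_measurable_continuous_onI continuous_intros)

lemma L2_prod:
  assumes "L2 f" "L2 g"
  shows "integrable lborel (\<lambda>z. f z * cnj (g z))"
proof (rule Bochner_Integration.integrable_bound)
  show "integrable lborel (\<lambda>z. (cmod (f z))\<^sup>2 + (cmod (g z))\<^sup>2)" using assms by (simp add: L2_def)
  show "(\<lambda>z. f z * cnj (g z)) \<in> borel_measurable lborel"
    using assms by (auto simp: L2_def intro!: borel_measurable_times borel_measurable_cnj)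
  have "cmod (f z * cnj (g z)) \<le> (cmod (f z))\<^sup>2 + (cmod (g z))\<^sup>2" for z
  proof -
    have "2 * (cmod (f z) * cmod (g z)) \<le> (cmod (f z))\<^sup>2 + (cmod (g z))\<^sup>2"
      using sum_squares_bound[of "cmod (f z)" "cmod (g z)"] by simp
    moreover have "0 \<le> cmod (f z) * cmod (g z)" by simp
    ultimately show ?thesis unfolding norm_mult complex_mod_cnj by linarith
  qed
  then show "AE z in lborel. cmod (f z * cnj (g z)) \<le> norm ((cmod (f z))\<^sup>2 + (cmod (g z))\<^sup>2)"
    by simp
qed

lemma cmod_sq_add_cmult: "(cmod (a + c * b))\<^sup>2 = (cmod a)\<^sup>2 + 2 * Re (cnj c * (a * cnj b)) + (cmod c)\<^sup>2 * (cmod b)\<^sup>2"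
  by (simp only: cmod_power2) (simp add: power2_eq_square algebra_simps)

lemma berg_norm_sq: "(berg_norm f)\<^sup>2 = (\<integral>z. (cmod (f z))\<^sup>2 \<partial>lborel)" by (simp add: berg_norm_def)

lemma L2_add_cmult:
  assumes f: "L2 f" and g: "L2 g"
  shows "L2 (\<lambda>z. f z + c * g z)"
    and "(berg_norm (\<lambda>z. f z + c * g z))\<^sup>2 = (berg_norm f)\<^sup>2 + 2 * Re (cnj c * berg_inner f g) + (cmod c)\<^sup>2 * (berg_norm g)\<^sup>2"
proof -
  have i2: "integrable lborel (\<lambda>z. Re (cnj c * (f z * cnj (g z))))"
    by (intro integrable_Re integrable_mult_right L2_prod f g)
  have i1: "integrable lborel (\<lambda>z. (cmod (f z))\<^sup>2)" "integrable lborel (\<lambda>z. (cmod (g z))\<^sup>2)"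
    using f g by (auto simp: L2_def)
  have i: "integrable lborel (\<lambda>z. (cmod (f z))\<^sup>2 + 2 * Re (cnj c * (f z * cnj (g z))) + (cmod c)\<^sup>2 * (cmod (g z))\<^sup>2)"
    by (intro Bochner_Integration.integrable_add integrable_mult_right i1 i2)
  show "L2 (\<lambda>z. f z + c * g z)"
    unfolding L2_def cmod_sq_add_cmult using i f g by (auto simp: L2_def)
  have "(\<integral>z. (cmod (f z + c * g z))\<^sup>2 \<partial>lborel) = (\<integral>z. (cmod (f z))\<^sup>2 \<partial>lborel) + 2 * Re (cnj c * berg_inner f g) + (cmod c)\<^sup>2 * (\<integral>z. (cmod (g z))\<^sup>2 \<partial>lborel)"
  proof -
    have "Re (cnj c * berg_inner f g) = (\<integral>z. Re (cnj c * (f z * cnj (g z))) \<partial>lborel)"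
      unfolding berg_inner_def using L2_prod[OF f g]
      by (subst integral_Re) (auto intro!: integrable_mult_right)
    then show ?thesis
      unfolding cmod_sq_add_cmult
      using Bochner_Integration.integral_add[OF Bochner_Integration.integrable_add[OF i1(1) integrable_mult_right[OF i2, of 2]] integrable_mult_right[OF i1(2), of "(cmod c)\<^sup>2"]]
        Bochner_Integration.integral_add[OF i1(1) integrable_mult_right[OF i2, of 2]]
      by (simp only: integral_mult_right_zero)
  qed
  then show "(berg_norm (\<lambda>z. f z + c * g z))\<^sup>2 = (berg_norm f)\<^sup>2 + 2 * Re (cnj c * berg_inner f g) + (cmod c)\<^sup>2 * (berg_norm g)\<^sup>2"
    unfolding berg_norm_sq .
qed

lemma berg_norm_nonneg [simp]: "berg_norm f \<ge> 0" by (simp add: berg_norm_def)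

lemma berg_inner_commute: "berg_inner g f = cnj (berg_inner f g)"
  unfolding berg_inner_def by (simp flip: Bochner_Integration.integral_cnj add: mult.commute)

lemma berg_inner_self: "berg_inner f f = of_real ((berg_norm f)\<^sup>2)"
  unfolding berg_inner_def berg_norm_sq by (simp only: complex_norm_square[symmetric] integral_complex_of_real)

lemma L2_cmult: "L2 f \<Longrightarrow> L2 (\<lambda>z. c * f z)"
  using L2_add_cmult(1)[of "\<lambda>z. 0" f c] by (simp add: L2_def)

lemma L2_lincomb:
  assumes "L2 f" "L2 g"
  shows "L2 (\<lambda>z. a * f z + b * g z)"
  by (rule L2_add_cmult(1)[OF L2_cmult[OF assms(1)] assms(2)])

lemma L2_diff: "L2 f \<Longrightarrow> L2 g \<Longrightarrow> L2 (\<lambda>z. f z - g z)"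
  using L2_add_cmult(1)[of f g "-1"] by simp

lemma berg_inner_lincomb_left:
  assumes "L2 f" "L2 g" "L2 h"
  shows "berg_inner (\<lambda>z. a * f z + b * g z) h = a * berg_inner f h + b * berg_inner g h"
proof -
  have "berg_inner (\<lambda>z. a * f z + b * g z) h = (\<integral>z. a * (f z * cnj (h z)) + b * (g z * cnj (h z)) \<partial>lborel)"
    unfolding berg_inner_def by (simp add: algebra_simps)
  then show ?thesis
    using L2_prod[OF assms(1,3)] L2_prod[OF assms(2,3)] unfolding berg_inner_def by simp
qed

lemma berg_inner_diff_left:
  assumes "L2 f" "L2 g" "L2 h"
  shows "berg_inner (\<lambda>z. f z - g z) h = berg_inner f h - berg_inner g h"
  using berg_inner_lincomb_left[OF assms, of 1 "-1"] by simp

lemma berg_inner_diff_right: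
  assumes "L2 f" "L2 g" "L2 h"
  shows "berg_inner h (\<lambda>z. f z - g z) = berg_inner h f - berg_inner h g"
  using berg_inner_diff_left[OF assms] berg_inner_commute by (metis complex_cnj_diff)

lemma Re_cnj_scaled: "Re (cnj (- of_real s * c) * c) = - s * (cmod c)\<^sup>2"
proof -
  have "cnj (- of_real s * c) * c = of_real (- s) * (c * cnj c)" by simp
  also have "\<dots> = of_real (- s * (cmod c)\<^sup>2)" by (simp only: complex_norm_square[symmetric] of_real_mult)
  finally show ?thesis by (simp only: Re_complex_of_real)
qed

lemma berg_Cauchy_Schwarz:
  assumes f: "L2 f" and g: "L2 g"
  shows "cmod (berg_inner f g) \<le> berg_norm f * berg_norm g"
proof (cases "berg_norm g = 0")
  \<comment> \<open>\<open>L2\<close> contains functions rather than classes, so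
    \<open>berg_norm g = 0\<close> does not make \<open>g\<close> zero. With no quadratic term,
    arbitrarily large multiples of \<open>g\<close> can be added, which forces the inner product to
    vanish.\<close>
  case True
  define c where "c = berg_inner f g"
  have "2 * (cmod c)\<^sup>2 \<le> e * (berg_norm f)\<^sup>2" if e: "e > 0" for e
  proof -
    have "0 \<le> (berg_norm f)\<^sup>2 + 2 * Re (cnj (- of_real (1/e) * c) * c)"
      using zero_le_power2[of "berg_norm (\<lambda>z. f z + (- of_real (1/e) * c) * g z)"]
      unfolding L2_add_cmult(2)[OF f g] True c_def[symmetric] by simp
    also have "Re (cnj (- of_real (1/e) * c) * c) = - (1/e) * (cmod c)\<^sup>2" by (rule Re_cnj_scaled)
    finally show ?thesis using e by (simp add: field_simps)
  qed
  then have "2 * (cmod c)\<^sup>2 \<le> 0" using nonpos_if_le_eps_mult by (metis zero_le_power2)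
  then have "c = 0" by simp
  then show ?thesis by (simp add: c_def)
next
  case False
  then have gp: "(berg_norm g)\<^sup>2 > 0" by simp
  define c where "c = berg_inner f g"
  let ?s = "1 / (berg_norm g)\<^sup>2"
  have "0 \<le> (berg_norm f)\<^sup>2 + 2 * Re (cnj (- of_real ?s * c) * c) + (cmod (- of_real ?s * c))\<^sup>2 * (berg_norm g)\<^sup>2"
    using zero_le_power2[of "berg_norm (\<lambda>z. f z + (- of_real ?s * c) * g z)"]
    unfolding L2_add_cmult(2)[OF f g] c_def[symmetric] .
  also have "Re (cnj (- of_real ?s * c) * c) = - ?s * (cmod c)\<^sup>2" by (rule Re_cnj_scaled)
  also have "(cmod (- of_real ?s * c))\<^sup>2 = ?s\<^sup>2 * (cmod c)\<^sup>2"
    by (simp add: norm_mult power_mult_distrib norm_divide norm_power power_divide)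
  finally have 0: "0 \<le> (berg_norm f)\<^sup>2 + 2 * (- ?s * (cmod c)\<^sup>2) + ?s\<^sup>2 * (cmod c)\<^sup>2 * (berg_norm g)\<^sup>2" .
  have "(1 / G)\<^sup>2 * x * G = 1 / G * x" if "G > 0" for G x :: real
    using that by (simp add: power2_eq_square)
  from this[OF gp] have "?s\<^sup>2 * (cmod c)\<^sup>2 * (berg_norm g)\<^sup>2 = ?s * (cmod c)\<^sup>2" .
  then have "?s * (cmod c)\<^sup>2 \<le> (berg_norm f)\<^sup>2" using 0 by linarith
  then have "(cmod c)\<^sup>2 \<le> (berg_norm f)\<^sup>2 * (berg_norm g)\<^sup>2"
    using gp by (simp add: pos_divide_le_eq)
  then have "(cmod c)\<^sup>2 \<le> (berg_norm f * berg_norm g)\<^sup>2" by (simp add: power_mult_distrib)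
  then show ?thesis unfolding c_def by (rule power2_le_imp_le) simp
qed

text \<open>Fatou's lemma in a form that also yields integrability of the limit; later it removes
  cutoffs and bounds the limit of a Cauchy sequence.\<close>

lemma integrable_limit_bound:
  fixes u :: "nat \<Rightarrow> 'a \<Rightarrow> real"
  assumes int: "\<And>n. integrable M (u n)" and nn: "\<And>n x. x \<in> space M \<Longrightarrow> u n x \<ge> 0"
    and lim: "\<And>x. x \<in> space M \<Longrightarrow> (\<lambda>n. u n x) \<longlonglongrightarrow> v x"
    and B: "\<And>n. integral\<^sup>L M (u n) \<le> B"
  shows "integrable M v" "integral\<^sup>L M v \<le> B"
proof -
  have vn: "v x \<ge> 0" if "x \<in> space M" for x
    using LIMSEQ_le_const[OF lim[OF that]] nn[OF that] by blast
  have vm: "v \<in> borel_measurable M"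
    by (rule borel_measurable_LIMSEQ_real[OF lim]) (use int in auto)
  have "0 \<le> integral\<^sup>L M (u 0)" by (rule Bochner_Integration.integral_nonneg) (use nn in auto)
  then have B0: "B \<ge> 0" using B[of 0] by linarith
  have "(\<integral>\<^sup>+x. ennreal (v x) \<partial>M) = (\<integral>\<^sup>+x. liminf (\<lambda>n. ennreal (u n x)) \<partial>M)"
    by (rule nn_integral_cong) (auto intro!: lim_imp_Liminf[symmetric] tendsto_ennrealI lim)
  also have "\<dots> \<le> liminf (\<lambda>n. \<integral>\<^sup>+x. ennreal (u n x) \<partial>M)"
    by (rule nn_integral_liminf) (use int in auto)
  also have "\<dots> \<le> ennreal B"
  proof -
    have "(\<integral>\<^sup>+x. ennreal (u n x) \<partial>M) \<le> ennreal B" for n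
      using nn_integral_eq_integral[OF int, of n] nn B[of n] by (simp add: ennreal_leI)
    then have "liminf (\<lambda>n. \<integral>\<^sup>+x. ennreal (u n x) \<partial>M) \<le> liminf (\<lambda>n::nat. ennreal B)"
      by (intro Liminf_mono always_eventually) auto
    then show ?thesis by (simp add: Liminf_const)
  qed
  finally have *: "(\<integral>\<^sup>+x. ennreal (v x) \<partial>M) \<le> ennreal B" .
  show i: "integrable M v"
    using vm vn * by (intro integrableI_nonneg) (auto simp: less_top[symmetric] top_unique)
  have "ennreal (integral\<^sup>L M v) \<le> ennreal B"
    using nn_integral_eq_integral[OF i] vn * by simp
  then show "integral\<^sup>L M v \<le> B" using B0 by simp
qed

section \<open>Point evaluations, completeness and Riesz representation\<close>

lemma bergman_holo: "f \<in> bergman_space S \<Longrightarrow> holo_fun f S"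
  and bergman_outside: "f \<in> bergman_space S \<Longrightarrow> z \<notin> S \<Longrightarrow> f z = 0"
  by (auto simp: bergman_space_def)

lemma holo_measurable:
  assumes "open S" "holo_fun f S" "\<And>z. z \<notin> S \<Longrightarrow> f z = 0"
  shows "f \<in> borel_measurable lborel"
proof -
  have "(\<lambda>z. indicator S z *\<^sub>R f z) \<in> borel_measurable borel"
    using assms by (intro borel_measurable_continuous_on_indicator holo_fun_continuous_on) auto
  moreover have "(\<lambda>z. indicator S z *\<^sub>R f z) = f" using assms(3) by (auto simp: indicator_def)
  ultimately show ?thesis by simp
qed

lemma bergman_L2: "open S \<Longrightarrow> f \<in> bergman_space S \<Longrightarrow> L2 f"
  using holo_measurable unfolding bergman_space_def L2_def by blast

lemma bergman_I:
  "open S \<Longrightarrow> holo_fun f S \<Longrightarrow> (\<And>z. z \<notin> S \<Longrightarrow> f z = 0) \<Longrightarrow> L2 f \<Longrightarrow> f \<in> bergman_space S"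
  unfolding bergman_space_def L2_def by blast

lemma bergman_lincomb:
  assumes "open S" "f \<in> bergman_space S" "g \<in> bergman_space S"
  shows "(\<lambda>z. a * f z + b * g z) \<in> bergman_space S"
proof (rule bergman_I[OF assms(1)])
  show "holo_fun (\<lambda>z. a * f z + b * g z) S"
    by (intro holo_fun_add holo_fun_cmult bergman_holo assms)
  show "L2 (\<lambda>z. a * f z + b * g z)" by (intro L2_lincomb bergman_L2[OF assms(1)] assms)
qed (use assms in \<open>simp add: bergman_outside\<close>)

lemma bergman_diff:
  assumes "open S" "f \<in> bergman_space S" "g \<in> bergman_space S"
  shows "(\<lambda>z. f z - g z) \<in> bergman_space S"
  using bergman_lincomb[OF assms, of 1 "-1"] by simp

text \<open>Cauchy-Schwarz applied to the mean value formula. All balls of one radius around points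
  of \<open>K\<close> fit into \<open>S\<close>, and the kernels are translates of each other, so
  one norm serves for every \<open>w\<close>.\<close>

lemma bergman_eval_bound:
  assumes S: "open S" and K: "compact K" "K \<subseteq> S"
  obtains C where "C > 0" "\<And>f w. f \<in> bergman_space S \<Longrightarrow> w \<in> K \<Longrightarrow> cmod (f w) \<le> C * berg_norm f"
proof -
  obtain R where R: "R > 0" "(\<Union>x\<in>K. cball x R) \<subseteq> S"
    using compact_subset_open_imp_cball_epsilon_subset[OF K(1) S K(2)] by blast
  define t where "t = 2 / R\<^sup>2"
  have t: "t > 0" "1 < t * R\<^sup>2" using R by (auto simp: t_def)
  let ?m = "mol t :: complex^'a \<Rightarrow> complex"
  have even: "mol t (w - z) = mol t (z - w)" for w z :: "complex^'a"
    by (simp add: mol_def scaled_bump_def norm_minus_commute)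
  have mi: "integrable lborel (\<lambda>z. (cmod (?m z))\<^sup>2)"
  proof (rule integrable_compact_support[of "cball 0 (1 / sqrt t)"])
    fix x :: "complex^'a" assume "x \<notin> cball 0 (1 / sqrt t)"
    then have "1 < sqrt t * norm x" using t by (simp add: field_simps)
    then have "1 \<le> (sqrt t * norm x)\<^sup>2" by simp
    then show "(cmod (?m x))\<^sup>2 = 0" using t scaled_bump_zero[of t x] by (simp add: power_mult_distrib mol_def)
  qed (auto intro!: continuous_intros continuous_mol)
  define C where "C = berg_norm ?m"
  have mL2: "L2 (\<lambda>z. cnj (mol t (w - z)))" and mn: "berg_norm (\<lambda>z. cnj (mol t (w - z))) = C" for w :: "complex^'a"
  proof -
    have "(\<lambda>z. cnj (mol t (z - w))) \<in> borel_measurable borel"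
      by (intro borel_measurable_continuous_onI continuous_intros continuous_on_compose2[OF continuous_mol[of UNIV]]) auto
    then show "L2 (\<lambda>z. cnj (mol t (w - z)))"
      unfolding L2_def even using lborel_translate(1)[OF mi, of w] by simp
    show "berg_norm (\<lambda>z. cnj (mol t (w - z))) = C"
      unfolding berg_norm_def C_def even using lborel_translate(2)[OF mi, of w] by simp
  qed
  have "cmod (f w) \<le> berg_norm f * C" if f: "f \<in> bergman_space S" and w: "w \<in> K" for f w
  proof -
    have "cball w R \<subseteq> S" using w R by auto
    then have "f w = (\<integral>z. f z * mol t (w - z) \<partial>lborel)"
      by (intro holo_mean_value[OF S bergman_holo[OF f] bergman_outside[OF f] t(1) R(1) t(2)])
    also have "\<dots> = berg_inner f (\<lambda>z. cnj (mol t (w - z)))" by (simp add: berg_inner_def)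
    finally show ?thesis
      using berg_Cauchy_Schwarz[OF bergman_L2[OF S f] mL2[of w]] mn[of w] by simp
  qed
  then have "cmod (f w) \<le> (C + 1) * berg_norm f" if f: "f \<in> bergman_space S" and w: "w \<in> K" for f w
    using add_mono[OF berg_norm_nonneg[of f] \<open>\<And>f w. f \<in> bergman_space S \<Longrightarrow> w \<in> K \<Longrightarrow> cmod (f w) \<le> berg_norm f * C\<close>[OF f w]]
    by (simp add: algebra_simps)
  moreover have "C + 1 > 0" by (simp add: C_def add_nonneg_pos)
  ultimately show ?thesis using that by blast
qed

lemma bergman_norm_zero:
  assumes "open S" "f \<in> bergman_space S" "berg_norm f = 0"
  shows "f = (\<lambda>z. 0)"
proof
  fix z
  show "f z = 0"
  proof (cases "z \<in> S")
    case True
    then show ?thesis using bergman_eval_bound[OF assms(1), of "{z}"] assms(2,3)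
      by (metis compact_sing empty_subsetI insert_subset mult_zero_right norm_le_zero_iff singletonI)
  qed (simp add: bergman_outside[OF assms(2)])
qed

lemma bergman_inner_eqI:
  assumes S: "open S" and h: "h \<in> bergman_space S" "h' \<in> bergman_space S"
    and eq: "\<And>f. f \<in> bergman_space S \<Longrightarrow> berg_inner f h = berg_inner f h'"
  shows "h = h'"
proof -
  let ?d = "\<lambda>z. h z - h' z"
  have d: "?d \<in> bergman_space S" by (rule bergman_diff[OF S h])
  have "berg_inner ?d ?d = 0"
    using eq[OF d] berg_inner_diff_right[OF bergman_L2[OF S h(1)] bergman_L2[OF S h(2)] bergman_L2[OF S d]]
    by simp
  then have "berg_norm ?d = 0" unfolding berg_inner_self by (simp add: of_real_eq_0_iff)
  from bergman_norm_zero[OF S d this] show ?thesis by (auto simp: fun_eq_iff)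
qed

text \<open>The limit is built pointwise as an actual function: evaluation bounds give locally
  uniform convergence and hence holomorphy, while convergence in norm comes from Fatou.\<close>

lemma bergman_complete:
  assumes S: "open S" and f: "\<And>n. f n \<in> bergman_space S"
    and C: "\<And>e. e > 0 \<Longrightarrow> \<exists>N. \<forall>m\<ge>N. \<forall>n\<ge>N. berg_norm (\<lambda>z. f m z - f n z) < e"
  obtains g where "g \<in> bergman_space S" "(\<lambda>n. berg_norm (\<lambda>z. f n z - g z)) \<longlonglongrightarrow> 0"
proof -
  have unif: "\<exists>N. \<forall>m\<ge>N. \<forall>n\<ge>N. \<forall>w\<in>K. cmod (f m w - f n w) < e" if K: "compact K" "K \<subseteq> S" and e: "e > 0" for K e
  proof -
    obtain C0 where C0: "C0 > 0" "\<And>f w. f \<in> bergman_space S \<Longrightarrow> w \<in> K \<Longrightarrow> cmod (f w) \<le> C0 * berg_norm f"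
      using bergman_eval_bound[OF S K] by blast
    obtain N where N: "\<forall>m\<ge>N. \<forall>n\<ge>N. berg_norm (\<lambda>z. f m z - f n z) < e / C0"
      using C[of "e / C0"] e C0 by auto
    have "cmod (f m w - f n w) < e" if "m \<ge> N" "n \<ge> N" "w \<in> K" for m n w
    proof -
      have "cmod (f m w - f n w) \<le> C0 * berg_norm (\<lambda>z. f m z - f n z)"
        using C0(2)[OF bergman_diff[OF S f f] that(3)] .
      also have "\<dots> < C0 * (e / C0)" using N that C0(1) by (intro mult_strict_left_mono) auto
      finally show ?thesis using C0(1) by simp
    qed
    then show ?thesis by blast
  qed
  have "\<exists>l. (\<lambda>n. f n z) \<longlonglongrightarrow> l" for z
  proof (cases "z \<in> S")
    case True
    have "Cauchy (\<lambda>n. f n z)"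
      unfolding Cauchy_def dist_norm using unif[of "{z}"] True by auto
    then show ?thesis using Cauchy_convergent_iff convergent_def by blast
  next
    case False
    then show ?thesis using bergman_outside[OF f False] by (intro exI[of _ 0]) simp
  qed
  then obtain g where g: "\<And>z. (\<lambda>n. f n z) \<longlonglongrightarrow> g z" by metis
  have g0: "g z = 0" if "z \<notin> S" for z
    using LIMSEQ_unique[OF g[of z]] bergman_outside[OF f that] by simp
  have "\<exists>r>0. holo_fun g (ball w0 r)" if w0: "w0 \<in> S" for w0
  proof -
    obtain R where R: "R > 0" "cball w0 R \<subseteq> S" using S w0 open_contains_cball by blast
    have "uniform_limit (ball w0 R) f g sequentially"
    proof (rule uniform_limitI)
      fix e :: real assume e: "e > 0"
      obtain N where "\<forall>m\<ge>N. \<forall>n\<ge>N. \<forall>w\<in>cball w0 R. cmod (f m w - f n w) < e/2"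
        using unif[OF compact_cball R(2) half_gt_zero[OF e]] by blast
      then have N: "\<And>m n w. m \<ge> N \<Longrightarrow> n \<ge> N \<Longrightarrow> w \<in> cball w0 R \<Longrightarrow> cmod (f m w - f n w) < e/2"
        by blast
      have "dist (f n w) (g w) < e" if n: "n \<ge> N" and w: "w \<in> ball w0 R" for n w
      proof -
        have "(\<lambda>m. cmod (f n w - f m w)) \<longlonglongrightarrow> cmod (f n w - g w)"
          by (intro tendsto_intros g)
        then have "cmod (f n w - g w) \<le> e/2"
          by (rule LIMSEQ_le_const2) (use N[OF n, of _ w] w in \<open>auto intro!: exI[of _ N] less_imp_le\<close>)
        then show ?thesis using e by (simp add: dist_norm)
      qed
      then show "\<forall>\<^sub>F n in sequentially. \<forall>w\<in>ball w0 R. dist (f n w) (g w) < e"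
        unfolding eventually_sequentially by blast
    qed
    moreover have "holo_fun (f n) (ball w0 R)" for n
      using R by (intro holo_fun_subset[OF bergman_holo[OF f]]) auto
    ultimately show ?thesis using holo_uniform_limit[OF open_ball] R(1) by blast
  qed
  then have gh: "holo_fun g S" unfolding holo_fun_def by (metis centre_in_ball)
  have L2f: "L2 (f n)" for n by (rule bergman_L2[OF S f])
  \<comment> \<open>Fatou in the index \<open>m\<close> turns the Cauchy estimate into one against
    the limit.\<close>
  have key: "integrable lborel (\<lambda>z. (cmod (f n z - g z))\<^sup>2) \<and> (\<integral>z. (cmod (f n z - g z))\<^sup>2 \<partial>lborel) \<le> e\<^sup>2"
    if N: "\<forall>m\<ge>N. \<forall>n\<ge>N. berg_norm (\<lambda>z. f m z - f n z) < e" and n: "n \<ge> N" for N n e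
  proof -
    have i: "integrable lborel (\<lambda>z. (cmod (f n z - f (m + N) z))\<^sup>2)" for m
      using L2_diff[OF L2f L2f] unfolding L2_def by blast
    have l: "(\<lambda>m. (cmod (f n z - f (m + N) z))\<^sup>2) \<longlonglongrightarrow> (cmod (f n z - g z))\<^sup>2" for z
      by (intro tendsto_intros LIMSEQ_ignore_initial_segment[OF g])
    have b: "(\<integral>z. (cmod (f n z - f (m + N) z))\<^sup>2 \<partial>lborel) \<le> e\<^sup>2" for m
      using N n unfolding berg_norm_sq[symmetric] by (intro power_mono) (auto simp: less_imp_le)
    show ?thesis using integrable_limit_bound[OF i _ l b] by simp
  qed
  have gL2: "L2 g"
  proof -
    obtain N where N: "\<forall>m\<ge>N. \<forall>n\<ge>N. berg_norm (\<lambda>z. f m z - f n z) < 1" using C[of 1] by auto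
    have m: "g \<in> borel_measurable lborel" by (rule holo_measurable[OF S gh g0])
    then have "L2 (\<lambda>z. f N z - g z)" using key[OF N, of N] L2f[of N] unfolding L2_def by auto
    from L2_diff[OF L2f[of N] this] show ?thesis by simp
  qed
  have "(\<lambda>n. berg_norm (\<lambda>z. f n z - g z)) \<longlonglongrightarrow> 0"
  proof (rule LIMSEQ_I)
    fix e :: real assume e: "e > 0"
    obtain N where N: "\<forall>m\<ge>N. \<forall>n\<ge>N. berg_norm (\<lambda>z. f m z - f n z) < e/2" using C[of "e/2"] e by auto
    have "berg_norm (\<lambda>z. f n z - g z) \<le> e/2" if "n \<ge> N" for n
      using key[OF N that] e unfolding berg_norm_def by (intro real_le_lsqrt) auto
    then show "\<exists>N. \<forall>n\<ge>N. norm (berg_norm (\<lambda>z. f n z - g z) - 0) < e"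
      using e by (intro exI[of _ N]) force
  qed
  then show ?thesis using that bergman_I[OF S gh g0 gL2] by blast
qed

text \<open>The representing function minimises the quadratic functional \<open>N\<close>. The
  parallelogram law makes a minimising sequence Cauchy, and the first variation at its limit gives
  the representation.\<close>

lemma bergman_Riesz:
  assumes S: "open S"
    and lin: "\<And>f g a b. f \<in> bergman_space S \<Longrightarrow> g \<in> bergman_space S \<Longrightarrow> l (\<lambda>z. a * f z + b * g z) = a * l f + b * l g"
    and bd: "\<And>f. f \<in> bergman_space S \<Longrightarrow> cmod (l f) \<le> C * berg_norm f"
  obtains h where "h \<in> bergman_space S" "\<And>f. f \<in> bergman_space S \<Longrightarrow> l f = berg_inner f h"
proof -
  let ?B = "bergman_space S"
  have z0: "(\<lambda>z. 0) \<in> ?B" by (simp add: bergman_space_def)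
  define N where "N f = (berg_norm f)\<^sup>2 - 2 * Re (l f)" for f
  have L2B: "f \<in> ?B \<Longrightarrow> L2 f" for f by (rule bergman_L2[OF S])
  \<comment> \<open>Completing the square in
    \<open>(berg_norm f)\<^sup>2 - 2 * C * berg_norm f\<close>.\<close>
  have lb: "N f \<ge> - C\<^sup>2" if "f \<in> ?B" for f
  proof -
    have "Re (l f) \<le> C * berg_norm f" using bd[OF that] complex_Re_le_cmod order_trans by blast
    moreover have "0 \<le> (berg_norm f - C)\<^sup>2" by simp
    ultimately show ?thesis unfolding N_def power2_diff by (simp add: mult.commute)
  qed
  define d where "d = Inf (N ` ?B)"
  have bdd: "bdd_below (N ` ?B)" using lb by (auto intro!: bdd_belowI)
  have dN: "d \<le> N f" if "f \<in> ?B" for f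
    unfolding d_def using that by (intro cInf_lower bdd) auto
  have "\<exists>f\<in>?B. N f < d + 1 / real (Suc n)" for n
    using cInf_lessD[of "N ` ?B" "d + 1 / real (Suc n)"] z0 unfolding d_def by force
  then obtain f where f: "\<And>n. f n \<in> ?B" "\<And>n. N (f n) < d + 1 / real (Suc n)" by metis
  have par: "(berg_norm (\<lambda>z. f m z - f n z))\<^sup>2 \<le> 2 * (1 / real (Suc m) + 1 / real (Suc n))" for m n
  proof -
    let ?h = "\<lambda>z. (1/2) * f m z + (1/2) * f n z"
    have h: "?h \<in> ?B" by (rule bergman_lincomb[OF S f(1) f(1)])
    have e1: "(berg_norm ?h)\<^sup>2 = (berg_norm (f m))\<^sup>2 / 4 + Re (berg_inner (f m) (f n)) / 2 + (berg_norm (f n))\<^sup>2 / 4"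
    proof -
      have A: "berg_inner (\<lambda>z. (1/2) * f m z) (f n) = (1/2) * berg_inner (f m) (f n)"
        using berg_inner_lincomb_left[OF L2B[OF f(1)] L2B[OF f(1)] L2B[OF f(1)], of "1/2" m 0 m n] by simp
      have B: "(berg_norm (\<lambda>z. (1/2) * f m z))\<^sup>2 = (berg_norm (f m))\<^sup>2 / 4"
        unfolding berg_norm_sq by (simp add: norm_mult power_mult_distrib power2_eq_square norm_divide)
      show ?thesis
        unfolding L2_add_cmult(2)[OF L2_cmult[OF L2B[OF f(1)]] L2B[OF f(1)]] A B
        by (simp add: power2_eq_square norm_divide)
    qed
    have e2: "(berg_norm (\<lambda>z. f m z - f n z))\<^sup>2 = (berg_norm (f m))\<^sup>2 - 2 * Re (berg_inner (f m) (f n)) + (berg_norm (f n))\<^sup>2"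
      using L2_add_cmult(2)[OF L2B[OF f(1)[of m]] L2B[OF f(1)[of n]], of "-1"] by simp
    have e3: "Re (l ?h) = Re (l (f m)) / 2 + Re (l (f n)) / 2"
      using lin[OF f(1) f(1), of "1/2" m "1/2" n] by simp
    have "(berg_norm (\<lambda>z. f m z - f n z))\<^sup>2 = 2 * (N (f m) + N (f n) - 2 * N ?h)"
      unfolding N_def e1 e2 e3 by (simp add: algebra_simps)
    then show ?thesis using dN[OF h] f(2)[of m] f(2)[of n] by (simp add: algebra_simps)
  qed
  obtain h where h: "h \<in> ?B" "(\<lambda>n. berg_norm (\<lambda>z. f n z - h z)) \<longlonglongrightarrow> 0"
  proof (rule bergman_complete[OF S f(1)])
    fix e :: real assume e: "e > 0"
    obtain N0 where N0: "1 / real (Suc N0) < e\<^sup>2 / 4"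
      using e nat_approx_posE[of "e\<^sup>2/4"] by auto
    have "berg_norm (\<lambda>z. f m z - f n z) < e" if "m \<ge> N0" "n \<ge> N0" for m n
    proof -
      have "1 / real (Suc m) \<le> 1 / real (Suc N0)" "1 / real (Suc n) \<le> 1 / real (Suc N0)"
        using that by (auto intro!: divide_left_mono)
      then have "2 * (1 / real (Suc m) + 1 / real (Suc n)) \<le> 2 * (1 / real (Suc N0) + 1 / real (Suc N0))"
        by (intro mult_left_mono add_mono) auto
      also have "\<dots> < e\<^sup>2" using N0 by simp
      finally have "(berg_norm (\<lambda>z. f m z - f n z))\<^sup>2 < e\<^sup>2" using par[of m n] by (rule order.strict_trans1[rotated])
      then show ?thesis by (rule power2_less_imp_less) (use e in simp)
    qed
    then show "\<exists>N. \<forall>m\<ge>N. \<forall>n\<ge>N. berg_norm (\<lambda>z. f m z - f n z) < e" by blast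
  qed blast
  have "l g = berg_inner g h" if g: "g \<in> ?B" for g
  proof -
    have conv: "(\<lambda>n. berg_inner (f n) g) \<longlonglongrightarrow> berg_inner h g"
    proof (rule LIM_zero_cancel, rule Lim_null_comparison)
      show "\<forall>\<^sub>F n in sequentially. norm (berg_inner (f n) g - berg_inner h g) \<le> berg_norm (\<lambda>z. f n z - h z) * berg_norm g"
        using berg_Cauchy_Schwarz[OF L2_diff[OF L2B[OF f(1)] L2B[OF h(1)]] L2B[OF g]]
          berg_inner_diff_left[OF L2B[OF f(1)] L2B[OF h(1)] L2B[OF g]] by simp
      show "(\<lambda>n. berg_norm (\<lambda>z. f n z - h z) * berg_norm g) \<longlonglongrightarrow> 0"
        using tendsto_mult_right[OF h(2), of "berg_norm g"] by simp
    qed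
    \<comment> \<open>The variation is written for \<open>f n\<close>, where \<open>N\<close> is
      within \<open>1 / real (Suc n)\<close> of its infimum, and then passed to the limit; this
      avoids evaluating \<open>N\<close> at \<open>h\<close>.\<close>
    have var: "0 \<le> 2 * Re (cnj t * berg_inner h g) + (cmod t)\<^sup>2 * (berg_norm g)\<^sup>2 - 2 * Re (t * l g)" for t
    proof -
      have "(\<lambda>n. 2 * Re (cnj t * berg_inner (f n) g) + (cmod t)\<^sup>2 * (berg_norm g)\<^sup>2 - 2 * Re (t * l g) + 1 / real (Suc n))
         \<longlonglongrightarrow> 2 * Re (cnj t * berg_inner h g) + (cmod t)\<^sup>2 * (berg_norm g)\<^sup>2 - 2 * Re (t * l g) + 0"
        by (intro tendsto_intros conv LIMSEQ_Suc lim_1_over_n)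
      moreover have "0 \<le> 2 * Re (cnj t * berg_inner (f n) g) + (cmod t)\<^sup>2 * (berg_norm g)\<^sup>2 - 2 * Re (t * l g) + 1 / real (Suc n)" for n
      proof -
        have b: "(\<lambda>z. f n z + t * g z) \<in> ?B" using bergman_lincomb[OF S f(1) g, of 1 n t] by simp
        have "N (\<lambda>z. f n z + t * g z) = N (f n) + 2 * Re (cnj t * berg_inner (f n) g) + (cmod t)\<^sup>2 * (berg_norm g)\<^sup>2 - 2 * Re (t * l g)"
          unfolding N_def L2_add_cmult(2)[OF L2B[OF f(1)] L2B[OF g]]
          using lin[OF f(1) g, of 1 n t] by simp
        then show ?thesis using dN[OF b] f(2)[of n] by linarith
      qed
      ultimately show ?thesis using LIMSEQ_le_const[of _ _ 0] by (metis (no_types, lifting) add.right_neutral)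
    qed
    define c where "c = l g - berg_inner g h"
    have "2 * (cmod c)\<^sup>2 \<le> s * ((cmod c)\<^sup>2 * (berg_norm g)\<^sup>2)" if s: "s > 0" for s
    proof -
      \<comment> \<open>In this direction the linear part is
        \<open>- 2 * s * (cmod c)\<^sup>2\<close> while the quadratic part has order
        \<open>s\<^sup>2\<close>; small \<open>s\<close> forces \<open>c = 0\<close>.\<close>
      let ?t = "of_real s * cnj c"
      have "Re (cnj ?t * berg_inner h g) - Re (?t * l g) = - s * (cmod c)\<^sup>2"
      proof -
        have "Re (cnj ?t * berg_inner h g) = Re (?t * berg_inner g h)"
          unfolding berg_inner_commute[of h g] by simp
        then have "Re (cnj ?t * berg_inner h g) - Re (?t * l g) = - Re (?t * c)"
          unfolding c_def by (simp add: algebra_simps)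
        also have "?t * c = of_real (s * (cmod c)\<^sup>2)"
          using complex_norm_square[of c] by (simp add: mult_ac)
        finally show ?thesis by simp
      qed
      moreover have "(cmod ?t)\<^sup>2 = s\<^sup>2 * (cmod c)\<^sup>2" by (simp add: norm_mult power_mult_distrib)
      ultimately have "2 * (s * (cmod c)\<^sup>2) \<le> s\<^sup>2 * (cmod c)\<^sup>2 * (berg_norm g)\<^sup>2"
        using var[of ?t] by simp
      then have "s * (2 * (cmod c)\<^sup>2) \<le> s * (s * ((cmod c)\<^sup>2 * (berg_norm g)\<^sup>2))"
        by (simp add: power2_eq_square mult_ac)
      then show ?thesis using s by simp
    qed
    then have "2 * (cmod c)\<^sup>2 \<le> 0"
      by (rule nonpos_if_le_eps_mult) simp_all
    then show ?thesis by (simp add: c_def)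
  qed
  then show ?thesis using that h(1) by blast
qed

section \<open>Multiplication operators and their adjoints\<close>

lemma mult_op_bergman:
  assumes S: "open S" and phi: "holo_fun \<phi> S" "\<And>z. z \<in> S \<Longrightarrow> cmod (\<phi> z) \<le> M" and f: "f \<in> bergman_space S"
  shows "mult_op S \<phi> f \<in> bergman_space S" "M \<ge> 0 \<Longrightarrow> berg_norm (mult_op S \<phi> f) \<le> M * berg_norm f"
proof -
  have h: "holo_fun (mult_op S \<phi> f) S"
    by (rule holo_fun_cong[OF S _ holo_fun_mult[OF phi(1) bergman_holo[OF f]]]) (simp add: mult_op_def)
  have m: "mult_op S \<phi> f \<in> borel_measurable lborel"
    by (rule holo_measurable[OF S h]) (simp add: mult_op_def)
  have b: "(cmod (mult_op S \<phi> f z))\<^sup>2 \<le> M\<^sup>2 * (cmod (f z))\<^sup>2" for z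
    using phi(2)[of z] by (auto simp: mult_op_def norm_mult power_mult_distrib intro!: mult_right_mono power_mono)
  have i: "integrable lborel (\<lambda>z. M\<^sup>2 * (cmod (f z))\<^sup>2)"
    using bergman_L2[OF S f] by (simp add: L2_def)
  have i2: "integrable lborel (\<lambda>z. (cmod (mult_op S \<phi> f z))\<^sup>2)"
    by (rule Bochner_Integration.integrable_bound[OF i]) (use m b in auto)
  show "mult_op S \<phi> f \<in> bergman_space S"
    by (rule bergman_I[OF S h]) (use m i2 in \<open>auto simp: L2_def mult_op_def\<close>)
  assume M: "M \<ge> 0"
  have "(berg_norm (mult_op S \<phi> f))\<^sup>2 \<le> (M * berg_norm f)\<^sup>2"
    unfolding berg_norm_sq power_mult_distrib using integral_mono[OF i2 i b] by simp
  then show "berg_norm (mult_op S \<phi> f) \<le> M * berg_norm f"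
    by (rule power2_le_imp_le) (use M in simp)
qed

text \<open>\<open>mult_adj\<close> is defined by choice, so its properties depend on the existence
  of a representing function, supplied by Riesz.\<close>

lemma mult_adj:
  assumes S: "open S" and phi: "holo_fun \<phi> S" "\<And>z. z \<in> S \<Longrightarrow> cmod (\<phi> z) \<le> M" and g: "g \<in> bergman_space S"
  shows "mult_adj S \<phi> g \<in> bergman_space S"
    and "f \<in> bergman_space S \<Longrightarrow> berg_inner (mult_op S \<phi> f) g = berg_inner f (mult_adj S \<phi> g)"
proof -
  have phi': "cmod (\<phi> z) \<le> \<bar>M\<bar>" if "z \<in> S" for z using phi(2)[OF that] by linarith
  obtain h where h: "h \<in> bergman_space S" "\<And>f. f \<in> bergman_space S \<Longrightarrow> berg_inner (mult_op S \<phi> f) g = berg_inner f h"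
  proof (rule bergman_Riesz[OF S, of "\<lambda>f. berg_inner (mult_op S \<phi> f) g" "\<bar>M\<bar> * berg_norm g"])
    fix f1 f2 a b assume f: "f1 \<in> bergman_space S" "f2 \<in> bergman_space S"
    have e: "mult_op S \<phi> (\<lambda>z. a * f1 z + b * f2 z) = (\<lambda>z. a * mult_op S \<phi> f1 z + b * mult_op S \<phi> f2 z)"
      by (auto simp: mult_op_def algebra_simps)
    show "berg_inner (mult_op S \<phi> (\<lambda>z. a * f1 z + b * f2 z)) g = a * berg_inner (mult_op S \<phi> f1) g + b * berg_inner (mult_op S \<phi> f2) g"
      unfolding e by (intro berg_inner_lincomb_left bergman_L2[OF S] mult_op_bergman(1)[OF S phi] f g)
  next
    fix f assume f: "f \<in> bergman_space S"
    have "cmod (berg_inner (mult_op S \<phi> f) g) \<le> berg_norm (mult_op S \<phi> f) * berg_norm g"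
      by (intro berg_Cauchy_Schwarz bergman_L2[OF S] mult_op_bergman(1)[OF S phi] f g)
    also have "\<dots> \<le> (\<bar>M\<bar> * berg_norm f) * berg_norm g"
      by (intro mult_right_mono mult_op_bergman(2)[OF S phi(1) phi' f]) auto
    finally show "cmod (berg_inner (mult_op S \<phi> f) g) \<le> \<bar>M\<bar> * berg_norm g * berg_norm f"
      by (simp add: mult_ac)
  qed blast
  have "mult_adj S \<phi> g \<in> bergman_space S \<and>
      (\<forall>f\<in>bergman_space S. berg_inner (mult_op S \<phi> f) g = berg_inner f (mult_adj S \<phi> g))"
    unfolding mult_adj_def by (rule someI[where x=h]) (use h in blast)
  then show "mult_adj S \<phi> g \<in> bergman_space S"
    and "f \<in> bergman_space S \<Longrightarrow> berg_inner (mult_op S \<phi> f) g = berg_inner f (mult_adj S \<phi> g)" by blast+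
qed

subsection \<open>Nondegeneracy of the Jacobian\<close>

text \<open>The interior \<open>A\<close> of the zero set is also closed in \<open>S\<close>: if a
  ball meets \<open>A\<close> at \<open>y\<close>, one-variable continuation along the lines through
  \<open>y\<close> makes \<open>g\<close> vanish on the whole ball.\<close>

lemma holo_fun_identity:
  assumes S: "open S" "connected S" and g: "holo_fun g S"
    and U: "open U" "U \<noteq> {}" "U \<subseteq> S" "\<And>z. z \<in> U \<Longrightarrow> g z = 0" and z: "z \<in> S"
  shows "g z = 0"
proof -
  define A where "A = {z\<in>S. \<exists>V. open V \<and> z \<in> V \<and> (\<forall>x\<in>V. g x = 0)}"
  have "open A"
  proof -
    have "A = S \<inter> \<Union>{V. open V \<and> (\<forall>x\<in>V. g x = 0)}" unfolding A_def by auto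
    then show ?thesis using S(1) by auto
  qed
  moreover have "open (S - A)"
    unfolding open_contains_ball
    proof
      fix z assume z: "z \<in> S - A"
      obtain r where r: "r > 0" "ball z r \<subseteq> S" using S(1) z open_contains_ball by (metis DiffD1)
      have False if y: "y \<in> ball z r" "y \<in> A" for y
      proof -
        obtain V where V: "open V" "y \<in> V" "\<forall>x\<in>V. g x = 0" using y(2) unfolding A_def by blast
        have "g x = 0" if x: "x \<in> ball z r" for x
        proof -
          \<comment> \<open>The complex line through \<open>y\<close> and \<open>x\<close>. The
            preimage of the ball under it is convex, hence connected, and it contains 0 and
            1.\<close>
          let ?l = "\<lambda>t::complex. y + t *s (x - y)"
          have lin: "bounded_linear (\<lambda>t. t *s v)" for v :: "complex^'a"
          proof -
            have "linear (\<lambda>t. t *s v)" by (rule linearI) (auto simp: vec_eq_iff algebra_simps)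
            then show ?thesis by (simp add: linear_conv_bounded_linear)
          qed
          have cl: "continuous_on UNIV ?l"
            by (intro continuous_intros linear_continuous_on lin)
          have op: "open (?l -` W)" if "open W" for W
            using continuous_open_preimage[OF cl open_UNIV that] by simp
          have conv: "convex (?l -` ball z r)"
          proof (rule convexI)
            fix s t and u v :: real
            assume st: "s \<in> ?l -` ball z r" "t \<in> ?l -` ball z r" and uv: "0 \<le> u" "0 \<le> v" "u + v = 1"
            have "u *\<^sub>R ?l s + v *\<^sub>R ?l t \<in> ball z r"
              using convex_ball[of z r] st uv unfolding convex_def by auto
            moreover have "?l (u *\<^sub>R s + v *\<^sub>R t) = u *\<^sub>R ?l s + v *\<^sub>R ?l t"
            proof -
              have "y = u *\<^sub>R y + v *\<^sub>R y" using uv by (metis scaleR_add_left scaleR_one)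
              moreover have "(u *\<^sub>R s + v *\<^sub>R t) *s (x - y) = u *\<^sub>R (s *s (x - y)) + v *\<^sub>R (t *s (x - y))"
                by (simp add: vec_eq_iff algebra_simps)
              ultimately show ?thesis
                unfolding scaleR_add_right by (metis (no_types, lifting) add.assoc add.left_commute)
            qed
            ultimately show "u *\<^sub>R s + v *\<^sub>R t \<in> ?l -` ball z r" by simp
          qed
          have "g (?l 1) = 0"
          proof (rule analytic_continuation_open[where s="?l -` (V \<inter> ball z r)" and s'="?l -` ball z r"
                and f="\<lambda>t. g (?l t)" and g="\<lambda>t. 0" and z=1])
            show "open (?l -` (V \<inter> ball z r))" "open (?l -` ball z r)" using op V by auto
            have "0 \<in> ?l -` (V \<inter> ball z r)" using V y by simp
            then show "?l -` (V \<inter> ball z r) \<noteq> {}" by blast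
            show "connected (?l -` ball z r)" using conv by (rule convex_connected)
            show "(\<lambda>t. g (?l t)) holomorphic_on ?l -` ball z r"
              by (rule holomorphic_on_subset[OF holo_fun_line(1)[OF g, of y "x - y"]]) (use r in auto)
          qed (use V x in auto)
          then show ?thesis by simp
        qed
        then have "z \<in> A" unfolding A_def using r z by (auto intro!: exI[of _ "ball z r"])
        then show False using z by simp
      qed
      then show "\<exists>e>0. ball z e \<subseteq> S - A" using r by (intro exI[of _ r]) auto
    qed
  moreover have "A \<inter> S \<noteq> {}" using U unfolding A_def by blast
  ultimately have "S - A = {}"
    using connectedD[OF S(2), of A "S - A"] by (auto simp: A_def)
  then show ?thesis using z unfolding A_def by blast
qed

text \<open>Holomorphic functions on a connected open set form an integral domain: otherwise
  \<open>g\<close> would vanish on the nonempty open set where \<open>f\<close> does not, and hence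
  everywhere.\<close>

lemma holo_fun_mult_zero:
  assumes S: "open S" "connected S" and f: "holo_fun f S" and g: "holo_fun g S"
    and nz: "z \<in> S" "f z \<noteq> 0" "w \<in> S" "g w \<noteq> 0"
  shows "\<exists>x\<in>S. f x * g x \<noteq> 0"
proof (rule ccontr)
  assume "\<not> ?thesis"
  then have *: "f x * g x = 0" if "x \<in> S" for x using that by blast
  have "open (S \<inter> f -` (- {0}))"
    by (rule continuous_open_preimage[OF holo_fun_continuous_on[OF f] S(1)]) auto
  then have "g w = 0"
    by (rule holo_fun_identity[OF S g _ _ _ _ nz(3)]) (use * nz in auto)
  then show False using nz by simp
qed

text \<open>Fraction-free Gaussian elimination over the ring of holomorphic functions; the weight
  \<open>g\<close> collects the pivots, away from whose zeros the matrix is assumed degenerate.\<close>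

lemma holo_kernel:
  fixes M :: "'i \<Rightarrow> 'j \<Rightarrow> complex^'d \<Rightarrow> complex"
  assumes S: "open S" "connected S" and J: "finite J"
    and M: "\<And>i j. i \<in> I \<Longrightarrow> j \<in> J \<Longrightarrow> holo_fun (M i j) S"
    and g: "holo_fun g S" "\<exists>z\<in>S. g z \<noteq> 0"
    and dep: "\<And>z. z \<in> S \<Longrightarrow> g z \<noteq> 0 \<Longrightarrow> \<exists>c. (\<exists>j\<in>J. c j \<noteq> 0) \<and> (\<forall>i\<in>I. (\<Sum>j\<in>J. c j * M i j z) = 0)"
  shows "\<exists>a. (\<forall>j\<in>J. holo_fun (a j) S) \<and> (\<exists>j\<in>J. \<exists>z\<in>S. a j z \<noteq> 0) \<and>
     (\<forall>z\<in>S. \<forall>i\<in>I. (\<Sum>j\<in>J. a j z * M i j z) = 0)"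
  using J M g dep
proof (induction J arbitrary: M g rule: finite_induct)
  case empty
  then show ?case by fastforce
next
  case (insert j0 J)
  show ?case
  proof (cases "\<forall>i\<in>I. \<forall>z\<in>S. M i j0 z = 0")
    case True
    obtain z where z: "z \<in> S" using insert.prems by blast
    show ?thesis
    proof (intro exI[of _ "\<lambda>j z. if j = j0 then 1 else 0"] conjI ballI)
      show "holo_fun (\<lambda>z. if j = j0 then 1 else 0) S" for j by simp
      show "\<exists>j\<in>insert j0 J. \<exists>z\<in>S. (if j = j0 then 1 else 0) \<noteq> (0::complex)" using z by auto
      show "(\<Sum>j\<in>insert j0 J. (if j = j0 then 1 else 0) * M i j z) = 0" if "z \<in> S" "i \<in> I" for z i
        using True that insert.hyps by (subst sum.insert) (auto intro!: sum.neutral)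
    qed
  next
    case False
    then obtain i0 z0 where i0: "i0 \<in> I" "z0 \<in> S" "M i0 j0 z0 \<noteq> 0" by blast
    let ?p = "M i0 j0"
    \<comment> \<open>Elimination of column \<open>j0\<close> by row \<open>i0\<close>, multiplied
      by the pivot instead of divided by it.\<close>
    let ?M = "\<lambda>i j z. ?p z * M i j z - M i0 j z * M i j0 z"
    have hp: "holo_fun ?p S" using insert.prems(1)[OF i0(1)] by simp
    have "\<exists>a. (\<forall>j\<in>J. holo_fun (a j) S) \<and> (\<exists>j\<in>J. \<exists>z\<in>S. a j z \<noteq> 0) \<and>
      (\<forall>z\<in>S. \<forall>i\<in>I. (\<Sum>j\<in>J. a j z * ?M i j z) = 0)"
    proof (rule insert.IH[where g="\<lambda>z. g z * ?p z"])
      show "holo_fun (?M i j) S" if "i \<in> I" "j \<in> J" for i j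
        using insert.prems(1) i0 that by (intro holo_fun_diff holo_fun_mult) auto
      show "holo_fun (\<lambda>z. g z * ?p z) S" by (intro holo_fun_mult insert.prems hp)
      obtain z1 where "z1 \<in> S" "g z1 \<noteq> 0" using insert.prems by blast
      then show "\<exists>z\<in>S. g z * ?p z \<noteq> 0"
        using holo_fun_mult_zero[OF S insert.prems(2) hp] i0 by blast
      fix z assume z: "z \<in> S" "g z * ?p z \<noteq> 0"
      then obtain c where c: "\<exists>j\<in>insert j0 J. c j \<noteq> 0" "\<forall>i\<in>I. (\<Sum>j\<in>insert j0 J. c j * M i j z) = 0"
        using insert.prems(4)[of z] by auto
      have sum: "(\<Sum>j\<in>J. c j * M i j z) = - c j0 * M i j0 z" if "i \<in> I" for i
        using c(2) that insert.hyps by (auto simp: add_eq_0_iff2)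
      have "\<exists>j\<in>J. c j \<noteq> 0"
      proof (rule ccontr)
        assume n: "\<not> ?thesis"
        then have "c j0 * ?p z = 0" using sum[OF i0(1)] by simp
        then show False using z n c(1) by auto
      qed
      moreover have "(\<Sum>j\<in>J. c j * ?M i j z) = 0" if "i \<in> I" for i
      proof -
        have "(\<Sum>j\<in>J. c j * ?M i j z) = ?p z * (\<Sum>j\<in>J. c j * M i j z) - (\<Sum>j\<in>J. c j * M i0 j z) * M i j0 z"
          by (simp add: sum_distrib_left sum_distrib_right sum_subtractf algebra_simps)
        then show ?thesis using sum[OF that] sum[OF i0(1)] by simp
      qed
      ultimately show "\<exists>c. (\<exists>j\<in>J. c j \<noteq> 0) \<and> (\<forall>i\<in>I. (\<Sum>j\<in>J. c j * ?M i j z) = 0)" by blast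
    qed
    then obtain a j1 z1 where a: "\<And>j. j \<in> J \<Longrightarrow> holo_fun (a j) S" "j1 \<in> J" "z1 \<in> S" "a j1 z1 \<noteq> 0"
      "\<And>z i. z \<in> S \<Longrightarrow> i \<in> I \<Longrightarrow> (\<Sum>j\<in>J. a j z * ?M i j z) = 0" by blast
    \<comment> \<open>Back substitution without division: the old coefficients are multiplied by the
      pivot, and the one at \<open>j0\<close> is chosen to cancel row \<open>i0\<close>.\<close>
    define b where "b j z = (if j = j0 then - (\<Sum>j\<in>J. a j z * M i0 j z) else a j z * ?p z)" for j z
    have b0: "b j0 = (\<lambda>z. - (\<Sum>j\<in>J. a j z * M i0 j z))" and bj: "j \<in> J \<Longrightarrow> b j = (\<lambda>z. a j z * ?p z)" for j
      using insert.hyps by (auto simp: b_def)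
    show ?thesis
    proof (intro exI[of _ b] conjI ballI)
      fix j assume "j \<in> insert j0 J"
      moreover have "holo_fun (b j0) S"
      proof -
        have "holo_fun (\<lambda>z. (-1) * (\<Sum>j\<in>J. a j z * M i0 j z)) S"
          using a insert.prems(1) i0 by (intro holo_fun_cmult holo_fun_sum holo_fun_mult) auto
        then show ?thesis by (simp add: b0)
      qed
      moreover have "holo_fun (b j) S" if "j \<in> J" for j
        unfolding bj[OF that] by (intro holo_fun_mult a hp that)
      ultimately show "holo_fun (b j) S" by blast
    next
      show "\<exists>j\<in>insert j0 J. \<exists>z\<in>S. b j z \<noteq> 0"
        using holo_fun_mult_zero[OF S a(1)[OF a(2)] hp a(3,4) i0(2,3)] a(2) bj[OF a(2)]
        by (intro bexI[of _ j1]) auto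
    next
      fix z i assume zi: "z \<in> S" "i \<in> I"
      have "(\<Sum>j\<in>insert j0 J. b j z * M i j z) = b j0 z * M i j0 z + (\<Sum>j\<in>J. b j z * M i j z)"
        using insert.hyps by simp
      also have "(\<Sum>j\<in>J. b j z * M i j z) = (\<Sum>j\<in>J. a j z * ?p z * M i j z)"
        by (rule sum.cong) (auto simp: bj)
      also have "b j0 z * M i j0 z + (\<Sum>j\<in>J. a j z * ?p z * M i j z) = (\<Sum>j\<in>J. a j z * ?M i j z)"
        by (simp add: b0 sum_distrib_right sum_distrib_left sum_subtractf algebra_simps)
      finally show "(\<Sum>j\<in>insert j0 J. b j z * M i j z) = 0" using a(5)[OF zi] by simp
    qed
  qed
qed

context proper_holo
begin

text \<open>Write \<open>G\<close> for the divergence of \<open>h\<close> times the field. The field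
  annihilates every function of \<open>\<Phi>\<close> and \<open>dz\<close> annihilates
  \<open>cnj G\<close>, so \<open>cut (\<Phi> z) * (cmod (G z))\<^sup>2\<close> is the divergence of
  \<open>u\<close>. Properness makes the support of \<open>u\<close> compact, hence the integral is
  zero and so is \<open>G\<close>.\<close>

lemma tangent_divergence_zero:
  assumes a: "\<And>k. holo_fun (a k) \<Omega>" and ker: "\<And>z i. z \<in> \<Omega> \<Longrightarrow> (\<Sum>k\<in>UNIV. a k z * dz k (\<lambda>x. \<Phi> x $ i) z) = 0"
    and h: "holo_fun h \<Omega>" and z0: "z0 \<in> \<Omega>"
  shows "(\<Sum>k\<in>UNIV. dz k (\<lambda>x. h x * a k x) z0) = 0"
proof (rule ccontr)
  define G where "G z = (\<Sum>k\<in>UNIV. dz k (\<lambda>x. h x * a k x) z)" for z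
  assume "\<not> ?thesis"
  then have G0: "G z0 \<noteq> 0" by (simp add: G_def)
  have ha: "holo_fun (\<lambda>x. h x * a k x) \<Omega>" for k by (intro holo_fun_mult h a)
  have hG: "holo_fun G \<Omega>"
    unfolding G_def[abs_def] by (intro holo_fun_sum holo_fun_dz_holo \<Omega> ha)
  obtain R where R: "R > 0" "cball (\<Phi> z0) R \<subseteq> \<Omega>'"
    using \<Omega>' \<Phi>_in[OF z0] open_contains_cball by blast
  define cut where "cut = bump_at (\<Phi> z0) R"
  note bump = bump_at[where ?w0.0="\<Phi> z0", OF R(1), folded cut_def]
  let ?L = "{z\<in>\<Omega>. \<Phi> z \<in> cball (\<Phi> z0) R}"
  have L: "compact ?L" by (rule compact_preimage[OF compact_cball R(2)])
  define u where "u k z = (if z \<in> \<Omega> then cnj (G z) * (of_real (cut (\<Phi> z)) * (h z * a k z)) else 0)" for k z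
  have u0: "u k z = 0" if "z \<notin> ?L" for k z
    using that bump(4)[of "\<Phi> z"] by (auto simp: u_def)
  have C1c: "C1_on (\<lambda>z. of_real (cut (\<Phi> z))) \<Omega>"
    by (rule C1_on_compose_holo[OF \<Omega> holo bump(5)])
  have C1u: "C1_on (u k) UNIV" for k
  proof (rule C1_on_extend[OF \<Omega> _ compact_imp_closed[OF L]])
    have "C1_on (\<lambda>z. cnj (G z) * (of_real (cut (\<Phi> z)) * (h z * a k z))) \<Omega>"
      by (intro C1_on_mult C1_on_cnj C1c holo_fun_C1 \<Omega> hG h a)
    then show "C1_on (u k) \<Omega>"
      using C1_on_cong[OF \<Omega>, of "u k" "\<lambda>z. cnj (G z) * (of_real (cut (\<Phi> z)) * (h z * a k z))"] by (simp add: u_def)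
  qed (use u0 in auto)
  have D: "(\<Sum>k\<in>UNIV. dz k (u k) z) = of_real (cut (\<Phi> z) * (cmod (G z))\<^sup>2)" if z: "z \<in> \<Omega>" for z
  proof -
    have d: "(\<lambda>z. cnj (G z)) differentiable (at z)" "(\<lambda>z. of_real (cut (\<Phi> z)) :: complex) differentiable (at z)"
      "(\<lambda>z. h z * a k z) differentiable (at z)" for k
      using C1_on_cnj[OF holo_fun_C1[OF \<Omega> hG]] C1c holo_fun_differentiable[OF ha z] z unfolding C1_on_def by blast+
    have cd: "(\<lambda>w. of_real (cut w) :: complex) differentiable (at (\<Phi> z))"
      using bump(5) by (simp add: C1_on_def)
    have "dz k (u k) z = cnj (G z) * (dz k (\<lambda>z. of_real (cut (\<Phi> z))) z * (h z * a k z) + of_real (cut (\<Phi> z)) * dz k (\<lambda>z. h z * a k z) z)" for k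
    proof -
      have "dz k (u k) z = dz k (\<lambda>z. cnj (G z) * (of_real (cut (\<Phi> z)) * (h z * a k z))) z"
        by (rule dz_local_cong(1)[OF \<Omega> z]) (simp add: u_def)
      also have "\<dots> = cnj (G z) * dz k (\<lambda>z. of_real (cut (\<Phi> z)) * (h z * a k z)) z"
        unfolding dz_mult(1)[OF d(1) differentiable_mult[OF d(2,3)]]
        by (simp add: dz_cnj(1)[OF holo_fun_differentiable[OF hG z]] holo_fun_dzb[OF hG z])
      finally show ?thesis unfolding dz_mult(1)[OF d(2,3)] .
    qed
    then have "(\<Sum>k\<in>UNIV. dz k (u k) z) = cnj (G z) * ((\<Sum>k\<in>UNIV. dz k (\<lambda>z. of_real (cut (\<Phi> z))) z * (h z * a k z)) + of_real (cut (\<Phi> z)) * G z)"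
      by (simp add: G_def sum_distrib_left sum.distrib algebra_simps)
    also have "(\<Sum>k\<in>UNIV. dz k (\<lambda>z. of_real (cut (\<Phi> z))) z * (h z * a k z)) = 
       (\<Sum>k\<in>UNIV. \<Sum>j\<in>UNIV. h z * dz j (\<lambda>w. of_real (cut w)) (\<Phi> z) * (a k z * dz k (\<lambda>x. \<Phi> x $ j) z))"
      unfolding dz_compose_holo[OF cd holo z] by (simp add: sum_distrib_left sum_distrib_right mult_ac)
    also have "\<dots> = (\<Sum>j\<in>UNIV. h z * dz j (\<lambda>w. of_real (cut w)) (\<Phi> z) * (\<Sum>k\<in>UNIV. a k z * dz k (\<lambda>x. \<Phi> x $ j) z))"
      by (subst sum.swap) (simp add: sum_distrib_left)
    also have "\<dots> = 0" using ker[OF z] by simp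
    finally show ?thesis using complex_norm_square[of "G z"] by (simp add: mult_ac)
  qed
  have D0: "dz k (u k) z = 0" if "z \<notin> \<Omega>" for k z
    using frechet_zero_outside(1)[of ?L "u k" z, OF compact_imp_closed[OF L] u0] that by (simp add: dz_def)
  have iu: "integrable lborel (\<lambda>z. dz k (u k) z)" for k
    unfolding dz_def using integrable_frechet[OF C1u L u0] by simp
  define v where "v z = (if z \<in> \<Omega> then cut (\<Phi> z) * (cmod (G z))\<^sup>2 else 0)" for z
  have sv: "(\<Sum>k\<in>UNIV. dz k (u k) z) = of_real (v z)" for z
    using D D0 by (simp add: v_def)
  have iv: "integrable lborel v"
  proof -
    have "integrable lborel (\<lambda>z. \<Sum>k\<in>UNIV. dz k (u k) z)"
      by (intro Bochner_Integration.integrable_sum iu)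
    from integrable_Re[OF this] show ?thesis unfolding sv by simp
  qed
  have "(\<integral>z. complex_of_real (v z) \<partial>lborel) = 0"
    unfolding sv[symmetric] using iu integral_dz_zero(1)[OF C1u L u0]
    by (subst Bochner_Integration.integral_sum) auto
  then have "(\<integral>z. v z \<partial>lborel) = 0" by simp
  moreover have "(\<integral>z. v z \<partial>lborel) > 0"
  proof (rule integral_pos_open[OF \<Omega> z0 _ _ iv])
    have "continuous_on \<Omega> (\<lambda>z. cut (\<Phi> z) * (cmod (G z))\<^sup>2)"
      by (intro continuous_intros holo_fun_continuous_on hG continuous_on_compose2[OF bump(1)[of UNIV] \<Phi>_cont]) auto
    then show "continuous_on \<Omega> v" by (simp add: v_def cong: continuous_on_cong)
    show "0 \<le> v x" for x using bump(2) by (simp add: v_def)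
    show "0 < v z0" using bump(3) G0 z0 by (simp add: v_def cut_def)
  qed
  ultimately show False by simp
qed

text \<open>\<open>h = 1\<close> gives a divergence free field; \<open>h = z $ m\<close> then leaves
  just the component \<open>a m\<close>.\<close>

lemma no_tangent_field:
  assumes a: "\<And>k. holo_fun (a k) \<Omega>" and ker: "\<And>z i. z \<in> \<Omega> \<Longrightarrow> (\<Sum>k\<in>UNIV. a k z * dz k (\<lambda>x. \<Phi> x $ i) z) = 0"
    and z: "z \<in> \<Omega>"
  shows "a m z = 0"
proof -
  have d: "a k differentiable (at z)" for k by (rule holo_fun_differentiable[OF a z])
  have 1: "(\<Sum>k\<in>UNIV. dz k (a k) z) = 0"
    using tangent_divergence_zero[OF a ker holo_fun_const z, of 1] by simp
  have dc: "dz k (\<lambda>x. x $ m) z = (if k = m then 1 else 0)" for k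
    unfolding holo_fun_dz[OF holo_fun_coord[of m \<Omega>] z]
    unfolding frechet_eqI[OF bounded_linear_imp_has_derivative[OF bounded_linear_vec_nth]] by (simp add: axis_def)
  have "dz k (\<lambda>x. x $ m * a k x) z = (if k = m then a k z else 0) + z $ m * dz k (a k) z" for k
    using dz_mult(1)[OF holo_fun_differentiable[OF holo_fun_coord z] d, of k m k] dc by simp
  then have "(\<Sum>k\<in>UNIV. dz k (\<lambda>x. x $ m * a k x) z) = a m z + z $ m * (\<Sum>k\<in>UNIV. dz k (a k) z)"
    by (simp add: sum.distrib sum_distrib_left)
  then show ?thesis using tangent_divergence_zero[OF a ker holo_fun_coord z, of m] 1 by simp
qed

text \<open>If the Jacobian matrix were singular everywhere, elimination with weight 1 would produce
  a nonzero holomorphic field in its kernel.\<close>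

lemma jac_nonzero:
  assumes conn: "connected \<Omega>" and ne: "\<Omega> \<noteq> {}"
  shows "\<exists>z\<in>\<Omega>. jac z \<noteq> 0"
proof (rule ccontr)
  assume "\<not> ?thesis"
  then have j0: "det (jmat z) = 0" if "z \<in> \<Omega>" for z using that unfolding jac_def by metis
  have "\<exists>a. (\<forall>j\<in>UNIV. holo_fun (a j) \<Omega>) \<and> (\<exists>j\<in>UNIV. \<exists>z\<in>\<Omega>. a j z \<noteq> 0) \<and>
     (\<forall>z\<in>\<Omega>. \<forall>i\<in>UNIV. (\<Sum>j\<in>UNIV. a j z * dz j (\<lambda>x. \<Phi> x $ i) z) = 0)"
  proof (rule holo_kernel[OF \<Omega> conn finite, where g="\<lambda>z. 1"])
    show "holo_fun (dz j (\<lambda>x. \<Phi> x $ i)) \<Omega>" for i j by (intro holo_fun_dz_holo \<Omega> holo_coord)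
    fix z assume z: "z \<in> \<Omega>"
    then have "\<not> invertible (jmat z)" using j0 invertible_det_nz by blast
    then have "\<not> (\<exists>B. B ** jmat z = mat 1)" unfolding invertible_left_inverse .
    then obtain x where x: "jmat z *v x = 0" "x \<noteq> 0" unfolding matrix_left_invertible_ker by blast
    have "\<exists>j. x $ j \<noteq> 0" using x(2) by (metis vec_eq_iff zero_index)
    moreover have "(\<Sum>j\<in>UNIV. x $ j * dz j (\<lambda>x. \<Phi> x $ i) z) = 0" for i
      using arg_cong[OF x(1), of "\<lambda>v. v $ i"] by (simp add: matrix_vector_mult_def jmat_def mult.commute)
    ultimately show "\<exists>c. (\<exists>j\<in>UNIV. c j \<noteq> 0) \<and> (\<forall>i\<in>UNIV. (\<Sum>j\<in>UNIV. c j * dz j (\<lambda>x. \<Phi> x $ i) z) = 0)"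
      by blast
  qed (use ne in auto)
  then show False using no_tangent_field by blast
qed

end

subsection \<open>Proper maps of bounded domains and the reducing projection\<close>

text \<open>The derivative is both complex linear and conjugate linear, hence zero.\<close>

lemma holo_cnj_holo_const:
  assumes S: "open S" "connected S" and f: "holo_fun f S" and g: "holo_fun (\<lambda>z. cnj (f z)) S"
    and xy: "x \<in> S" "y \<in> S"
  shows "f x = f y"
proof (rule has_derivative_zero_unique_connected[OF S _ xy])
  fix z assume z: "z \<in> S"
  let ?L = "frechet_derivative f (at z)"
  have "((\<lambda>z. cnj (f z)) has_derivative (\<lambda>v. cnj (?L v))) (at z)"
    using bounded_linear.has_derivative[OF bounded_linear_cnj holo_fun_D(1)[OF f z]] .
  then have "frechet_derivative (\<lambda>z. cnj (f z)) (at z) = (\<lambda>v. cnj (?L v))" by (rule frechet_eqI)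
  then have "cnj (\<i> * ?L v) = \<i> * cnj (?L v)" for v
    using holo_fun_D(2)[OF g z, of \<i> v] holo_fun_D(2)[OF f z, of \<i> v] by simp
  then have "?L v = 0" for v by (simp add: complex_eq_iff)
  then have "?L = (\<lambda>v. 0)" by blast
  then show "(f has_derivative (\<lambda>v. 0)) (at z)" using holo_fun_D(1)[OF f z] by simp
qed

lemma test_fun_mult:
  assumes Y: "open Y" and u: "test_fun u Y" and g: "continuous_on Y g"
  shows "test_fun (\<lambda>w. g w * u w) Y"
proof -
  obtain K where K: "continuous_on UNIV u" "compact K" "K \<subseteq> Y" "\<And>w. w \<notin> K \<Longrightarrow> u w = 0"
    using u unfolding test_fun_def by blast
  have "continuous_on Y (\<lambda>w. g w * u w)"
    by (intro continuous_intros g continuous_on_subset[OF K(1)]) auto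
  moreover have "continuous_on (- K) (\<lambda>w. g w * u w)"
    using K(4) by (subst continuous_on_cong[OF refl, where g="\<lambda>w. 0"]) auto
  ultimately have "continuous_on (Y \<union> - K) (\<lambda>w. g w * u w)"
    using Y compact_imp_closed[OF K(2)] by (intro continuous_on_open_Un) auto
  moreover have "Y \<union> - K = UNIV" using K by auto
  ultimately show ?thesis unfolding test_fun_def using K by auto
qed

lemma test_fun_cnj: "test_fun u Y \<Longrightarrow> test_fun (\<lambda>w. cnj (u w)) Y"
  unfolding test_fun_def by (auto intro!: continuous_intros)

lemma L2_compact_support:
  assumes "compact L" "continuous_on L g" "\<And>z. z \<notin> L \<Longrightarrow> g z = 0"
  shows "L2 g"
proof -
  have "integrable lborel g" by (rule integrable_compact_support[OF assms])
  moreover have "integrable lborel (\<lambda>z. (cmod (g z))\<^sup>2)"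
    by (rule integrable_compact_support[OF assms(1)]) (use assms in \<open>auto intro!: continuous_intros\<close>)
  ultimately show ?thesis unfolding L2_def by auto
qed

text \<open>Zero up to distance \<open>1 / n\<close> from the complement and one from distance
  \<open>2 / n\<close> on; for bounded \<open>Y\<close> the support is therefore compact inside
  \<open>Y\<close>.\<close>

definition cutoff :: "(complex^'d) set \<Rightarrow> nat \<Rightarrow> complex^'d \<Rightarrow> real" where
  "cutoff Y n w = min 1 (max 0 (real n * infdist w (- Y) - 1))"

lemma cutoff:
  assumes Y: "open Y" "bounded Y"
  shows "0 \<le> cutoff Y n w" "cutoff Y n w \<le> 1" "continuous_on S (cutoff Y n)"
    "w \<in> Y \<Longrightarrow> (\<lambda>n. cutoff Y n w) \<longlonglongrightarrow> 1"
    "test_fun (\<lambda>w. of_real (cutoff Y n w)) Y"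
proof -
  show "0 \<le> cutoff Y n w" "cutoff Y n w \<le> 1" by (auto simp: cutoff_def)
  show c: "continuous_on S (cutoff Y n)" for S
    unfolding cutoff_def by (intro continuous_intros)
  \<comment> \<open>\<open>infdist\<close> to the empty set is 0, which would make the cutoff vanish
    identically.\<close>
  have ne: "- Y \<noteq> {}"
  proof
    assume "- Y = {}"
    then have "Y = UNIV" by auto
    then show False using Y(2) not_bounded_UNIV by blast
  qed
  show "(\<lambda>n. cutoff Y n w) \<longlonglongrightarrow> 1" if w: "w \<in> Y"
  proof (rule tendsto_eventually)
    have d: "infdist w (- Y) > 0" using infdist_pos_not_in_closed[of "- Y" w] Y ne w by auto
    obtain N where N: "2 < real N * infdist w (- Y)" using reals_Archimedean3[OF d] by blast
    have "cutoff Y n w = 1" if "n \<ge> N" for n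
    proof -
      have "real N * infdist w (- Y) \<le> real n * infdist w (- Y)"
        using that d by (intro mult_right_mono) auto
      then show ?thesis using N by (simp add: cutoff_def)
    qed
    then show "\<forall>\<^sub>F n in sequentially. cutoff Y n w = 1" unfolding eventually_sequentially by blast
  qed
  let ?K = "{w\<in>closure Y. 1 \<le> real n * infdist w (- Y)}"
  have K: "compact ?K"
  proof -
    have "closed (closure Y \<inter> {w. 1 \<le> real n * infdist w (- Y)})"
      by (intro closed_Int closed_Collect_le continuous_intros) auto
    then have "compact (closure Y \<inter> (closure Y \<inter> {w. 1 \<le> real n * infdist w (- Y)}))"
      using Y(2) by (intro compact_Int_closed) (auto simp: compact_closure)
    then show ?thesis by (simp add: Collect_conj_eq Int_absorb2 inf_left_idem inf.assoc Collect_mem_eq)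
  qed
  have KY: "?K \<subseteq> Y"
  proof
    fix w assume "w \<in> ?K"
    then have "infdist w (- Y) \<noteq> 0" by auto
    then show "w \<in> Y" by (metis ComplI infdist_zero)
  qed
  show "test_fun (\<lambda>w. of_real (cutoff Y n w)) Y"
    unfolding test_fun_def
  proof (intro conjI exI[of _ ?K] allI impI)
    show "complex_of_real (cutoff Y n w) = 0" if w: "w \<notin> ?K" for w
    proof (cases "w \<in> closure Y")
      case True
      then show ?thesis using w by (simp add: cutoff_def)
    next
      case False
      then have "w \<in> - Y" using closure_subset by auto
      then show ?thesis by (simp add: cutoff_def)
    qed
  qed (use K KY c in \<open>auto intro!: continuous_intros\<close>)
qed

locale proper_holo_bounded = proper_holo +
  assumes conn: "connected \<Omega>" "connected \<Omega>'" and ne: "\<Omega> \<noteq> {}"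
    and bdd: "bounded \<Omega>" "bounded \<Omega>'"
begin

abbreviation B where "B \<equiv> bergman_space \<Omega>"

lemma trB:
  assumes "f \<in> B"
  shows "holo_fun (tr f) \<Omega>'"
    and "test_fun u \<Omega>' \<Longrightarrow> (\<integral>z. f z * cnj (jac z) * u (\<Phi> z) \<partial>lborel) = (\<integral>w. tr f w * u w \<partial>lborel)"
    and "test_fun u \<Omega>' \<Longrightarrow> integrable lborel (\<lambda>z. f z * cnj (jac z) * u (\<Phi> z))"
proof -
  have f: "holo_fun f \<Omega>" "\<And>z. z \<notin> \<Omega> \<Longrightarrow> f z = 0"
    using bergman_holo[OF assms] bergman_outside[OF assms] by auto
  show "holo_fun (tr f) \<Omega>'" by (rule tr(1)) (use f in auto)
  show "test_fun u \<Omega>' \<Longrightarrow> (\<integral>z. f z * cnj (jac z) * u (\<Phi> z) \<partial>lborel) = (\<integral>w. tr f w * u w \<partial>lborel)"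
    by (rule tr(2)) (use f in auto)
  show "test_fun u \<Omega>' \<Longrightarrow> integrable lborel (\<lambda>z. f z * cnj (jac z) * u (\<Phi> z))"
    by (rule tr(3)) (use f in auto)
qed

lemma tr_jac:
  shows "holo_fun (tr jac) \<Omega>'"
    and "test_fun u \<Omega>' \<Longrightarrow> (\<integral>z. jac z * cnj (jac z) * u (\<Phi> z) \<partial>lborel) = (\<integral>w. tr jac w * u w \<partial>lborel)"
    and "test_fun u \<Omega>' \<Longrightarrow> integrable lborel (\<lambda>z. jac z * cnj (jac z) * u (\<Phi> z))"
  by (rule tr; simp add: holo_jac jac_outside)+

lemma test_pullback_support:
  assumes "test_fun u \<Omega>'"
  obtains L where "compact L" "L \<subseteq> \<Omega>" "\<And>z. z \<in> \<Omega> \<Longrightarrow> z \<notin> L \<Longrightarrow> u (\<Phi> z) = 0" "continuous_on \<Omega> (\<lambda>z. u (\<Phi> z))"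
proof -
  obtain K where K: "continuous_on UNIV u" "compact K" "K \<subseteq> \<Omega>'" "\<And>w. w \<notin> K \<Longrightarrow> u w = 0"
    using assms unfolding test_fun_def by blast
  show ?thesis
    by (rule that[of "{z\<in>\<Omega>. \<Phi> z \<in> K}"])
      (use compact_preimage[OF K(2,3)] K(4) in \<open>auto intro!: continuous_on_compose2[OF K(1) \<Phi>_cont]\<close>)
qed

text \<open>The density \<open>jac * cnj jac\<close> is real, so \<open>tr jac\<close> and its
  conjugate have the same pairings. Positivity is seen by pairing with a bump around the image of a
  point where \<open>jac\<close> does not vanish.\<close>

lemma tr_jac_const: "\<exists>m>0. \<forall>w\<in>\<Omega>'. tr jac w = of_real m"
proof -
  note J = tr_jac
  have cJ: "continuous_on \<Omega>' (tr jac)" by (rule holo_fun_continuous_on[OF J(1)])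
  have real: "tr jac w = cnj (tr jac w)" if w: "w \<in> \<Omega>'" for w
  proof (rule test_fun_eqI[OF \<Omega>' cJ _ _ w])
    show "continuous_on \<Omega>' (\<lambda>w. cnj (tr jac w))" by (intro continuous_intros cJ)
    fix u assume u: "test_fun u \<Omega>'"
    have "(\<integral>w. cnj (tr jac w) * u w \<partial>lborel) = cnj (\<integral>w. tr jac w * cnj (u w) \<partial>lborel)"
      by (simp flip: Bochner_Integration.integral_cnj)
    also have "\<dots> = cnj (\<integral>z. jac z * cnj (jac z) * cnj (u (\<Phi> z)) \<partial>lborel)"
      using J(2)[OF test_fun_cnj[OF u]] by simp
    also have "\<dots> = (\<integral>z. jac z * cnj (jac z) * u (\<Phi> z) \<partial>lborel)"
      by (simp flip: Bochner_Integration.integral_cnj add: mult_ac)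
    finally show "(\<integral>w. tr jac w * u w \<partial>lborel) = (\<integral>w. cnj (tr jac w) * u w \<partial>lborel)"
      using J(2)[OF u] by simp
  qed
  have "holo_fun (\<lambda>w. cnj (tr jac w)) \<Omega>'"
    by (rule holo_fun_cong[OF \<Omega>' real J(1)])
  note const = holo_cnj_holo_const[OF \<Omega>' conn(2) J(1) this]
  obtain z0 where z0: "z0 \<in> \<Omega>" "jac z0 \<noteq> 0" using jac_nonzero[OF conn(1) ne] by blast
  define w0 where "w0 = \<Phi> z0"
  have w0: "w0 \<in> \<Omega>'" using \<Phi>_in z0 by (simp add: w0_def)
  define m where "m = Re (tr jac w0)"
  have trm: "tr jac w = of_real m" if "w \<in> \<Omega>'" for w
    using const[OF that w0] real[OF w0] by (simp add: m_def complex_eq_iff)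
  obtain R where R: "R > 0" "cball w0 R \<subseteq> \<Omega>'" using \<Omega>' w0 open_contains_cball by blast
  note bump = bump_at[where ?w0.0=w0, OF R(1)]
  have u: "test_fun (\<lambda>w. of_real (bump_at w0 R w)) \<Omega>'"
    using test_fun_bump[OF R, of 1] by simp
  have iJ: "integrable lborel (\<lambda>z. (cmod (jac z))\<^sup>2 * bump_at w0 R (\<Phi> z))"
  proof -
    have "integrable lborel (\<lambda>z. jac z * cnj (jac z) * of_real (bump_at w0 R (\<Phi> z)))"
      by (rule J(3)[OF u])
    moreover have "jac z * cnj (jac z) * of_real (bump_at w0 R (\<Phi> z)) = of_real ((cmod (jac z))\<^sup>2 * bump_at w0 R (\<Phi> z))" for z
      by (simp only: complex_norm_square[symmetric] of_real_mult)
    ultimately have "integrable lborel (\<lambda>z. Re (of_real ((cmod (jac z))\<^sup>2 * bump_at w0 R (\<Phi> z))))"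
      by (intro integrable_Re) simp
    then show ?thesis by simp
  qed
  have "0 < (\<integral>z. (cmod (jac z))\<^sup>2 * bump_at w0 R (\<Phi> z) \<partial>lborel)"
  proof (rule integral_pos_open[OF \<Omega> z0(1) _ _ iJ])
    show "continuous_on \<Omega> (\<lambda>z. (cmod (jac z))\<^sup>2 * bump_at w0 R (\<Phi> z))"
      by (intro continuous_intros holo_fun_continuous_on holo_jac continuous_on_compose2[OF bump(1)[of UNIV] \<Phi>_cont]) auto
    show "0 \<le> (cmod (jac z))\<^sup>2 * bump_at w0 R (\<Phi> z)" for z using bump(2) by simp
    show "0 < (cmod (jac z0))\<^sup>2 * bump_at w0 R (\<Phi> z0)" using z0 bump(3) by (simp add: w0_def)
  qed
  moreover have "complex_of_real (\<integral>z. (cmod (jac z))\<^sup>2 * bump_at w0 R (\<Phi> z) \<partial>lborel) = of_real (m * (\<integral>w. bump_at w0 R w \<partial>lborel))"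
  proof -
    have "complex_of_real (\<integral>z. (cmod (jac z))\<^sup>2 * bump_at w0 R (\<Phi> z) \<partial>lborel) = (\<integral>z. of_real ((cmod (jac z))\<^sup>2 * bump_at w0 R (\<Phi> z)) \<partial>lborel)"
      by (rule integral_complex_of_real[symmetric])
    also have "\<dots> = (\<integral>z. jac z * cnj (jac z) * of_real (bump_at w0 R (\<Phi> z)) \<partial>lborel)"
      by (simp only: complex_norm_square[symmetric] of_real_mult)
    also have "\<dots> = (\<integral>w. tr jac w * of_real (bump_at w0 R w) \<partial>lborel)" by (rule J(2)[OF u])
    also have "\<dots> = (\<integral>w. of_real (m * bump_at w0 R w) \<partial>lborel)"
    proof (rule Bochner_Integration.integral_cong[OF refl])
      show "tr jac w * of_real (bump_at w0 R w) = of_real (m * bump_at w0 R w)" for w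
        using trm[of w] R(2) bump(4)[of w] by (cases "w \<in> cball w0 R") auto
    qed
    finally show ?thesis by simp
  qed
  ultimately have "0 < m * (\<integral>w. bump_at w0 R w \<partial>lborel)" by (simp only: of_real_eq_iff)
  moreover have "0 \<le> (\<integral>w. bump_at w0 R w \<partial>lborel)"
    by (rule Bochner_Integration.integral_nonneg) (use bump(2) in auto)
  ultimately have "m > 0" by (simp add: zero_less_mult_iff)
  then show ?thesis using trm by blast
qed

text \<open>\<open>tr f\<close> is formally a sum of \<open>f / jac\<close> over preimages, so
  \<open>tr jac\<close> counts them.\<close>

definition map_degree :: real where "map_degree = (SOME m. m > 0 \<and> (\<forall>w\<in>\<Omega>'. tr jac w = of_real m))"

lemma map_degree: "map_degree > 0" "w \<in> \<Omega>' \<Longrightarrow> tr jac w = of_real map_degree"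
  using someI_ex[OF tr_jac_const[unfolded Bex_def]] tr_jac_const unfolding map_degree_def
  by (metis (mono_tags, lifting) someI_ex)+

text \<open>The change of variables formula for a covering with \<open>map_degree\<close> sheets,
  obtained from the trace of \<open>jac\<close>.\<close>

lemma jac_sq_pairing:
  assumes u: "test_fun u \<Omega>'"
  shows "(\<integral>z. of_real ((cmod (jac z))\<^sup>2) * u (\<Phi> z) \<partial>lborel) = of_real map_degree * (\<integral>w. u w \<partial>lborel)"
proof -
  have "(\<integral>z. of_real ((cmod (jac z))\<^sup>2) * u (\<Phi> z) \<partial>lborel) = (\<integral>z. jac z * cnj (jac z) * u (\<Phi> z) \<partial>lborel)"
    by (simp only: complex_norm_square)
  also have "\<dots> = (\<integral>w. tr jac w * u w \<partial>lborel)" by (rule tr_jac(2)[OF u])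
  also have "\<dots> = (\<integral>w. of_real map_degree * u w \<partial>lborel)"
  proof (rule Bochner_Integration.integral_cong[OF refl])
    show "tr jac w * u w = of_real map_degree * u w" for w
      using map_degree(2)[of w] u unfolding test_fun_def by (cases "w \<in> \<Omega>'") (force, metis mult_zero_right subsetD)
  qed
  finally show ?thesis by simp
qed

section \<open>The trace operator as an element of the algebra\<close>

text \<open>Formally the sum over the sheets of \<open>\<Phi>\<close> of the pullbacks of
  \<open>f\<close>, taken as the coefficient of a holomorphic form of top degree; this accounts for
  the factor \<open>jac\<close>.\<close>

definition trace_op :: "(complex^'a \<Rightarrow> complex) \<Rightarrow> complex^'a \<Rightarrow> complex" where
  "trace_op f z = jac z * tr f (\<Phi> z)"

abbreviation cf where "cf n w \<equiv> cutoff \<Omega>' n w"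
lemmas cf = cutoff[OF \<Omega>' bdd(2)]

lemma trace_op_holo: "f \<in> B \<Longrightarrow> holo_fun (trace_op f) \<Omega>"
  unfolding trace_op_def[abs_def]
  by (intro holo_fun_mult holo_jac holo_fun_compose[OF trB(1) holo]) (use \<Phi>_in in auto)

lemma trace_op_outside: "z \<notin> \<Omega> \<Longrightarrow> trace_op f z = 0" by (simp add: trace_op_def jac_def)

text \<open>A self-improving estimate. Pushing down and lifting back once turns the integral
  \<open>I\<close> into \<open>map_degree\<close> times the inner product of \<open>f\<close> and
  \<open>g\<close>, where \<open>g\<close> is the cut-off \<open>trace_op f\<close>. Since the
  cutoff is at most 1, the norm of \<open>g\<close> is at most \<open>sqrt I\<close>, and
  \<open>I\<close> is finite thanks to the compact support, so one factor \<open>sqrt I\<close> can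
  be divided out.\<close>

lemma trace_op_cut_bound:
  assumes f: "f \<in> B"
  shows "integrable lborel (\<lambda>z. (cmod (trace_op f z))\<^sup>2 * cf n (\<Phi> z))"
    and "(\<integral>z. (cmod (trace_op f z))\<^sup>2 * cf n (\<Phi> z) \<partial>lborel) \<le> (map_degree * berg_norm f)\<^sup>2"
proof -
  let ?F = "tr f"
  have cF: "continuous_on \<Omega>' ?F" by (rule holo_fun_continuous_on[OF trB(1)[OF f]])
  have cTf: "continuous_on \<Omega> (trace_op f)" by (rule holo_fun_continuous_on[OF trace_op_holo[OF f]])
  obtain L where L: "compact L" "L \<subseteq> \<Omega>" "\<And>z. z \<in> \<Omega> \<Longrightarrow> z \<notin> L \<Longrightarrow> complex_of_real (cf n (\<Phi> z)) = 0"
    "continuous_on \<Omega> (\<lambda>z. complex_of_real (cf n (\<Phi> z)))"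
    using test_pullback_support[OF cf(5)] by blast
  have cc: "continuous_on \<Omega> (\<lambda>z. cf n (\<Phi> z))"
    by (intro continuous_on_compose2[OF cf(3)[of UNIV] \<Phi>_cont]) auto
  define I where "I = (\<integral>z. (cmod (trace_op f z))\<^sup>2 * cf n (\<Phi> z) \<partial>lborel)"
  show int: "integrable lborel (\<lambda>z. (cmod (trace_op f z))\<^sup>2 * cf n (\<Phi> z))"
  proof (rule integrable_compact_support[OF L(1)])
    show "continuous_on L (\<lambda>z. (cmod (trace_op f z))\<^sup>2 * cf n (\<Phi> z))"
      by (intro continuous_intros continuous_on_subset[OF cTf L(2)] continuous_on_subset[OF cc L(2)])
    show "(cmod (trace_op f z))\<^sup>2 * cf n (\<Phi> z) = 0" if "z \<notin> L" for z
      using L(3)[of z] that trace_op_outside[of z f] by (cases "z \<in> \<Omega>") auto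
  qed
  define g where "g z = trace_op f z * of_real (cf n (\<Phi> z))" for z
  have gL2: "L2 g"
  proof (rule L2_compact_support[OF L(1)])
    show "continuous_on L g" unfolding g_def
      by (intro continuous_intros continuous_on_subset[OF cTf L(2)] continuous_on_subset[OF cc L(2)])
    show "g z = 0" if "z \<notin> L" for z
      using L(3)[of z] that trace_op_outside[of z f] by (cases "z \<in> \<Omega>") (auto simp: g_def)
  qed
  have gn: "(berg_norm g)\<^sup>2 \<le> I"
    unfolding berg_norm_sq I_def
  proof (rule integral_mono[OF _ int])
    show "integrable lborel (\<lambda>z. (cmod (g z))\<^sup>2)" using gL2 by (simp add: L2_def)
    fix z
    have "(cf n (\<Phi> z))\<^sup>2 \<le> cf n (\<Phi> z)"
      using cf(1,2)[of n "\<Phi> z"] by (simp add: power2_eq_square mult_left_le)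
    then show "(cmod (g z))\<^sup>2 \<le> (cmod (trace_op f z))\<^sup>2 * cf n (\<Phi> z)"
      by (simp add: g_def norm_mult power_mult_distrib mult_left_mono)
  qed
  let ?u = "\<lambda>w. cnj (?F w) * of_real (cf n w)"
  have u: "test_fun ?u \<Omega>'" by (intro test_fun_mult \<Omega>' cf(5) continuous_intros cF)
  have u2: "test_fun (\<lambda>w. ?F w * ?u w) \<Omega>'" by (intro test_fun_mult \<Omega>' u cF)
  have "complex_of_real I = (\<integral>z. of_real ((cmod (trace_op f z))\<^sup>2 * cf n (\<Phi> z)) \<partial>lborel)"
    unfolding I_def by (rule integral_complex_of_real[symmetric])
  also have "\<dots> = (\<integral>z. of_real ((cmod (jac z))\<^sup>2) * (?F (\<Phi> z) * ?u (\<Phi> z)) \<partial>lborel)"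
    unfolding trace_op_def norm_mult power_mult_distrib of_real_mult mult.assoc[symmetric] complex_norm_square[of "tr f _"] ..
  also have "\<dots> = of_real map_degree * (\<integral>w. ?F w * ?u w \<partial>lborel)" by (rule jac_sq_pairing[OF u2])
  also have "(\<integral>w. ?F w * ?u w \<partial>lborel) = (\<integral>z. f z * cnj (jac z) * ?u (\<Phi> z) \<partial>lborel)"
    using trB(2)[OF f u] by simp
  also have "\<dots> = berg_inner f g"
    unfolding berg_inner_def g_def trace_op_def by (simp add: mult_ac)
  \<comment> \<open>The inner product is a priori complex, so moduli are compared; the sign is
    settled by \<open>I \<ge> 0\<close>.\<close>
  finally have "I = map_degree * cmod (berg_inner f g) \<or> I = - (map_degree * cmod (berg_inner f g))"
    using map_degree(1) by (metis abs_eq_iff abs_of_pos norm_mult norm_of_real abs_mult abs_of_nonneg norm_ge_zero)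
  moreover have "I \<ge> 0" unfolding I_def by (rule Bochner_Integration.integral_nonneg) (use cf(1) in auto)
  moreover have "map_degree * cmod (berg_inner f g) \<ge> 0" using map_degree(1) by simp
  ultimately have "I = map_degree * cmod (berg_inner f g)" by linarith
  also have "\<dots> \<le> map_degree * (berg_norm f * berg_norm g)"
    using map_degree(1) berg_Cauchy_Schwarz[OF bergman_L2[OF \<Omega> f] gL2] by (intro mult_left_mono) auto
  also have "\<dots> \<le> map_degree * (berg_norm f * sqrt I)"
    using map_degree(1) gn by (intro mult_left_mono) (auto intro: real_le_rsqrt)
  finally have *: "I \<le> (map_degree * berg_norm f) * sqrt I" by simp
  show "I \<le> (map_degree * berg_norm f)\<^sup>2"
  proof (cases "I = 0")
    case False
    then have I: "sqrt I > 0" using \<open>I \<ge> 0\<close> by simp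
    have "sqrt I * sqrt I \<le> (map_degree * berg_norm f) * sqrt I" using * \<open>I \<ge> 0\<close> by simp
    then have "sqrt I \<le> map_degree * berg_norm f" by (rule mult_right_le_imp_le[OF _ I])
    then have "(sqrt I)\<^sup>2 \<le> (map_degree * berg_norm f)\<^sup>2" using I by (intro power_mono) auto
    then show ?thesis using \<open>I \<ge> 0\<close> by simp
  qed simp
qed

text \<open>The bound on the cut-off integrals is uniform in \<open>n\<close>, so Fatou removes the
  cutoff.\<close>

lemma trace_op_bergman:
  assumes f: "f \<in> B"
  shows "trace_op f \<in> B" "berg_norm (trace_op f) \<le> map_degree * berg_norm f"
proof -
  have lim: "(\<lambda>n. (cmod (trace_op f z))\<^sup>2 * cf n (\<Phi> z)) \<longlonglongrightarrow> (cmod (trace_op f z))\<^sup>2" for z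
  proof (cases "z \<in> \<Omega>")
    case True
    show ?thesis using tendsto_mult[OF tendsto_const cf(4)[OF \<Phi>_in[OF True]]] by fastforce
  qed (simp add: trace_op_outside)
  note b = integrable_limit_bound[OF trace_op_cut_bound(1)[OF f] _ lim trace_op_cut_bound(2)[OF f]]
  have b1: "integrable lborel (\<lambda>z. (cmod (trace_op f z))\<^sup>2)" "(\<integral>z. (cmod (trace_op f z))\<^sup>2 \<partial>lborel) \<le> (map_degree * berg_norm f)\<^sup>2"
    using b cf(1) by auto
  have "L2 (trace_op f)" unfolding L2_def using b1(1) holo_measurable[OF \<Omega> trace_op_holo[OF f] trace_op_outside] by blast
  then show "trace_op f \<in> B" by (intro bergman_I \<Omega> trace_op_holo f trace_op_outside)
  show "berg_norm (trace_op f) \<le> map_degree * berg_norm f"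
    by (rule power2_le_imp_le) (use b1(2) map_degree(1) in \<open>auto simp: berg_norm_sq\<close>)
qed

text \<open>On the target the form is visibly Hermitian in \<open>f\<close> and \<open>g\<close>. It
  appears as a limit because the pairing with traces is available for compactly supported test
  functions.\<close>

lemma trace_op_inner_limit:
  assumes f: "f \<in> B" and g: "g \<in> B"
  shows "(\<lambda>n. \<integral>w. tr f w * cnj (tr g w) * of_real (cf n w) \<partial>lborel) \<longlonglongrightarrow> berg_inner (trace_op f) g"
proof -
  have cF: "continuous_on \<Omega>' (tr f)" by (rule holo_fun_continuous_on[OF trB(1)[OF f]])
  have i: "integrable lborel (\<lambda>z. trace_op f z * cnj (g z))"
    by (intro L2_prod bergman_L2[OF \<Omega>] trace_op_bergman f g)
  have "(\<lambda>n. \<integral>z. trace_op f z * cnj (g z) * of_real (cf n (\<Phi> z)) \<partial>lborel) \<longlonglongrightarrow> (\<integral>z. trace_op f z * cnj (g z) \<partial>lborel)"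
  proof (rule integral_dominated_convergence[where w="\<lambda>z. cmod (trace_op f z * cnj (g z))"])
    show "(\<lambda>z. trace_op f z * cnj (g z)) \<in> borel_measurable lborel" using i by auto
    show "(\<lambda>z. trace_op f z * cnj (g z) * of_real (cf n (\<Phi> z))) \<in> borel_measurable lborel" for n
    proof -
      have "(\<lambda>z. indicator \<Omega> z *\<^sub>R (trace_op f z * cnj (g z) * of_real (cf n (\<Phi> z)))) \<in> borel_measurable borel"
        by (intro borel_measurable_continuous_on_indicator continuous_intros holo_fun_continuous_on trace_op_holo f bergman_holo[OF g]
            continuous_on_compose2[OF cf(3)[of UNIV] \<Phi>_cont]) (use \<Omega> in auto)
      moreover have "(\<lambda>z. indicator \<Omega> z *\<^sub>R (trace_op f z * cnj (g z) * of_real (cf n (\<Phi> z)))) = (\<lambda>z. trace_op f z * cnj (g z) * of_real (cf n (\<Phi> z)))"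
        by (auto simp: indicator_def trace_op_outside)
      ultimately show ?thesis by simp
    qed
    show "AE z in lborel. (\<lambda>n. trace_op f z * cnj (g z) * of_real (cf n (\<Phi> z))) \<longlonglongrightarrow> trace_op f z * cnj (g z)"
    proof (rule AE_I2)
      fix z
      show "(\<lambda>n. trace_op f z * cnj (g z) * of_real (cf n (\<Phi> z))) \<longlonglongrightarrow> trace_op f z * cnj (g z)"
      proof (cases "z \<in> \<Omega>")
        case True
        show ?thesis
          using tendsto_mult[OF tendsto_const[of "trace_op f z * cnj (g z)"] tendsto_of_real[OF cf(4)[OF \<Phi>_in[OF True]]]] by simp
      qed (simp add: trace_op_outside)
    qed
    show "AE z in lborel. norm (trace_op f z * cnj (g z) * of_real (cf n (\<Phi> z))) \<le> cmod (trace_op f z * cnj (g z))" for n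
      using cf(1,2) by (intro AE_I2) (simp add: norm_mult mult_left_le)
  qed (use i in auto)
  moreover have "(\<integral>z. trace_op f z * cnj (g z) * of_real (cf n (\<Phi> z)) \<partial>lborel) = (\<integral>w. tr f w * cnj (tr g w) * of_real (cf n w) \<partial>lborel)" for n
  proof -
    let ?u = "\<lambda>w. cnj (tr f w) * of_real (cf n w)"
    have u: "test_fun ?u \<Omega>'" by (intro test_fun_mult \<Omega>' cf(5) continuous_intros cF)
    have "(\<integral>z. trace_op f z * cnj (g z) * of_real (cf n (\<Phi> z)) \<partial>lborel) = cnj (\<integral>z. g z * cnj (jac z) * ?u (\<Phi> z) \<partial>lborel)"
      unfolding trace_op_def by (simp flip: Bochner_Integration.integral_cnj add: mult_ac)
    also have "\<dots> = cnj (\<integral>w. tr g w * ?u w \<partial>lborel)" using trB(2)[OF g u] by simp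
    also have "\<dots> = (\<integral>w. tr f w * cnj (tr g w) * of_real (cf n w) \<partial>lborel)"
      by (simp flip: Bochner_Integration.integral_cnj add: mult_ac)
    finally show ?thesis .
  qed
  ultimately show ?thesis by (simp add: berg_inner_def)
qed

lemma trace_op_selfadjoint:
  assumes f: "f \<in> B" and g: "g \<in> B"
  shows "berg_inner (trace_op f) g = berg_inner f (trace_op g)"
proof -
  have "(\<lambda>n. cnj (\<integral>w. tr g w * cnj (tr f w) * of_real (cf n w) \<partial>lborel)) \<longlonglongrightarrow> cnj (berg_inner (trace_op g) f)"
    by (intro tendsto_cnj trace_op_inner_limit f g)
  moreover have "cnj (\<integral>w. tr g w * cnj (tr f w) * of_real (cf n w) \<partial>lborel) = (\<integral>w. tr f w * cnj (tr g w) * of_real (cf n w) \<partial>lborel)" for n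
    by (simp flip: Bochner_Integration.integral_cnj add: mult_ac)
  ultimately have "berg_inner (trace_op f) g = cnj (berg_inner (trace_op g) f)"
    using LIMSEQ_unique[OF trace_op_inner_limit[OF f g]] by simp
  then show ?thesis using berg_inner_commute[of f "trace_op g"] by simp
qed

lemma tr_eqI:
  assumes f: "f \<in> B" and G: "continuous_on \<Omega>' G" and w: "w \<in> \<Omega>'"
    and eq: "\<And>u. test_fun u \<Omega>' \<Longrightarrow> (\<integral>z. f z * cnj (jac z) * u (\<Phi> z) \<partial>lborel) = (\<integral>w. G w * u w \<partial>lborel)"
  shows "tr f w = G w"
  by (rule test_fun_eqI[OF \<Omega>' holo_fun_continuous_on[OF trB(1)[OF f]] G _ w])
    (simp add: eq flip: trB(2)[OF f])

lemma tr_lincomb: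
  assumes f: "f \<in> B" and g: "g \<in> B" and w: "w \<in> \<Omega>'"
  shows "tr (\<lambda>z. a * f z + b * g z) w = a * tr f w + b * tr g w"
proof (rule tr_eqI[OF bergman_lincomb[OF \<Omega> f g] _ w])
  have c: "continuous_on \<Omega>' (tr f)" "continuous_on \<Omega>' (tr g)"
    by (intro holo_fun_continuous_on trB f g)+
  then show "continuous_on \<Omega>' (\<lambda>w. a * tr f w + b * tr g w)" by (intro continuous_intros)
  fix u assume u: "test_fun u \<Omega>'"
  have i: "integrable lborel (\<lambda>z. f z * cnj (jac z) * u (\<Phi> z))" "integrable lborel (\<lambda>z. g z * cnj (jac z) * u (\<Phi> z))"
    by (intro trB f g u)+
  have i2: "integrable lborel (\<lambda>w. tr f w * u w)" "integrable lborel (\<lambda>w. tr g w * u w)"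
    using integrable_test_mult[OF c(1) u] integrable_test_mult[OF c(2) u] .
  have "(\<integral>z. (a * f z + b * g z) * cnj (jac z) * u (\<Phi> z) \<partial>lborel)
    = (\<integral>z. a * (f z * cnj (jac z) * u (\<Phi> z)) + b * (g z * cnj (jac z) * u (\<Phi> z)) \<partial>lborel)"
    by (simp add: algebra_simps)
  also have "\<dots> = a * (\<integral>w. tr f w * u w \<partial>lborel) + b * (\<integral>w. tr g w * u w \<partial>lborel)"
    using i trB(2)[OF f u] trB(2)[OF g u] by simp
  also have "\<dots> = (\<integral>w. a * (tr f w * u w) + b * (tr g w * u w) \<partial>lborel)"
    using i2 by simp
  finally show "(\<integral>z. (a * f z + b * g z) * cnj (jac z) * u (\<Phi> z) \<partial>lborel) = (\<integral>w. (a * tr f w + b * tr g w) * u w \<partial>lborel)"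
    by (simp add: algebra_simps)
qed

lemma \<Phi>_coord_bound: "\<exists>M\<ge>0. \<forall>z\<in>\<Omega>. \<forall>j. cmod (\<Phi> z $ j) \<le> M"
proof -
  obtain M where M: "\<And>w. w \<in> \<Omega>' \<Longrightarrow> norm w \<le> M" using bdd(2) unfolding bounded_iff by blast
  have "cmod (\<Phi> z $ j) \<le> \<bar>M\<bar>" if "z \<in> \<Omega>" for z j
    using M[OF \<Phi>_in[OF that]] Finite_Cartesian_Product.norm_nth_le[of "\<Phi> z" j] by linarith
  then show ?thesis by (intro exI[of _ "\<bar>M\<bar>"]) auto
qed

lemma mult_\<Phi>_bergman: "f \<in> B \<Longrightarrow> mult_op \<Omega> (\<lambda>z. \<Phi> z $ j) f \<in> B"
  using mult_op_bergman(1)[OF \<Omega> holo_coord] \<Phi>_coord_bound by blast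

lemma adj_\<Phi>:
  assumes "g \<in> B"
  shows "mult_adj \<Omega> (\<lambda>z. \<Phi> z $ j) g \<in> B"
    "f \<in> B \<Longrightarrow> berg_inner (mult_op \<Omega> (\<lambda>z. \<Phi> z $ j) f) g = berg_inner f (mult_adj \<Omega> (\<lambda>z. \<Phi> z $ j) g)"
proof -
  obtain M where "\<And>z. z \<in> \<Omega> \<Longrightarrow> cmod (\<Phi> z $ j) \<le> M" using \<Phi>_coord_bound by blast
  from mult_adj[OF \<Omega> holo_coord this assms]
  show "mult_adj \<Omega> (\<lambda>z. \<Phi> z $ j) g \<in> B"
    "f \<in> B \<Longrightarrow> berg_inner (mult_op \<Omega> (\<lambda>z. \<Phi> z $ j) f) g = berg_inner f (mult_adj \<Omega> (\<lambda>z. \<Phi> z $ j) g)" by blast+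
qed

text \<open>A factor \<open>\<Phi> z $ j\<close> upstairs can be absorbed into the test function as
  \<open>w $ j\<close>, so it passes through the trace.\<close>

lemma trace_op_mult:
  assumes f: "f \<in> B"
  shows "trace_op (mult_op \<Omega> (\<lambda>z. \<Phi> z $ j) f) = mult_op \<Omega> (\<lambda>z. \<Phi> z $ j) (trace_op f)"
proof
  fix z
  let ?g = "mult_op \<Omega> (\<lambda>z. \<Phi> z $ j) f"
  have g: "?g \<in> B" by (rule mult_\<Phi>_bergman[OF f])
  have cF: "continuous_on \<Omega>' (tr f)" by (rule holo_fun_continuous_on[OF trB(1)[OF f]])
  have "tr ?g w = w $ j * tr f w" if w: "w \<in> \<Omega>'" for w
  proof (rule tr_eqI[OF g _ w])
    show "continuous_on \<Omega>' (\<lambda>w. w $ j * tr f w)" by (intro continuous_intros cF)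
    fix u assume u: "test_fun u \<Omega>'"
    have u': "test_fun (\<lambda>w. w $ j * u w) \<Omega>'" by (intro test_fun_mult \<Omega>' u continuous_intros)
    have "(\<integral>z. ?g z * cnj (jac z) * u (\<Phi> z) \<partial>lborel) = (\<integral>z. f z * cnj (jac z) * (\<Phi> z $ j * u (\<Phi> z)) \<partial>lborel)"
      by (rule Bochner_Integration.integral_cong) (auto simp: mult_op_def bergman_outside[OF f])
    also have "\<dots> = (\<integral>w. tr f w * (w $ j * u w) \<partial>lborel)" by (rule trB(2)[OF f u'])
    finally show "(\<integral>z. ?g z * cnj (jac z) * u (\<Phi> z) \<partial>lborel) = (\<integral>w. w $ j * tr f w * u w \<partial>lborel)"
      by (simp add: mult_ac)
  qed
  then show "trace_op ?g z = mult_op \<Omega> (\<lambda>z. \<Phi> z $ j) (trace_op f) z"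
    using \<Phi>_in[of z] by (cases "z \<in> \<Omega>") (auto simp: trace_op_def mult_op_def jac_def)
qed

text \<open>Commutation with the adjoints follows from self-adjointness and commutation with the
  multiplications.\<close>

lemma trace_op_in_vN: "trace_op \<in> vN_alg \<Phi> \<Omega>"
proof -
  have lin: "trace_op (\<lambda>z. a * f z + b * g z) = (\<lambda>z. a * trace_op f z + b * trace_op g z)" if "f \<in> B" "g \<in> B" for f g a b
  proof
    fix z
    show "trace_op (\<lambda>z. a * f z + b * g z) z = a * trace_op f z + b * trace_op g z"
      using tr_lincomb[OF that \<Phi>_in, of z a b]
      by (cases "z \<in> \<Omega>") (auto simp: trace_op_def jac_def algebra_simps)
  qed
  have "bounded_op \<Omega> trace_op" unfolding bounded_op_def using trace_op_bergman lin by blast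
  moreover have "trace_op (mult_adj \<Omega> (\<lambda>z. \<Phi> z $ j) f) = mult_adj \<Omega> (\<lambda>z. \<Phi> z $ j) (trace_op f)" if f: "f \<in> B" for j f
  proof (rule bergman_inner_eqI[OF \<Omega>])
    let ?M = "mult_op \<Omega> (\<lambda>z. \<Phi> z $ j)" and ?A = "mult_adj \<Omega> (\<lambda>z. \<Phi> z $ j)"
    show "trace_op (?A f) \<in> B" "?A (trace_op f) \<in> B" by (intro trace_op_bergman adj_\<Phi> f)+
    fix g assume g: "g \<in> B"
    have "berg_inner g (trace_op (?A f)) = berg_inner (trace_op g) (?A f)"
      by (rule trace_op_selfadjoint[symmetric]) (intro g adj_\<Phi> f)+
    also have "\<dots> = berg_inner (?M (trace_op g)) f" by (rule adj_\<Phi>(2)[OF f trace_op_bergman(1)[OF g], symmetric])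
    also have "\<dots> = berg_inner (trace_op (?M g)) f" by (simp only: trace_op_mult[OF g])
    also have "\<dots> = berg_inner (?M g) (trace_op f)" by (rule trace_op_selfadjoint[OF mult_\<Phi>_bergman[OF g] f])
    also have "\<dots> = berg_inner g (?A (trace_op f))" by (rule adj_\<Phi>(2)[OF trace_op_bergman(1)[OF f] g])
    finally show "berg_inner g (trace_op (?A f)) = berg_inner g (?A (trace_op f))" .
  qed
  ultimately show ?thesis unfolding vN_alg_def using trace_op_mult by blast
qed

lemma bounded_holo_bergman:
  assumes f: "holo_fun f \<Omega>" and f0: "\<And>z. z \<notin> \<Omega> \<Longrightarrow> f z = 0" and b: "\<And>z. z \<in> \<Omega> \<Longrightarrow> cmod (f z) \<le> M"
  shows "f \<in> B"
proof (rule bergman_I[OF \<Omega> f f0])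
  have m: "f \<in> borel_measurable lborel" by (rule holo_measurable[OF \<Omega> f f0])
  have i: "integrable lborel (\<lambda>z. indicator \<Omega> z *\<^sub>R M\<^sup>2)"
    using emeasure_bounded_finite[OF bdd(1)] \<Omega> by (intro integrable_scaleR_left integrable_real_indicator) auto
  have "integrable lborel (\<lambda>z. (cmod (f z))\<^sup>2)"
  proof (rule Bochner_Integration.integrable_bound[OF i])
    show "(\<lambda>z. (cmod (f z))\<^sup>2) \<in> borel_measurable lborel" using m by measurable
    have "(cmod (f z))\<^sup>2 \<le> indicator \<Omega> z *\<^sub>R M\<^sup>2" for z
      using b[of z] f0[of z] by (cases "z \<in> \<Omega>") (auto intro!: power_mono)
    then show "AE z in lborel. norm ((cmod (f z))\<^sup>2) \<le> norm (indicator \<Omega> z *\<^sub>R M\<^sup>2)" by simp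
  qed
  then show "L2 f" using m by (simp add: L2_def)
qed

text \<open>\<open>jac\<close> may be unbounded, but its squared norm is at most
  \<open>map_degree\<close> times the volume of the bounded target, by the pairing with cutoffs and
  Fatou.\<close>

lemma jac_bergman: "jac \<in> B"
proof (rule bergman_I[OF \<Omega> holo_jac jac_outside])
  have m: "jac \<in> borel_measurable lborel" by (rule holo_measurable[OF \<Omega> holo_jac jac_outside])
  let ?u = "\<lambda>n z. (cmod (jac z))\<^sup>2 * cf n (\<Phi> z)"
  have i: "integrable lborel (?u n)" for n
  proof -
    have "integrable lborel (\<lambda>z. jac z * cnj (jac z) * of_real (cf n (\<Phi> z)))"
      by (rule tr_jac(3)[OF cf(5)])
    moreover have "jac z * cnj (jac z) * of_real (cf n (\<Phi> z)) = of_real (?u n z)" for z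
      by (simp only: complex_norm_square[symmetric] of_real_mult)
    ultimately have "integrable lborel (\<lambda>z. Re (of_real (?u n z)))"
      by (intro integrable_Re) simp
    then show ?thesis by simp
  qed
  have iO: "integrable lborel (\<lambda>w. indicator \<Omega>' w :: real)"
    using emeasure_bounded_finite[OF bdd(2)] \<Omega>' by (intro integrable_real_indicator) auto
  have ic: "integrable lborel (\<lambda>w. cf n w)" for n
  proof -
    have "integrable lborel (\<lambda>w. 1 * complex_of_real (cf n w))"
      by (rule integrable_test_mult[OF continuous_on_const cf(5)])
    from integrable_Re[OF this] show ?thesis by simp
  qed
  have b: "(\<integral>z. ?u n z \<partial>lborel) \<le> map_degree * (\<integral>w. indicator \<Omega>' w \<partial>lborel)" for n
  proof -
    have "complex_of_real (\<integral>z. ?u n z \<partial>lborel) = (\<integral>z. of_real ((cmod (jac z))\<^sup>2) * of_real (cf n (\<Phi> z)) \<partial>lborel)"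
      unfolding of_real_mult[symmetric] by (rule integral_complex_of_real[symmetric])
    also have "\<dots> = of_real (map_degree * (\<integral>w. cf n w \<partial>lborel))"
      unfolding jac_sq_pairing[OF cf(5)] by simp
    finally have "(\<integral>z. ?u n z \<partial>lborel) = map_degree * (\<integral>w. cf n w \<partial>lborel)" by (simp only: of_real_eq_iff)
    also have "\<dots> \<le> map_degree * (\<integral>w. indicator \<Omega>' w \<partial>lborel)"
    proof (intro mult_left_mono integral_mono ic iO)
      show "cf n w \<le> indicator \<Omega>' w" for w
        using cf(2) by (cases "w \<in> \<Omega>'") (auto simp: cutoff_def infdist_zero)
    qed (use map_degree(1) in simp)
    finally show ?thesis .
  qed
  have lim: "(\<lambda>n. ?u n z) \<longlonglongrightarrow> (cmod (jac z))\<^sup>2" for z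
  proof (cases "z \<in> \<Omega>")
    case True
    show ?thesis using tendsto_mult[OF tendsto_const cf(4)[OF \<Phi>_in[OF True]]] by fastforce
  qed (simp add: jac_outside)
  have "integrable lborel (\<lambda>z. (cmod (jac z))\<^sup>2)"
    using integrable_limit_bound(1)[OF i _ lim b] cf(1) by auto
  then show "L2 jac" using m by (simp add: L2_def)
qed

text \<open>By properness a point outside the image has a whole ball outside it. A bump on that ball
  pulls back to zero, whereas \<open>jac_sq_pairing\<close> gives it the integral
  \<open>map_degree\<close> times its positive mass.\<close>

lemma \<Phi>_surj: "\<Phi> ` \<Omega> = \<Omega>'"
proof
  show "\<Phi> ` \<Omega> \<subseteq> \<Omega>'" using \<Phi>_in by auto
  show "\<Omega>' \<subseteq> \<Phi> ` \<Omega>"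
  proof
    fix w0 assume w0: "w0 \<in> \<Omega>'"
    show "w0 \<in> \<Phi> ` \<Omega>"
    proof (rule ccontr)
      assume n: "w0 \<notin> \<Phi> ` \<Omega>"
      obtain r where r: "r > 0" "cball w0 r \<subseteq> \<Omega>'" using \<Omega>' w0 open_contains_cball by blast
      let ?L = "{z\<in>\<Omega>. \<Phi> z \<in> cball w0 r}"
      have "compact (\<Phi> ` ?L)"
        by (intro compact_continuous_image continuous_on_subset[OF \<Phi>_cont] compact_preimage r) auto
      then have "open (- (\<Phi> ` ?L))" by (simp add: compact_imp_closed open_Compl)
      moreover have "w0 \<in> - (\<Phi> ` ?L)" using n by auto
      ultimately obtain s where s: "s > 0" "cball w0 s \<subseteq> - (\<Phi> ` ?L)" using open_contains_cball by blast
      define R where "R = min r s"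
      have R: "R > 0" "cball w0 R \<subseteq> \<Omega>'" using r s by (auto simp: R_def)
      have avoid: "\<Phi> z \<notin> cball w0 R" if "z \<in> \<Omega>" for z using s(2) that by (auto simp: R_def)
      note bump = bump_at[where ?w0.0=w0, OF R(1)]
      have u: "test_fun (\<lambda>w. of_real (bump_at w0 R w)) \<Omega>'"
        using test_fun_bump[OF R, of 1] by simp
      have "(cmod (jac z))\<^sup>2 * bump_at w0 R (\<Phi> z) = 0" for z
        using bump(4)[OF avoid] jac_outside[of z] by (cases "z \<in> \<Omega>") auto
      then have z0: "of_real ((cmod (jac z))\<^sup>2) * complex_of_real (bump_at w0 R (\<Phi> z)) = 0" for z
        by (metis of_real_0 of_real_mult)
      have "of_real map_degree * (\<integral>w. complex_of_real (bump_at w0 R w) \<partial>lborel) = 0"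
        using jac_sq_pairing[OF u] unfolding z0 by simp
      then have "(\<integral>w. bump_at w0 R w \<partial>lborel) = 0" using map_degree(1) by simp
      moreover have "(\<integral>w. bump_at w0 R w \<partial>lborel) > 0"
      proof (rule integral_pos_open[OF \<Omega>' w0 bump(1,2) _ bump(3)])
        have "integrable lborel (\<lambda>w. 1 * complex_of_real (bump_at w0 R w))"
          by (rule integrable_test_mult[OF continuous_on_const u])
        from integrable_Re[OF this] show "integrable lborel (bump_at w0 R)" by simp
      qed
      ultimately show False by simp
    qed
  qed
qed

lemma vN_trivial_imp_biholomorphic:
  assumes triv: "vN_trivial \<Phi> \<Omega>"
  shows "biholomorphic \<Phi> \<Omega> \<Omega>'"
proof -
  obtain c where c: "\<And>f. f \<in> B \<Longrightarrow> trace_op f = (\<lambda>z. c * f z)"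
    using triv trace_op_in_vN unfolding vN_trivial_def by blast
  obtain z0 where z0: "z0 \<in> \<Omega>" "jac z0 \<noteq> 0" using jac_nonzero[OF conn(1) ne] by blast
  \<comment> \<open>\<open>jac\<close> is an eigenvector of \<open>trace_op\<close> with eigenvalue
    \<open>map_degree\<close>, which makes the scalar nonzero.\<close>
  have "jac z0 * of_real map_degree = c * jac z0"
    using fun_cong[OF c[OF jac_bergman], of z0] map_degree(2)[OF \<Phi>_in[OF z0(1)]] by (simp add: trace_op_def)
  then have c0: "c \<noteq> 0" using z0 map_degree(1) by auto
  define e where "e z = (if z \<in> \<Omega> then 1 else 0 :: complex)" for z
  define x where "x k z = (if z \<in> \<Omega> then z $ k else 0)" for k and z :: "complex^'a"
  have e: "e \<in> B"
    by (rule bounded_holo_bergman[where M=1]) (use holo_fun_cong[OF \<Omega>, of "\<lambda>z. 1" e] in \<open>auto simp: e_def\<close>)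
  have x: "x k \<in> B" for k
  proof -
    obtain M where M: "\<And>z. z \<in> \<Omega> \<Longrightarrow> norm z \<le> M" using bdd(1) unfolding bounded_iff by blast
    show ?thesis
    proof (rule bounded_holo_bergman[where M=M])
      show "holo_fun (x k) \<Omega>" using holo_fun_cong[OF \<Omega>, of "\<lambda>z. z $ k" "x k"] by (auto simp: x_def)
      show "cmod (x k z) \<le> M" if "z \<in> \<Omega>" for z
        using M[OF that] Finite_Cartesian_Product.norm_nth_le[of z k] that by (simp add: x_def)
    qed (simp add: x_def)
  qed
  have e1: "jac z * tr e (\<Phi> z) = c" and x1: "jac z * tr (x k) (\<Phi> z) = c * z $ k" if "z \<in> \<Omega>" for z k
    using fun_cong[OF c[OF e], of z] fun_cong[OF c[OF x[of k]], of z] that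
    by (auto simp: trace_op_def e_def x_def)
  have tre: "tr e w \<noteq> 0" if "w \<in> \<Omega>'" for w
  proof -
    obtain z where z: "z \<in> \<Omega>" "w = \<Phi> z" using \<Phi>_surj \<open>w \<in> \<Omega>'\<close> by blast
    then show ?thesis using e1[OF z(1)] c0 by auto
  qed
  \<comment> \<open>The quotient cancels both \<open>c\<close> and \<open>jac\<close>, the latter
    being nonzero throughout because its product with \<open>tr e (\<Phi> z)\<close> is
    \<open>c\<close>.\<close>
  define G where "G w = (\<chi> k. tr (x k) w * inverse (tr e w))" for w
  have G\<Phi>: "G (\<Phi> z) = z" if z: "z \<in> \<Omega>" for z
  proof -
    have j: "jac z \<noteq> 0" using e1[OF z] c0 by auto
    have "tr (x k) (\<Phi> z) * inverse (tr e (\<Phi> z)) = z $ k" for k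
    proof -
      have "tr e (\<Phi> z) = c / jac z" "tr (x k) (\<Phi> z) = c * z $ k / jac z"
        using e1[OF z] x1[OF z, of k] j by (auto simp: field_simps)
      then show ?thesis using j c0 by simp
    qed
    then show ?thesis by (simp add: G_def vec_eq_iff)
  qed
  have "holo_map G \<Omega>'"
    unfolding holo_map_def G_def using tre
    by (auto intro!: holo_fun_mult holo_fun_inverse trB e x)
  moreover have "G w \<in> \<Omega> \<and> \<Phi> (G w) = w" if w: "w \<in> \<Omega>'" for w
  proof -
    obtain z where z: "z \<in> \<Omega>" "w = \<Phi> z" using \<Phi>_surj w by blast
    then show ?thesis using G\<Phi>[OF z(1)] by simp
  qed
  moreover have "bij_betw \<Phi> \<Omega> \<Omega>'"
    unfolding bij_betw_def using \<Phi>_surj G\<Phi> by (metis inj_onI)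
  ultimately show ?thesis unfolding biholomorphic_def using holo G\<Phi> by blast
qed

end

subsection \<open>Operators in the algebra of an injective map\<close>

text \<open>Generated one coordinate factor at a time, so that inductions apply one operator
  \<open>mult_op\<close> per step.\<close>

inductive_set monomials :: "(complex^'d \<Rightarrow> complex) set" where
  one: "(\<lambda>w. 1) \<in> monomials"
| mult: "p \<in> monomials \<Longrightarrow> (\<lambda>w. w $ j * p w) \<in> monomials"

context proper_holo_bounded
begin

definition annih :: "(complex^'a \<Rightarrow> complex) \<Rightarrow> bool" where
  "annih D \<longleftrightarrow> integrable lborel D \<and> (\<forall>z. z \<notin> \<Omega> \<longrightarrow> D z = 0) \<and>
     (\<forall>p\<in>monomials. \<forall>q\<in>monomials. (\<integral>z. p (\<Phi> z) * cnj (q (\<Phi> z)) * D z \<partial>lborel) = 0)"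

lemma annihD:
  assumes "annih D"
  shows "integrable lborel D" "z \<notin> \<Omega> \<Longrightarrow> D z = 0"
    "p \<in> monomials \<Longrightarrow> q \<in> monomials \<Longrightarrow> (\<integral>z. p (\<Phi> z) * cnj (q (\<Phi> z)) * D z \<partial>lborel) = 0"
  using assms unfolding annih_def by blast+

lemma continuous_bounded_mult_integrable:
  assumes g: "continuous_on UNIV g" and D: "integrable lborel D" "\<And>z. z \<notin> \<Omega> \<Longrightarrow> D z = (0::complex)"
  shows "integrable lborel (\<lambda>z. g (\<Phi> z) * D z)"
proof -
  have "compact (closure \<Omega>')" using bdd(2) by (simp add: compact_closure)
  then have "bounded (g ` closure \<Omega>')"
    using compact_continuous_image[OF continuous_on_subset[OF g]] compact_imp_bounded by blast
  then obtain M where M: "\<And>w. w \<in> closure \<Omega>' \<Longrightarrow> cmod (g w) \<le> M" unfolding bounded_iff by blast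
  have eq: "(\<lambda>z. g (\<Phi> z) * D z) = (\<lambda>z. (indicator \<Omega> z *\<^sub>R g (\<Phi> z)) * D z)"
    using D(2) by (auto simp: indicator_def)
  have m: "(\<lambda>z. indicator \<Omega> z *\<^sub>R g (\<Phi> z)) \<in> borel_measurable borel"
    using \<Omega> by (intro borel_measurable_continuous_on_indicator continuous_on_compose2[OF g \<Phi>_cont]) auto
  show ?thesis
    unfolding eq
  proof (rule Bochner_Integration.integrable_bound[where f="\<lambda>z. M * cmod (D z)"])
    show "(\<lambda>z. (indicator \<Omega> z *\<^sub>R g (\<Phi> z)) * D z) \<in> borel_measurable lborel"
      using m D(1) by (intro borel_measurable_times) auto
    have "cmod ((indicator \<Omega> z *\<^sub>R g (\<Phi> z)) * D z) \<le> M * cmod (D z)" for z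
      using M[of "\<Phi> z"] D(2)[of z] \<Phi>_in[of z] closure_subset
      by (cases "z \<in> \<Omega>") (auto simp: norm_mult intro!: mult_right_mono)
    then show "AE z in lborel. norm ((indicator \<Omega> z *\<^sub>R g (\<Phi> z)) * D z) \<le> norm (M * cmod (D z))"
      by (intro AE_I2) (metis abs_ge_self order_trans real_norm_def)
  qed (use D in simp)
qed

lemma mono_cont: "p \<in> monomials \<Longrightarrow> continuous_on UNIV p"
  by (induction rule: monomials.induct) (auto intro!: continuous_intros)

lemma annih_coord:
  assumes D: "annih D"
  shows "annih (\<lambda>z. \<Phi> z $ j * D z)" "annih (\<lambda>z. cnj (\<Phi> z $ j) * D z)"
proof -
  have Di: "integrable lborel D" and D0: "\<And>z. z \<notin> \<Omega> \<Longrightarrow> D z = 0" using D unfolding annih_def by blast+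
  have i: "integrable lborel (\<lambda>z. \<Phi> z $ j * D z)" "integrable lborel (\<lambda>z. cnj (\<Phi> z $ j) * D z)"
    by (rule continuous_bounded_mult_integrable[OF _ Di D0]; simp add: continuous_intros)
      (rule continuous_bounded_mult_integrable[where g="\<lambda>w. cnj (w $ j)", OF _ Di D0]; auto intro!: continuous_intros)
  have a: "(\<integral>z. p (\<Phi> z) * cnj (q (\<Phi> z)) * (\<Phi> z $ j * D z) \<partial>lborel) = 0" if "p \<in> monomials" "q \<in> monomials" for p q
  proof -
    have "(\<integral>z. (\<Phi> z $ j * p (\<Phi> z)) * cnj (q (\<Phi> z)) * D z \<partial>lborel) = 0"
      using annihD(3)[OF D monomials.mult[OF that(1)] that(2)] .
    then show ?thesis by (simp add: mult_ac)
  qed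
  have b: "(\<integral>z. p (\<Phi> z) * cnj (q (\<Phi> z)) * (cnj (\<Phi> z $ j) * D z) \<partial>lborel) = 0" if "p \<in> monomials" "q \<in> monomials" for p q
  proof -
    have "(\<integral>z. p (\<Phi> z) * cnj (\<Phi> z $ j * q (\<Phi> z)) * D z \<partial>lborel) = 0"
      using annihD(3)[OF D that(1) monomials.mult[OF that(2)]] .
    then show ?thesis by (simp add: mult_ac)
  qed
  show "annih (\<lambda>z. \<Phi> z $ j * D z)" "annih (\<lambda>z. cnj (\<Phi> z $ j) * D z)"
    unfolding annih_def using i a b D0 by auto
qed

lemma annih_add: 
  assumes "annih D" "annih E"
  shows "annih (\<lambda>z. D z + E z)"
proof -
  have i: "integrable lborel (\<lambda>z. p (\<Phi> z) * cnj (q (\<Phi> z)) * D z)" if "annih D" "p \<in> monomials" "q \<in> monomials" for p q D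
    using that unfolding annih_def
    by (intro continuous_bounded_mult_integrable[where g="\<lambda>w. p w * cnj (q w)"] continuous_intros mono_cont) auto
  show ?thesis
    using assms i[OF assms(1)] i[OF assms(2)] unfolding annih_def by (simp add: distrib_left)
qed

lemma annih_cmult: "annih D \<Longrightarrow> annih (\<lambda>z. c * D z)"
proof -
  assume D: "annih D"
  have "(\<integral>z. p (\<Phi> z) * cnj (q (\<Phi> z)) * (c * D z) \<partial>lborel) = c * (\<integral>z. p (\<Phi> z) * cnj (q (\<Phi> z)) * D z \<partial>lborel)" for p q
    by (simp add: mult_ac flip: integral_mult_right_zero)
  then show ?thesis using D unfolding annih_def by simp
qed

lemma annih_zero: "annih (\<lambda>z. 0)" by (simp add: annih_def)

lemma annih_sum: "finite A \<Longrightarrow> (\<And>i. i \<in> A \<Longrightarrow> annih (D i)) \<Longrightarrow> annih (\<lambda>z. \<Sum>i\<in>A. D i z)"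
  by (induction A rule: finite_induct) (auto intro: annih_zero annih_add)

text \<open>A real linear form is a combination of coordinates and their conjugates, and
  annihilation is stable under multiplication by either. \<open>D\<close> is general because a
  product of polynomials is handled by one multiplication after the other.\<close>

lemma annih_real_polynomial:
  assumes "real_polynomial_function r" "annih D"
  shows "annih (\<lambda>z. of_real (r (\<Phi> z)) * D z)"
  using assms
proof (induction arbitrary: D rule: real_polynomial_function.induct)
  case (linear r)
  have r: "linear r" using linear(1) by (rule bounded_linear.linear)
  have "linear (\<lambda>w. complex_of_real (r w))"
  proof (rule linearI)
    show "complex_of_real (r (c *\<^sub>R b)) = c *\<^sub>R complex_of_real (r b)" for c b
      unfolding linear_cmul[OF r] by (simp add: scaleR_conv_of_real)
  qed (simp add: linear_add[OF r])
  note dec = real_linear_decomp[OF this]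
  have "annih (\<lambda>z. \<Sum>j\<in>UNIV. (complex_of_real (r (axis j 1)) - \<i> * of_real (r (axis j \<i>))) / 2 * (\<Phi> z $ j * D z)
       + (complex_of_real (r (axis j 1)) + \<i> * of_real (r (axis j \<i>))) / 2 * (cnj (\<Phi> z $ j) * D z))"
    by (intro annih_sum annih_add annih_cmult annih_coord linear finite)
  moreover have "of_real (r (\<Phi> z)) * D z = (\<Sum>j\<in>UNIV. (complex_of_real (r (axis j 1)) - \<i> * of_real (r (axis j \<i>))) / 2 * (\<Phi> z $ j * D z)
       + (complex_of_real (r (axis j 1)) + \<i> * of_real (r (axis j \<i>))) / 2 * (cnj (\<Phi> z $ j) * D z))" for z
    unfolding dec[of "\<Phi> z"] sum_distrib_right by (rule sum.cong[OF refl]) (simp only: distrib_right mult.assoc)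
  ultimately show ?case by simp
next
  case (const c)
  then show ?case by (rule annih_cmult)
next
  case (add r s)
  then show ?case using annih_add[OF add.IH(1)[OF add.prems] add.IH(2)[OF add.prems]] by (simp add: distrib_right)
next
  case (mult r s)
  then show ?case using mult.IH(1)[OF mult.IH(2)[OF mult.prems]] by (simp add: mult.assoc)
qed

text \<open>Stone-Weierstrass on the compact closure of the bounded target, with error at most
  \<open>e\<close> times the integral of \<open>cmod (D z)\<close>.\<close>

lemma annih_continuous:
  assumes D: "annih D" and u: "continuous_on UNIV (u :: complex^'a \<Rightarrow> real)"
  shows "(\<integral>z. of_real (u (\<Phi> z)) * D z \<partial>lborel) = 0"
proof -
  have Di: "integrable lborel D" and D0: "\<And>z. z \<notin> \<Omega> \<Longrightarrow> D z = 0" using D unfolding annih_def by blast+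
  define A where "A = (\<integral>z. cmod (D z) \<partial>lborel)"
  have i: "integrable lborel (\<lambda>z. of_real (u (\<Phi> z)) * D z)"
    by (rule continuous_bounded_mult_integrable[where g="\<lambda>w. of_real (u w)", OF _ Di D0])
      (auto intro!: continuous_intros u)
  have "cmod (\<integral>z. of_real (u (\<Phi> z)) * D z \<partial>lborel) \<le> e * A" if e: "e > 0" for e
  proof -
    have K: "compact (closure \<Omega>')" using bdd(2) by (simp add: compact_closure)
    obtain r where r: "real_polynomial_function r" "\<And>w. w \<in> closure \<Omega>' \<Longrightarrow> \<bar>u w - r w\<bar> < e"
      using Stone_Weierstrass_real_polynomial_function[OF K continuous_on_subset[OF u] e] by auto
    have a: "annih (\<lambda>z. of_real (r (\<Phi> z)) * D z)" by (rule annih_real_polynomial[OF r(1) D])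
    then have ir: "integrable lborel (\<lambda>z. of_real (r (\<Phi> z)) * D z)" unfolding annih_def by blast
    have "(\<integral>z. of_real (r (\<Phi> z)) * D z \<partial>lborel) = 0"
      using a monomials.one unfolding annih_def by fastforce
    then have "(\<integral>z. of_real (u (\<Phi> z)) * D z \<partial>lborel) = (\<integral>z. of_real (u (\<Phi> z)) * D z - of_real (r (\<Phi> z)) * D z \<partial>lborel)"
      using i ir by simp
    also have "cmod \<dots> \<le> (\<integral>z. e * cmod (D z) \<partial>lborel)"
    proof (rule Bochner_Integration.integral_norm_bound_integral)
      show "cmod (of_real (u (\<Phi> z)) * D z - of_real (r (\<Phi> z)) * D z) \<le> e * cmod (D z)" for z
      proof (cases "z \<in> \<Omega>")
        case True
        then have "\<bar>u (\<Phi> z) - r (\<Phi> z)\<bar> \<le> e" using r(2)[of "\<Phi> z"] \<Phi>_in closure_subset by (meson less_imp_le subsetD)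
        then show ?thesis
          unfolding left_diff_distrib[symmetric] norm_mult of_real_diff[symmetric] norm_of_real by (rule mult_right_mono) simp
      qed (use D0 in simp)
    qed (use i ir Di in auto)
    finally show ?thesis by (simp add: A_def)
  qed
  moreover have "A \<ge> 0" unfolding A_def by (rule Bochner_Integration.integral_nonneg) simp
  ultimately have "cmod (\<integral>z. of_real (u (\<Phi> z)) * D z \<partial>lborel) \<le> 0" using nonpos_if_le_eps_mult by blast
  then show ?thesis by simp
qed

text \<open>A continuous left inverse lets functions of \<open>\<Phi>\<close> localise on the
  source: a small ball around \<open>\<Phi> z0\<close> pulls back into the set where
  \<open>D\<close> has positive real part relative to \<open>D z0\<close>.\<close>

lemma annih_injective_zero:
  assumes D: "annih D" and c: "continuous_on \<Omega> D"
    and G: "continuous_on \<Omega>' G" "\<And>z. z \<in> \<Omega> \<Longrightarrow> G (\<Phi> z) = z" and z0: "z0 \<in> \<Omega>"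
  shows "D z0 = 0"
proof (rule ccontr)
  assume n: "D z0 \<noteq> 0"
  have Di: "integrable lborel D" and D0: "\<And>z. z \<notin> \<Omega> \<Longrightarrow> D z = 0" using D unfolding annih_def by blast+
  define h where "h z = Re (cnj (D z0) * D z)" for z
  have h: "continuous_on \<Omega> h" unfolding h_def by (intro continuous_intros c)
  have h0: "h z0 > 0"
    using n unfolding h_def mult.commute[of "cnj (D z0)"] complex_norm_square[symmetric] Re_complex_of_real by simp
  have oU: "open (\<Omega> \<inter> h -` {0<..})" by (rule continuous_open_preimage[OF h \<Omega> open_greaterThan])
  have "open (\<Omega>' \<inter> G -` (\<Omega> \<inter> h -` {0<..}))" by (rule continuous_open_preimage[OF G(1) \<Omega>' oU])
  moreover have "\<Phi> z0 \<in> \<Omega>' \<inter> G -` (\<Omega> \<inter> h -` {0<..})" using z0 h0 \<Phi>_in G(2)[OF z0] by auto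
  ultimately obtain R where R: "R > 0" "cball (\<Phi> z0) R \<subseteq> \<Omega>' \<inter> G -` (\<Omega> \<inter> h -` {0<..})"
    using open_contains_cball by blast
  note bump = bump_at[where ?w0.0="\<Phi> z0", OF R(1)]
  let ?b = "bump_at (\<Phi> z0) R"
  have i: "integrable lborel (\<lambda>z. of_real (?b (\<Phi> z)) * D z)"
    by (rule continuous_bounded_mult_integrable[where g="\<lambda>w. of_real (?b w)", OF _ Di D0])
      (auto intro!: continuous_intros bump)
  have Re: "Re (cnj (D z0) * (of_real (?b (\<Phi> z)) * D z)) = ?b (\<Phi> z) * h z" for z
    by (simp add: h_def algebra_simps)
  have i2: "integrable lborel (\<lambda>z. cnj (D z0) * (of_real (?b (\<Phi> z)) * D z))" using i by simp
  have e0: "(\<integral>z. cnj (D z0) * (of_real (?b (\<Phi> z)) * D z) \<partial>lborel) = 0"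
    using annih_continuous[OF D bump(1)] by simp
  have "(\<integral>z. ?b (\<Phi> z) * h z \<partial>lborel) = 0"
    using integral_Re[OF i2] unfolding Re e0 by simp
  moreover have "(\<integral>z. ?b (\<Phi> z) * h z \<partial>lborel) > 0"
  proof (rule integral_pos_open[OF \<Omega> z0])
    show "continuous_on \<Omega> (\<lambda>z. ?b (\<Phi> z) * h z)"
      by (intro continuous_intros h continuous_on_compose2[OF bump(1)[of UNIV] \<Phi>_cont]) auto
    show "0 \<le> ?b (\<Phi> z) * h z" for z
    proof (cases "z \<in> \<Omega> \<and> \<Phi> z \<in> cball (\<Phi> z0) R")
      case True
      then have "h (G (\<Phi> z)) > 0" using R(2) by blast
      then show ?thesis using True G(2) bump(2) by simp
    next
      case False
      then show ?thesis using bump(4)[of "\<Phi> z"] D0[of z] by (auto simp: h_def)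
    qed
    show "integrable lborel (\<lambda>z. ?b (\<Phi> z) * h z)" using integrable_Re[OF i2] unfolding Re .
    show "0 < ?b (\<Phi> z0) * h z0" using h0 bump(3) by simp
  qed
  ultimately show False by simp
qed

lemma biholomorphic_imp_vN_trivial:
  assumes bi: "biholomorphic \<Phi> \<Omega> \<Omega>'"
  shows "vN_trivial \<Phi> \<Omega>"
  unfolding vN_trivial_def
proof
  fix S assume S: "S \<in> vN_alg \<Phi> \<Omega>"
  obtain G where G: "holo_map G \<Omega>'" "\<And>z. z \<in> \<Omega> \<Longrightarrow> G (\<Phi> z) = z"
    using bi unfolding biholomorphic_def by blast
  have cG: "continuous_on \<Omega>' G" by (rule holo_map_continuous_on[OF G(1)])
  have SB: "S f \<in> B" if "f \<in> B" for f
    using S that unfolding vN_alg_def bounded_op_def by blast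
  have Slin: "S (\<lambda>z. a * f z + b * g z) = (\<lambda>z. a * S f z + b * S g z)" if "f \<in> B" "g \<in> B" for a b f g
    using S that unfolding vN_alg_def bounded_op_def by blast
  obtain C where C: "\<And>f. f \<in> B \<Longrightarrow> berg_norm (S f) \<le> C * berg_norm f"
    using S unfolding vN_alg_def bounded_op_def by blast
  let ?M = "\<lambda>j. mult_op \<Omega> (\<lambda>z. \<Phi> z $ j)" and ?A = "\<lambda>j. mult_adj \<Omega> (\<lambda>z. \<Phi> z $ j)"
  have SM: "S (?M j f) = ?M j (S f)" and SA: "S (?A j f) = ?A j (S f)" if "f \<in> B" for j f
    using S that unfolding vN_alg_def by blast+
  define e where "e z = (if z \<in> \<Omega> then 1 else 0 :: complex)" for z
  have e: "e \<in> B"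
    by (rule bounded_holo_bergman[where M=1]) (use holo_fun_cong[OF \<Omega>, of "\<lambda>z. 1" e] in \<open>auto simp: e_def\<close>)
  \<comment> \<open>The adjoint of \<open>S\<close> applied to 1, obtained from Riesz without
    constructing the adjoint operator.\<close>
  obtain h where h: "h \<in> B" "\<And>f. f \<in> B \<Longrightarrow> berg_inner (S f) e = berg_inner f h"
  proof (rule bergman_Riesz[OF \<Omega>, of "\<lambda>f. berg_inner (S f) e" "C * berg_norm e"])
    fix f g a b assume fg: "f \<in> B" "g \<in> B"
    show "berg_inner (S (\<lambda>z. a * f z + b * g z)) e = a * berg_inner (S f) e + b * berg_inner (S g) e"
      unfolding Slin[OF fg] by (intro berg_inner_lincomb_left bergman_L2[OF \<Omega>] SB fg e)
  next
    fix f assume f: "f \<in> B"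
    have "cmod (berg_inner (S f) e) \<le> berg_norm (S f) * berg_norm e"
      by (intro berg_Cauchy_Schwarz bergman_L2[OF \<Omega>] SB f e)
    also have "\<dots> \<le> (C * berg_norm f) * berg_norm e" using C[OF f] by (intro mult_right_mono) auto
    finally show "cmod (berg_inner (S f) e) \<le> C * berg_norm e * berg_norm f" by (simp add: mult_ac)
  qed blast
  define ml where "ml p f z = (if z \<in> \<Omega> then p (\<Phi> z) * f z else 0)" for p f :: "complex^'a \<Rightarrow> complex" and z
  have ml_one: "ml (\<lambda>w. 1) f = f" if "f \<in> B" for f
    using bergman_outside[OF that] by (auto simp: ml_def)
  have ml_mult: "ml (\<lambda>w. w $ j * p w) f = ?M j (ml p f)" for j p f
    by (auto simp: ml_def mult_op_def)
  have mlB: "ml p f \<in> B" if "p \<in> monomials" "f \<in> B" for p f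
    using that by (induction rule: monomials.induct) (simp_all add: ml_one ml_mult mult_\<Phi>_bergman)
  have Sml: "S (ml p f) = ml p (S f)" if "p \<in> monomials" "f \<in> B" for p f
    using that
  proof (induction rule: monomials.induct)
    case (mult p j)
    then show ?case using SM[OF mlB[OF mult.hyps mult.prems]] by (simp add: ml_mult)
  qed (simp add: ml_one SB)
  \<comment> \<open>A factor \<open>?M j\<close> is moved across as \<open>?A j\<close>, passes
    through \<open>S\<close>, and returns as a factor on \<open>h\<close>. \<open>f\<close> is
    general because the induction hypothesis is used at \<open>?A j f\<close>.\<close>
  have adj: "berg_inner (S f) (ml q e) = berg_inner f (ml q h)" if "q \<in> monomials" "f \<in> B" for q f
    using that
  proof (induction arbitrary: f rule: monomials.induct)
    case (mult q j)
    have "berg_inner (S f) (ml (\<lambda>w. w $ j * q w) e) = cnj (berg_inner (?M j (ml q e)) (S f))"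
      unfolding ml_mult by (rule berg_inner_commute)
    also have "\<dots> = cnj (berg_inner (ml q e) (?A j (S f)))"
      by (simp add: adj_\<Phi>(2)[OF SB[OF mult.prems] mlB[OF mult.hyps e]])
    also have "\<dots> = berg_inner (S (?A j f)) (ml q e)"
      unfolding SA[OF mult.prems] by (rule berg_inner_commute[symmetric])
    also have "\<dots> = berg_inner (?A j f) (ml q h)" by (rule mult.IH[OF adj_\<Phi>(1)[OF mult.prems]])
    also have "\<dots> = cnj (berg_inner (ml q h) (?A j f))" by (rule berg_inner_commute)
    also have "\<dots> = cnj (berg_inner (?M j (ml q h)) f)"
      by (simp add: adj_\<Phi>(2)[OF mult.prems mlB[OF mult.hyps h(1)]])
    also have "\<dots> = berg_inner f (ml (\<lambda>w. w $ j * q w) h)"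
      unfolding ml_mult by (rule berg_inner_commute[symmetric])
    finally show ?case .
  qed (simp add: ml_one e h)
  have key: "S f z = f z * cnj (h z)" if f: "f \<in> B" and z: "z \<in> \<Omega>" for f z
  proof -
    let ?D = "\<lambda>z. S f z * cnj (e z) - f z * cnj (h z)"
    have i: "integrable lborel (\<lambda>z. S f z * cnj (e z))" "integrable lborel (\<lambda>z. f z * cnj (h z))"
      by (intro L2_prod bergman_L2[OF \<Omega>] SB f e h)+
    have "annih ?D"
      unfolding annih_def
    proof (intro conjI allI impI ballI)
      show "integrable lborel ?D" using i by simp
      show "?D z = 0" if "z \<notin> \<Omega>" for z using bergman_outside[OF f that] by (simp add: e_def that)
      fix p q :: "complex^'a \<Rightarrow> complex"
      assume pq: "p \<in> monomials" "q \<in> monomials"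
      have "(\<integral>z. p (\<Phi> z) * cnj (q (\<Phi> z)) * ?D z \<partial>lborel)
        = (\<integral>z. ml p (S f) z * cnj (ml q e z) - ml p f z * cnj (ml q h z) \<partial>lborel)"
      proof (rule Bochner_Integration.integral_cong[OF refl])
        show "p (\<Phi> z) * cnj (q (\<Phi> z)) * ?D z = ml p (S f) z * cnj (ml q e z) - ml p f z * cnj (ml q h z)" for z
          using bergman_outside[OF f, of z] by (cases "z \<in> \<Omega>") (auto simp: ml_def e_def algebra_simps)
      qed
      also have "\<dots> = berg_inner (ml p (S f)) (ml q e) - berg_inner (ml p f) (ml q h)"
        unfolding berg_inner_def
        by (rule Bochner_Integration.integral_diff) (intro L2_prod bergman_L2[OF \<Omega>] mlB SB f e h pq)+
      also have "\<dots> = 0"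
        using adj[OF pq(2) mlB[OF pq(1) f]] by (simp add: Sml[OF pq(1) f])
      finally show "(\<integral>z. p (\<Phi> z) * cnj (q (\<Phi> z)) * ?D z \<partial>lborel) = 0" .
    qed
    moreover have "continuous_on \<Omega> ?D"
      by (intro continuous_intros holo_fun_continuous_on bergman_holo SB f e h)
    ultimately have "?D z = 0" using annih_injective_zero[OF _ _ cG G(2) z] by blast
    then show ?thesis using z by (simp add: e_def)
  qed
  have "holo_fun (\<lambda>z. cnj (h z)) \<Omega>"
    by (rule holo_fun_cong[OF \<Omega> _ bergman_holo[OF SB[OF e]]]) (simp add: key[OF e] e_def)
  note const = holo_cnj_holo_const[OF \<Omega> conn(1) bergman_holo[OF h(1)] this]
  obtain z0 where z0: "z0 \<in> \<Omega>" using ne by blast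
  show "\<exists>c. \<forall>f\<in>B. S f = (\<lambda>z. c * f z)"
  proof (intro exI ballI ext)
    fix f z assume f: "f \<in> B"
    show "S f z = cnj (h z0) * f z"
      using key[OF f, of z] const[of z z0] z0 bergman_outside[OF f, of z] bergman_outside[OF SB[OF f], of z]
      by (cases "z \<in> \<Omega>") (auto simp: mult.commute)
  qed
qed

end

theorem theorem1p4:
  fixes \<Omega> \<Omega>' :: "(complex^'d) set" and \<Phi> :: "complex^'d \<Rightarrow> complex^'d"
  assumes "cdomain \<Omega>" and "cdomain \<Omega>'"
    and "bounded \<Omega>" and "bounded \<Omega>'"
    and "holo_map \<Phi> \<Omega>"
    and "proper_map \<Phi> \<Omega> \<Omega>'"
  shows "\<not> vN_trivial \<Phi> \<Omega> \<longleftrightarrow> \<not> biholomorphic \<Phi> \<Omega> \<Omega>'"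
proof -
  interpret proper_holo_bounded \<Omega> \<Omega>' \<Phi>
    using assms unfolding cdomain_def by unfold_locales auto
  show ?thesis using vN_trivial_imp_biholomorphic biholomorphic_imp_vN_trivial by blast
qed

end
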